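(* Let $(R,\mathfrak m,\mathsf k)$ be an Artinian local ring with canonical module $\omega$, and write $R\simeq T/\mathfrak b$, where $(T,\mathfrak m_T,\mathsf k)$ is a regular local ring and $\mathfrak b$ is an $\mathfrak m_T$-primary ideal. Let $\mathfrak a$ be an ideal in $T$ and let $\mathfrak d\subseteq\mathfrak a$ be an ideal generated by a system of parameters such that (a) there is an injective map $\phi:\overline{\mathfrak d}\hookrightarrow\overline{\mathfrak a}^\vee$ satisfying $\phi(\overline x)(\overline y)=\phi(\overline y)(\overline x)$ for all $x,y\in\mathfrak d$; (b) $\mathfrak b\subseteq\mathfrak a\mathfrak d$; and (c) $(\mathfrak b:_T\mathfrak a)\subseteq\mathfrak d$. Then there is a Gorenstein Artin ring $S$ mapping onto $R$ such that $\lambda(S)-\lambda(R)=\lambda(R/\overline{\mathfrak a})$, i.e., $g(R)\leq\lambda(R/\overline{\mathfrak a})$.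
   Context: Rings are commutative, maps of $R$-modules are $R$-linear, and $\lambda$ denotes length. For an Artinian local ring $R$ with residue field $\mathsf k$, the canonical module $\omega$ is the injective hull of $\mathsf k$ over $R$, and $M^\vee:=\mathrm{Hom}_R(M,\omega)$ for an $R$-module $M$. A bar denotes passage modulo $\mathfrak b$: $\overline x=x+\mathfrak b\in R$ for $x\in T$, and $\overline{J}=(J+\mathfrak b)/\mathfrak b\subseteq R$ for an ideal $J\subseteq T$. The Gorenstein colength of $R$ is $g(R)=\min\{\lambda(S)-\lambda(R): S\text{ is a Gorenstein Artin local ring mapping onto } R\}$; the embedding dimension of $S$ is not required to equal that of $R$.
   Formalization: The ideal 𝔞 is assumed to be proper (𝔞 ≠ T); for 𝔞 = T the claim fails, e.g. T = k[[x,y]], 𝔟 = (x², xy, y³), 𝔡 = (x², y), where it would force the non-Gorenstein ring R to be Gorenstein. *)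

theory Defs
  imports "HOL-Algebra.Algebra" "HOL-Library.Extended_Nat"
begin

section \<open>Modules\<close>

text \<open>
  Records of type \<open>module\<close> inherit the fields \<open>mult\<close> and \<open>one\<close> from rings; the locale
  \<open>module\<close> ignores them, and they are left unspecified where no natural choice exists.
\<close>

definition ring_module :: "('a, 'c) ring_scheme \<Rightarrow> ('a, 'a) module" where
  "ring_module R =
     \<lparr>carrier = carrier R, monoid.mult = monoid.mult R, one = one R, ring.zero = ring.zero R, add = add R,
      smult = monoid.mult R\<rparr>"

definition ideal_module :: "('a, 'c) ring_scheme \<Rightarrow> 'a set \<Rightarrow> ('a, 'a) module" where
  "ideal_module R I = (ring_module R)\<lparr>carrier := I\<rparr>"

definition quotient_module :: "('a, 'b, 'd) module_scheme \<Rightarrow> 'b set \<Rightarrow> ('a, 'b set) module" where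
  "quotient_module M N =
     \<lparr>carrier = a_rcosets\<^bsub>M\<^esub> N, monoid.mult = undefined, one = undefined, ring.zero = N, add = set_add M,
      smult = (\<lambda>r C. \<Union>x\<in>C. N +>\<^bsub>M\<^esub> (r \<odot>\<^bsub>M\<^esub> x))\<rparr>"

text \<open>
  Homomorphisms are taken extensional (\<open>undefined\<close> off the carrier), so that equality of
  elements of \<open>Hom(M, N)\<close> is equality of maps.
\<close>

definition mod_hom ::
  "('a, 'c) ring_scheme \<Rightarrow> ('a, 'b, 'd) module_scheme \<Rightarrow> ('a, 'e, 'f) module_scheme \<Rightarrow> ('b \<Rightarrow> 'e) set"
where
  "mod_hom R M N =
     {f \<in> carrier M \<rightarrow>\<^sub>E carrier N.
        (\<forall>x\<in>carrier M. \<forall>y\<in>carrier M. f (x \<oplus>\<^bsub>M\<^esub> y) = f x \<oplus>\<^bsub>N\<^esub> f y) \<and>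
        (\<forall>r\<in>carrier R. \<forall>x\<in>carrier M. f (r \<odot>\<^bsub>M\<^esub> x) = r \<odot>\<^bsub>N\<^esub> f x)}"

definition hom_module ::
  "('a, 'c) ring_scheme \<Rightarrow> ('a, 'b, 'd) module_scheme \<Rightarrow> ('a, 'e, 'f) module_scheme \<Rightarrow>
     ('a, 'b \<Rightarrow> 'e) module"
where
  "hom_module R M N =
     \<lparr>carrier = mod_hom R M N, monoid.mult = undefined, one = undefined,
      ring.zero = (\<lambda>x\<in>carrier M. \<zero>\<^bsub>N\<^esub>),
      add = (\<lambda>f g. \<lambda>x\<in>carrier M. f x \<oplus>\<^bsub>N\<^esub> g x),
      smult = (\<lambda>r f. \<lambda>x\<in>carrier M. r \<odot>\<^bsub>N\<^esub> f x)\<rparr>"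

text \<open>Length is the supremum of the lengths of strictly increasing chains of submodules.\<close>

definition module_length :: "('a, 'c) ring_scheme \<Rightarrow> ('a, 'b, 'd) module_scheme \<Rightarrow> enat" where
  "module_length R M =
     Sup {enat n | n. \<exists>N :: nat \<Rightarrow> 'b set.
       (\<forall>i\<le>n. submodule (N i) R M) \<and> (\<forall>i<n. N i \<subset> N (Suc i))}"

text \<open>
  Quantification over types is not available, so the test modules \<open>A\<close>, \<open>B\<close> range over all
  modules carried by subsets of the ring's own type.  As this includes all inclusions of
  ideals into \<open>R\<close>, Baer's criterion shows that the result does not depend on this choice of
  universe: an injective module in this sense has the extension property for all \<open>R\<close>-modules.
\<close>

definition injective_module :: "('a, 'c) ring_scheme \<Rightarrow> ('a, 'b, 'd) module_scheme \<Rightarrow> bool" where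
  "injective_module R M \<longleftrightarrow> module R M \<and>
     (\<forall>(A :: ('a, 'a) module) (B :: ('a, 'a) module) i f.
        module R A \<and> module R B \<and> i \<in> mod_hom R A B \<and> inj_on i (carrier A) \<and> f \<in> mod_hom R A M
        \<longrightarrow> (\<exists>g\<in>mod_hom R B M. \<forall>a\<in>carrier A. g (i a) = f a))"

definition injective_hull ::
  "('a, 'c) ring_scheme \<Rightarrow> ('a, 'b, 'd) module_scheme \<Rightarrow> ('a, 'e, 'f) module_scheme \<Rightarrow> bool"
where
  "injective_hull R M E \<longleftrightarrow> injective_module R E \<and>
     (\<exists>i\<in>mod_hom R M E. inj_on i (carrier M) \<and>
        (\<forall>U. submodule U R E \<and> U \<inter> i ` carrier M = {\<zero>\<^bsub>E\<^esub>} \<longrightarrow> U = {\<zero>\<^bsub>E\<^esub>}))"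


section \<open>Ideals\<close>

definition colon_ideal :: "('a, 'c) ring_scheme \<Rightarrow> 'a set \<Rightarrow> 'a set \<Rightarrow> 'a set" where
  "colon_ideal R I J = {x \<in> carrier R. \<forall>y\<in>J. x \<otimes>\<^bsub>R\<^esub> y \<in> I}"

definition radical :: "('a, 'c) ring_scheme \<Rightarrow> 'a set \<Rightarrow> 'a set" where
  "radical R I = {x \<in> carrier R. \<exists>n::nat. x [^]\<^bsub>R\<^esub> n \<in> I}"

definition primary_ideal :: "('a, 'c) ring_scheme \<Rightarrow> 'a set \<Rightarrow> bool" where
  "primary_ideal R Q \<longleftrightarrow> ideal Q R \<and> Q \<noteq> carrier R \<and>
     (\<forall>x\<in>carrier R. \<forall>y\<in>carrier R. x \<otimes>\<^bsub>R\<^esub> y \<in> Q \<longrightarrow> x \<in> Q \<or> y \<in> radical R Q)"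

text \<open>\<open>Q\<close> is \<open>P\<close>-primary.\<close>

definition primary_to :: "('a, 'c) ring_scheme \<Rightarrow> 'a set \<Rightarrow> 'a set \<Rightarrow> bool" where
  "primary_to R P Q \<longleftrightarrow> primary_ideal R Q \<and> radical R Q = P"

definition krull_dim :: "('a, 'c) ring_scheme \<Rightarrow> enat" where
  "krull_dim R =
     Sup {enat n | n. \<exists>P :: nat \<Rightarrow> 'a set.
       (\<forall>i\<le>n. primeideal (P i) R) \<and> (\<forall>i<n. P i \<subset> P (Suc i))}"


section \<open>Local rings\<close>

definition local_ring :: "('a, 'c) ring_scheme \<Rightarrow> 'a set \<Rightarrow> bool" where
  "local_ring R \<mm> \<longleftrightarrow> cring R \<and> maximalideal \<mm> R \<and> (\<forall>I. maximalideal I R \<longrightarrow> I = \<mm>)"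

definition artinian_local_ring :: "('a, 'c) ring_scheme \<Rightarrow> 'a set \<Rightarrow> bool" where
  "artinian_local_ring R \<mm> \<longleftrightarrow> local_ring R \<mm> \<and>
     (\<forall>I :: nat \<Rightarrow> 'a set. (\<forall>n. ideal (I n) R \<and> I (Suc n) \<subseteq> I n) \<longrightarrow> (\<exists>n. \<forall>k\<ge>n. I k = I n))"

definition regular_local_ring :: "('a, 'c) ring_scheme \<Rightarrow> 'a set \<Rightarrow> bool" where
  "regular_local_ring R \<mm> \<longleftrightarrow> local_ring R \<mm> \<and> noetherian_ring R \<and>
     (\<exists>A. finite A \<and> A \<subseteq> carrier R \<and> enat (card A) = krull_dim R \<and> genideal R A = \<mm>)"

definition system_of_parameters :: "('a, 'c) ring_scheme \<Rightarrow> 'a set \<Rightarrow> 'a set \<Rightarrow> bool" where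
  "system_of_parameters R \<mm> A \<longleftrightarrow>
     finite A \<and> A \<subseteq> \<mm> \<and> enat (card A) = krull_dim R \<and> primary_to R \<mm> (genideal R A)"

definition residue_field_module :: "('a, 'c) ring_scheme \<Rightarrow> 'a set \<Rightarrow> ('a, 'a set) module" where
  "residue_field_module R \<mm> = quotient_module (ring_module R) \<mm>"

text \<open>The canonical module of an Artinian local ring, determined up to isomorphism.\<close>

definition canonical_module ::
  "('a, 'c) ring_scheme \<Rightarrow> 'a set \<Rightarrow> ('a, 'b, 'd) module_scheme \<Rightarrow> bool"
where
  "canonical_module R \<mm> \<omega> \<longleftrightarrow> injective_hull R (residue_field_module R \<mm>) \<omega>"

text \<open>
  An Artinian local ring is Gorenstein if it is isomorphic to its canonical module, i.e. if it
  is a canonical module of itself.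
\<close>

definition gorenstein_artin_local_ring :: "('a, 'c) ring_scheme \<Rightarrow> bool" where
  "gorenstein_artin_local_ring S \<longleftrightarrow>
     (\<exists>\<nn>. artinian_local_ring S \<nn> \<and> canonical_module S \<nn> (ring_module S))"

definition maps_onto :: "('a, 'c) ring_scheme \<Rightarrow> ('b, 'd) ring_scheme \<Rightarrow> bool" where
  "maps_onto S R \<longleftrightarrow> (\<exists>h\<in>ring_hom S R. h ` carrier S = carrier R)"

definition ring_length :: "('a, 'c) ring_scheme \<Rightarrow> enat" where
  "ring_length R = module_length R (ring_module R)"

text \<open>
  The rings \<open>S\<close> range over rings carried by subsets of \<open>'a list\<close>, where \<open>'a\<close> is the type of
  \<open>R\<close>.  This is no restriction: an Artinian local ring \<open>S\<close> mapping onto \<open>R\<close> has the same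
  residue field \<open>k\<close> as \<open>R\<close>, hence at most \<open>\<bar>k\<bar> ^ n \<le> \<bar>R\<bar> ^ n\<close> elements, \<open>n\<close> the length of \<open>S\<close>,
  so it is isomorphic to a ring of this kind.  The lengths of \<open>S\<close> and \<open>R\<close> are finite with that
  of \<open>R\<close> at most that of \<open>S\<close>, so the subtraction is neither truncated nor infinite; the infimum
  of a nonempty set of \<open>enat\<close> is its minimum.
\<close>

definition gorenstein_colength :: "('a, 'c) ring_scheme \<Rightarrow> enat" where
  "gorenstein_colength R =
     Inf {ring_length S - ring_length R | S :: 'a list ring.
            gorenstein_artin_local_ring S \<and> maps_onto S R}"

end

theory Submission
  imports Defs
begin

text \<open>
  Write \<open>B x y = \<phi> x y\<close> for \<open>x \<in> \<dd>\<close>, \<open>y \<in> \<aa>\<close>. In the regular ring \<open>T\<close> the ideal \<open>\<dd>\<close> has as many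
  generators \<open>x\<^sub>1, \<dots>, x\<^sub>n\<close> as the length of a regular sequence inside it, so its Koszul complex is
  exact and every syzygy of the \<open>x\<^sub>i\<close> is a Koszul syzygy. As \<open>B\<close> is symmetric on \<open>\<dd>\<close>, the map
  \<open>\<Sum> x\<^sub>i y\<^sub>i \<mapsto> \<Sum> B x\<^sub>i y\<^sub>i\<close> on \<open>\<aa>\<dd>\<close> is well defined, and injectivity of \<open>\<omega>\<close> extends it to
  \<open>\<Psi> : \<aa> \<rightarrow> \<omega>\<close>. An element of \<open>T\<close> that kills the image of \<open>\<Psi>\<close> but is not in \<open>\<bb>\<close> has a multiple
  representing a nonzero socle element of \<open>R\<close>; this multiple lies in \<open>\<bb> : \<aa> \<subseteq> \<dd>\<close>, where it
  contradicts the injectivity of \<open>\<phi>\<close>. So for \<open>\<cc> = ker \<Psi>\<close> we get \<open>\<cc> \<subseteq> \<bb> = \<cc> : \<aa>\<close>, and the socle of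
  \<open>S = T/\<cc>\<close> embeds into that of \<open>\<omega>\<close>, hence is simple. Annihilators in the Gorenstein ring \<open>S\<close> give
  \<open>\<lambda>(\<bb>/\<cc>) = \<lambda>(T/\<aa>)\<close>.
\<close>

text \<open>Regularity is given only as a count: the maximal ideal of \<open>T\<close> has as many
  generators as the Krull dimension. That \<open>T\<close> is Cohen-Macaulay must be earned, from
  Krull's principal ideal theorem: it makes these generators a regular sequence, and a common power
  of them falls into \<open>\<dd>\<close> and is still regular. The generators of
  \<open>\<dd>\<close> are never themselves shown to be regular, since depth sensitivity of the
  Koszul complex only asks for some regular sequence of the same length inside the ideal.

  The coefficients of a relation among the generators of \<open>\<dd>\<close> lie a priori only in
  \<open>\<aa>\<close>, where the pairing has no symmetry. But a Koszul syzygy has all its entries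
  in \<open>\<dd>\<close>, so symmetry on \<open>\<dd>\<close> is enough.

  The colength ranges over rings carried by lists over \<open>R\<close>, whereas
  \<open>T/\<cc>\<close> lives on sets of elements of \<open>T\<close>. So \<open>S\<close> is a
  copy of \<open>T/\<cc>\<close> whose elements are coded by lists over \<open>R\<close>.\<close>

no_notation Sum_Type.Plus (infixr "<+>" 65)

section \<open>Ideals and saturation\<close>

text \<open>
  Localization at a prime \<open>P\<close> is avoided: the ideals of the localization correspond to the
  \<open>P\<close>-saturated ideals of \<open>R\<close>.
\<close>

definition saturated :: "('a, 'c) ring_scheme \<Rightarrow> 'a set \<Rightarrow> 'a set \<Rightarrow> bool" where
  "saturated R P I \<longleftrightarrow> ideal I R \<and> (\<forall>s\<in>carrier R - P. \<forall>x\<in>carrier R. s \<otimes>\<^bsub>R\<^esub> x \<in> I \<longrightarrow> x \<in> I)"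

definition saturation :: "('a, 'c) ring_scheme \<Rightarrow> 'a set \<Rightarrow> 'a set \<Rightarrow> 'a set" where
  "saturation R P I = {x \<in> carrier R. \<exists>s\<in>carrier R - P. s \<otimes>\<^bsub>R\<^esub> x \<in> I}"

context cring
begin

lemma diff_zeroD:
  "x \<in> carrier R \<Longrightarrow> y \<in> carrier R \<Longrightarrow> x \<ominus> y = \<zero> \<Longrightarrow> x = y"
  using r_right_minus_eq by blast

lemma ideal_carr: "ideal I R \<Longrightarrow> x \<in> I \<Longrightarrow> x \<in> carrier R"
  by (rule ideal.Icarr)

lemma ideal_sub: "ideal I R \<Longrightarrow> I \<subseteq> carrier R"
  using ideal_carr by blast

lemma ideal_zero: "ideal I R \<Longrightarrow> \<zero> \<in> I"
  by (simp add: additive_subgroup.zero_closed ideal.axioms(1))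

lemma ideal_add: "ideal I R \<Longrightarrow> x \<in> I \<Longrightarrow> y \<in> I \<Longrightarrow> x \<oplus> y \<in> I"
  by (simp add: additive_subgroup.a_closed ideal.axioms(1))

lemma ideal_neg: "ideal I R \<Longrightarrow> x \<in> I \<Longrightarrow> \<ominus> x \<in> I"
  by (simp add: additive_subgroup.a_inv_closed ideal.axioms(1))

lemma ideal_minus: "ideal I R \<Longrightarrow> x \<in> I \<Longrightarrow> y \<in> I \<Longrightarrow> x \<ominus> y \<in> I"
  by (simp add: a_minus_def ideal_add ideal_neg)

lemma ideal_mult: "ideal I R \<Longrightarrow> x \<in> I \<Longrightarrow> r \<in> carrier R \<Longrightarrow> r \<otimes> x \<in> I"
  by (simp add: ideal.I_l_closed)

lemma ideal_mult': "ideal I R \<Longrightarrow> x \<in> I \<Longrightarrow> r \<in> carrier R \<Longrightarrow> x \<otimes> r \<in> I"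
  by (simp add: ideal.I_r_closed)

lemma ideal_cancel:
  assumes "ideal I R" "x \<oplus> y \<in> I" "y \<in> I" "x \<in> carrier R"
  shows "x \<in> I"
proof -
  have y: "y \<in> carrier R" using assms ideal_carr by blast
  have "(x \<oplus> y) \<ominus> y = x" using y assms(4) by algebra
  then show ?thesis using ideal_minus[OF assms(1-3)] by simp
qed

lemma idealI':
  assumes "I \<subseteq> carrier R" "\<zero> \<in> I" "\<And>x y. x \<in> I \<Longrightarrow> y \<in> I \<Longrightarrow> x \<oplus> y \<in> I"
    "\<And>r x. r \<in> carrier R \<Longrightarrow> x \<in> I \<Longrightarrow> r \<otimes> x \<in> I"
  shows "ideal I R"
proof (rule idealI[OF ring_axioms])
  have neg: "\<ominus> x \<in> I" if "x \<in> I" for x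
  proof -
    have x: "x \<in> carrier R" using that assms(1) by blast
    then have "\<ominus> x = (\<ominus> \<one>) \<otimes> x" by algebra
    then show ?thesis using assms(4)[of "\<ominus> \<one>" x] that by simp
  qed
  show "subgroup I (add_monoid R)"
    by (rule group.subgroupI[OF add.is_group]) (use assms neg in \<open>auto simp: a_inv_def[symmetric]\<close>)
  show "x \<otimes> a \<in> I" "a \<otimes> x \<in> I" if "a \<in> I" "x \<in> carrier R" for a x
    using that assms(1,4) m_comm[of a x] by auto
qed

lemma mem_add_PIdl_iff:
  "z \<in> I <+> PIdl x \<longleftrightarrow> (\<exists>i\<in>I. \<exists>r\<in>carrier R. z = i \<oplus> r \<otimes> x)"
  unfolding set_add_def' cgenideal_def by auto

lemma add_PIdl_ideal: "ideal I R \<Longrightarrow> x \<in> carrier R \<Longrightarrow> ideal (I <+> PIdl x) R"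
  by (simp add: add_ideals cgenideal_ideal)

lemma sub_add_ideals:
  assumes "ideal I R" "ideal J R"
  shows "I \<subseteq> I <+> J" "J \<subseteq> I <+> J"
proof -
  show "I \<subseteq> I <+> J"
  proof
    fix x assume x: "x \<in> I"
    then have "x = x \<oplus> \<zero>" using ideal_carr[OF assms(1)] by simp
    then show "x \<in> I <+> J" using x ideal_zero[OF assms(2)] unfolding set_add_def' by blast
  qed
  show "J \<subseteq> I <+> J"
  proof
    fix x assume x: "x \<in> J"
    then have "x = \<zero> \<oplus> x" using ideal_carr[OF assms(2)] by simp
    then show "x \<in> I <+> J" using x ideal_zero[OF assms(1)] unfolding set_add_def' by blast
  qed
qed

lemma self_in_add_PIdl: "ideal I R \<Longrightarrow> x \<in> carrier R \<Longrightarrow> x \<in> I <+> PIdl x"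
  using sub_add_ideals(2)[OF _ cgenideal_ideal] cgenideal_self by blast

lemma sub_add_PIdl: "ideal I R \<Longrightarrow> x \<in> carrier R \<Longrightarrow> I \<subseteq> I <+> PIdl x"
  using sub_add_ideals(1)[OF _ cgenideal_ideal] by blast

lemma add_ideals_least:
  assumes "ideal K R" "I \<subseteq> K" "J \<subseteq> K"
  shows "I <+> J \<subseteq> K"
  using assms ideal_add[OF assms(1)] unfolding set_add_def' by blast

lemma add_PIdl_least:
  assumes "ideal K R" "I \<subseteq> K" "x \<in> K"
  shows "I <+> PIdl x \<subseteq> K"
  by (rule add_ideals_least[OF assms(1,2)]) (rule cgenideal_minimal[OF assms(1,3)])

lemma primeD:
  assumes "primeideal P R"
  shows "ideal P R" "\<one> \<notin> P" "P \<noteq> carrier R"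
    and "\<And>x y. x \<in> carrier R \<Longrightarrow> y \<in> carrier R \<Longrightarrow> x \<otimes> y \<in> P \<Longrightarrow> x \<in> P \<or> y \<in> P"
  using assms primeideal.axioms(1) primeideal.I_notcarr primeideal.I_prime ideal.one_imp_carrier
  by metis+

lemma prime_compl:
  assumes "primeideal P R" "s \<in> carrier R - P" "s' \<in> carrier R - P"
  shows "s \<otimes> s' \<in> carrier R - P"
  using primeD(4)[OF assms(1)] assms by auto

lemma prime_pow:
  assumes "primeideal P R" "x \<in> carrier R" "x [^] (n::nat) \<in> P"
  shows "x \<in> P"
  using assms(3)
proof (induction n)
  case 0
  then show ?case using primeD(2)[OF assms(1)] by simp
next
  case (Suc n)
  then show ?case using primeD(4)[OF assms(1), of "x [^] n" x] assms(2) by auto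
qed

lemma saturatedD:
  assumes "saturated R P I"
  shows "ideal I R" "\<And>s x. s \<in> carrier R \<Longrightarrow> s \<notin> P \<Longrightarrow> x \<in> carrier R \<Longrightarrow> s \<otimes> x \<in> I \<Longrightarrow> x \<in> I"
  using assms unfolding saturated_def by auto

lemma saturated_mono: "saturated R P I \<Longrightarrow> P \<subseteq> P' \<Longrightarrow> saturated R P' I"
  unfolding saturated_def by blast

lemma saturated_Int: "saturated R P I \<Longrightarrow> saturated R P J \<Longrightarrow> saturated R P (I \<inter> J)"
  unfolding saturated_def using i_intersect by blast

lemma saturated_carrier: "saturated R P (carrier R)"
  unfolding saturated_def using oneideal by blast

text \<open>Elements outside \<open>P\<close> act as units: one of them in \<open>I\<close>, tested
  against \<open>\<one>\<close>, puts \<open>\<one>\<close> into \<open>I\<close>. When the elements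
  outside \<open>P\<close> are honest units, this says that every proper ideal lies in
  \<open>P\<close>.\<close>

lemma saturated_proper:
  assumes "saturated R P I" "I \<noteq> carrier R"
  shows "I \<subseteq> P"
proof
  fix x assume x: "x \<in> I"
  show "x \<in> P"
  proof (rule ccontr)
    assume "x \<notin> P"
    then have "\<one> \<in> I"
      using saturatedD(2)[OF assms(1), of x \<one>] x ideal_carr[OF saturatedD(1)[OF assms(1)]] by auto
    then show False using assms(2) ideal.one_imp_carrier[OF saturatedD(1)[OF assms(1)]] by blast
  qed
qed

text \<open>The complement of a prime is multiplicative, so two denominators can be replaced by
  their product; this gives closure under sums as well as idempotence.\<close>

lemma saturated_saturation:
  assumes P: "primeideal P R" and I: "ideal I R"
  shows "saturated R P (saturation R P I)"
  unfolding saturated_def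
proof (intro conjI ballI impI idealI')
  note [simp] = ideal_carr[OF I]
  show "saturation R P I \<subseteq> carrier R" unfolding saturation_def by blast
  show "\<zero> \<in> saturation R P I" unfolding saturation_def using primeD[OF P] ideal_zero[OF I] by force
  fix x y assume "x \<in> saturation R P I" "y \<in> saturation R P I"
  then obtain s s' where s: "s \<in> carrier R - P" "s' \<in> carrier R - P" "s \<otimes> x \<in> I" "s' \<otimes> y \<in> I"
    and xy: "x \<in> carrier R" "y \<in> carrier R" unfolding saturation_def by blast
  have sc: "s \<in> carrier R" "s' \<in> carrier R" using s by auto
  have "(s \<otimes> s') \<otimes> (x \<oplus> y) = s' \<otimes> (s \<otimes> x) \<oplus> s \<otimes> (s' \<otimes> y)"
    using sc xy by algebra
  also have "\<dots> \<in> I" using s by (auto intro!: ideal_add[OF I] ideal_mult[OF I])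
  finally show "x \<oplus> y \<in> saturation R P I"
    unfolding saturation_def using prime_compl[OF P s(1,2)] xy by blast
next
  fix r x assume r: "r \<in> carrier R" and "x \<in> saturation R P I"
  then obtain s where s: "s \<in> carrier R - P" "s \<otimes> x \<in> I" and x: "x \<in> carrier R"
    unfolding saturation_def by blast
  have "s \<otimes> (r \<otimes> x) = r \<otimes> (s \<otimes> x)" using s r x m_lcomm by auto
  then have "s \<otimes> (r \<otimes> x) \<in> I" using ideal_mult[OF I s(2) r] by simp
  then show "r \<otimes> x \<in> saturation R P I" unfolding saturation_def using s r x by blast
next
  fix s x assume s: "s \<in> carrier R - P" and x: "x \<in> carrier R" and "s \<otimes> x \<in> saturation R P I"
  then obtain s' where s': "s' \<in> carrier R - P" "s' \<otimes> (s \<otimes> x) \<in> I" unfolding saturation_def by blast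
  then have "(s' \<otimes> s) \<otimes> x \<in> I" using s x m_assoc by auto
  then show "x \<in> saturation R P I" unfolding saturation_def using prime_compl[OF P s'(1) s] x by blast
qed

lemma sub_saturation:
  assumes P: "primeideal P R" and I: "ideal I R"
  shows "I \<subseteq> saturation R P I"
proof
  fix x assume "x \<in> I"
  then show "x \<in> saturation R P I"
    unfolding saturation_def using primeD(2)[OF P] ideal_carr[OF I]
    by (auto intro!: bexI[of _ \<one>])
qed

lemma saturation_least:
  assumes "saturated R P K" "I \<subseteq> K"
  shows "saturation R P I \<subseteq> K"
  using assms unfolding saturation_def saturated_def by blast

end

locale noetherian_cring = cring R + noetherian_ring R for R (structure)
begin

text \<open>The form in which Noetherian induction is used throughout. Zorn's lemma applies because
  the union of a chain of ideals is already a member of the chain.\<close>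

lemma ideal_maximal_exists:
  assumes "C \<noteq> {}" "\<And>I. I \<in> C \<Longrightarrow> ideal I R"
  obtains M where "M \<in> C" "\<And>I. I \<in> C \<Longrightarrow> M \<subseteq> I \<Longrightarrow> I = M"
proof -
  have "\<exists>M\<in>C. \<forall>K\<in>C. M \<subseteq> K \<longrightarrow> K = M"
  proof (rule subset_Zorn_nonempty[OF assms(1)])
    fix D assume D: "D \<noteq> {}" "subset.chain C D"
    then have sub: "D \<subseteq> C" by (simp add: pred_on.chain_def)
    then have "subset.chain {I. ideal I R} D"
      using assms(2) D(2) by (auto simp: pred_on.chain_def)
    then have "\<Union>D \<in> D" by (rule ideal_chain_is_trivial[OF D(1)])
    then show "\<Union>D \<in> C" using sub by blast
  qed
  then show ?thesis using that by blast
qed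

text \<open>An ideal \<open>J\<close> maximal among those above \<open>I\<close> that miss
  \<open>M\<close> is prime: adjoining \<open>a\<close> or \<open>b\<close> outside \<open>J\<close>
  would meet \<open>M\<close>, and if \<open>a \<otimes> b\<close> were in \<open>J\<close>, the
  product of the two meeting elements would lie in both \<open>J\<close> and
  \<open>M\<close>.\<close>

lemma prime_avoiding:
  assumes I: "ideal I R" and M: "M \<subseteq> carrier R" "\<one> \<in> M" "\<And>x y. x \<in> M \<Longrightarrow> y \<in> M \<Longrightarrow> x \<otimes> y \<in> M"
    and "I \<inter> M = {}"
  obtains P where "primeideal P R" "I \<subseteq> P" "P \<inter> M = {}"
proof -
  let ?C = "{J. ideal J R \<and> I \<subseteq> J \<and> J \<inter> M = {}}"
  obtain J where J: "J \<in> ?C" and Jmax: "\<And>K. K \<in> ?C \<Longrightarrow> J \<subseteq> K \<Longrightarrow> K = J"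
    by (rule ideal_maximal_exists[of ?C]) (use assms in auto)
  have Ji: "ideal J R" using J by blast
  have meet: "\<exists>j\<in>J. \<exists>r\<in>carrier R. j \<oplus> r \<otimes> a \<in> M" if a: "a \<in> carrier R" "a \<notin> J" for a
  proof (rule ccontr)
    assume *: "\<not> ?thesis"
    have "J <+> PIdl a \<in> ?C"
      using add_PIdl_ideal[OF Ji a(1)] sub_add_PIdl[OF Ji a(1)] J *
      by (auto simp: mem_add_PIdl_iff)
    then have "J <+> PIdl a = J" using Jmax sub_add_PIdl[OF Ji a(1)] by blast
    then show False using self_in_add_PIdl[OF Ji a(1)] a(2) by simp
  qed
  have "primeideal J R"
  proof (rule primeidealI[OF Ji cring_axioms])
    show "carrier R \<noteq> J" using J M by blast
    fix a b assume ab: "a \<in> carrier R" "b \<in> carrier R" "a \<otimes> b \<in> J"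
    show "a \<in> J \<or> b \<in> J"
    proof (rule ccontr)
      assume "\<not> ?thesis"
      then obtain i r j q where 1: "i \<in> J" "r \<in> carrier R" "i \<oplus> r \<otimes> a \<in> M"
        and 2: "j \<in> J" "q \<in> carrier R" "j \<oplus> q \<otimes> b \<in> M"
        using meet ab by metis
      have ij: "i \<in> carrier R" "j \<in> carrier R" using 1 2 ideal_carr[OF Ji] by auto
      have "(i \<oplus> r \<otimes> a) \<otimes> (j \<oplus> q \<otimes> b) = i \<otimes> (j \<oplus> q \<otimes> b) \<oplus> (r \<otimes> a) \<otimes> j \<oplus> (r \<otimes> q) \<otimes> (a \<otimes> b)"
        using 1(2) 2(2) ij ab by algebra
      also have "\<dots> \<in> J"
        using 1 2 ij ab by (auto intro!: ideal_add[OF Ji] intro: ideal_mult[OF Ji] ideal_mult'[OF Ji])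
      finally show False using M(3)[OF 1(3) 2(3)] J by blast
    qed
  qed
  then show ?thesis using that J by blast
qed

text \<open>Nakayama's lemma for the localization at \<open>P\<close>.\<close>

lemma saturated_nakayama:
  assumes P: "primeideal P R" and I: "saturated R P I" and N: "saturated R P N" and "I \<subseteq> N"
    and t: "t \<in> P" and sub: "\<And>x. x \<in> N \<Longrightarrow> \<exists>s\<in>carrier R - P. \<exists>i\<in>I. \<exists>y\<in>N. s \<otimes> x = i \<oplus> t \<otimes> y"
  shows "N = I"
proof -
  \<comment> \<open>A maximal member \<open>J\<close> plays the role of a maximal submodule: for
    every \<open>x\<close> of \<open>N\<close> outside \<open>J\<close>, the saturation of
    \<open>J + (x)\<close> is all of \<open>N\<close>.\<close>
  let ?C = "{J. saturated R P J \<and> I \<subseteq> J \<and> J \<subseteq> N \<and> J \<noteq> N}"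
  show ?thesis
  proof (rule ccontr)
    assume "N \<noteq> I"
    then have "I \<in> ?C" using I \<open>I \<subseteq> N\<close> by auto
    then have ne: "?C \<noteq> {}" by blast
    obtain J where J: "J \<in> ?C" and Jmax: "\<And>K. K \<in> ?C \<Longrightarrow> J \<subseteq> K \<Longrightarrow> K = J"
      by (rule ideal_maximal_exists[OF ne]) (use saturatedD(1) in auto)
    have Js: "saturated R P J" using J by simp
    have Ji: "ideal J R" by (rule saturatedD(1)[OF Js])
    obtain x where x: "x \<in> N" "x \<notin> J" using J by blast
    have xc: "x \<in> carrier R" and tc: "t \<in> carrier R"
      using x ideal_carr saturatedD(1)[OF N] t primeD(1)[OF P] by blast+
    let ?K = "saturation R P (J <+> PIdl x)"
    have sub1: "J \<subseteq> ?K" and xK: "x \<in> ?K"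
      using sub_saturation[OF P add_PIdl_ideal[OF Ji xc]] sub_add_PIdl[OF Ji xc]
        self_in_add_PIdl[OF Ji xc] by auto
    have "?K = N"
    proof (rule ccontr)
      assume "?K \<noteq> N"
      moreover have "?K \<subseteq> N"
        by (rule saturation_least[OF N], rule add_PIdl_least[OF saturatedD(1)[OF N]]) (use J x in auto)
      ultimately have "?K = J"
        using Jmax[of ?K] sub1 saturated_saturation[OF P add_PIdl_ideal[OF Ji xc]] J by blast
      then show False using xK x by blast
    qed
    obtain s i y where s: "s \<in> carrier R" "s \<notin> P" "i \<in> I" "y \<in> N" "s \<otimes> x = i \<oplus> t \<otimes> y"
      using sub[OF x(1)] by blast
    obtain s' j a where s': "s' \<in> carrier R" "s' \<notin> P" "j \<in> J" "a \<in> carrier R" "s' \<otimes> y = j \<oplus> a \<otimes> x"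
      using s(4) \<open>?K = N\<close> unfolding saturation_def mem_add_PIdl_iff by blast
    have c: "i \<in> carrier R" "j \<in> carrier R" "y \<in> carrier R"
      using s s' ideal_carr[OF Ji] ideal_carr[OF saturatedD(1)[OF I]] ideal_carr[OF saturatedD(1)[OF N]] by auto
    \<comment> \<open>Modulo \<open>J\<close>, \<open>s x\<close> is \<open>t y\<close>, and
      \<open>y\<close> is \<open>x\<close> times \<open>a\<close> over \<open>s'\<close>. So
      \<open>s' s - t a\<close> carries \<open>x\<close> into \<open>J\<close>; as \<open>t\<close>
      is in \<open>P\<close> and \<open>s' s\<close> is not, this factor can be cancelled.\<close>
    have "(s' \<otimes> s \<ominus> t \<otimes> a) \<otimes> x = s' \<otimes> (s \<otimes> x) \<ominus> t \<otimes> (a \<otimes> x)"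
      using s(1) s'(1,4) c xc tc by algebra
    also have "\<dots> = s' \<otimes> i \<oplus> t \<otimes> (s' \<otimes> y) \<ominus> t \<otimes> (a \<otimes> x)"
      unfolding s(5) using s(1) s'(1,4) c xc tc by algebra
    also have "\<dots> = s' \<otimes> i \<oplus> t \<otimes> j"
      unfolding s'(5) using s(1) s'(1,4) c xc tc by algebra
    also have "\<dots> \<in> J" using s s' J tc by (auto intro!: ideal_add[OF Ji] intro: ideal_mult[OF Ji])
    finally have *: "(s' \<otimes> s \<ominus> t \<otimes> a) \<otimes> x \<in> J" .
    have "s' \<otimes> s \<ominus> t \<otimes> a \<notin> P"
    proof
      assume "s' \<otimes> s \<ominus> t \<otimes> a \<in> P"
      then have "(s' \<otimes> s \<ominus> t \<otimes> a) \<oplus> t \<otimes> a \<in> P"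
        using ideal_add[OF primeD(1)[OF P]] ideal_mult'[OF primeD(1)[OF P] t] s'(4) by blast
      moreover have "(s' \<otimes> s \<ominus> t \<otimes> a) \<oplus> t \<otimes> a = s' \<otimes> s" using s(1) s'(1,4) tc by algebra
      ultimately show False using prime_compl[OF P, of s' s] s s' by auto
    qed
    then have "x \<in> J" using saturatedD(2)[OF Js _ _ xc *] s s' tc by auto
    then show False using x by blast
  qed
qed

end

section \<open>Chains of saturated ideals\<close>

text \<open>The chain only has to lie between \<open>A\<close> and \<open>B\<close>, whose
  membership in it is not asked for. So \<open>A\<close> and \<open>B\<close> may be arbitrary sets,
  and monotonicity in both is immediate. For saturated \<open>A\<close> and \<open>B\<close> this
  measures the length of \<open>B/A\<close> localized at \<open>P\<close>.\<close>

definition saturated_chain ::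
  "('a, 'c) ring_scheme \<Rightarrow> 'a set \<Rightarrow> 'a set \<Rightarrow> 'a set \<Rightarrow> nat \<Rightarrow> bool" where
  "saturated_chain R P A B n \<longleftrightarrow> (\<exists>N :: nat \<Rightarrow> 'a set.
     (\<forall>i\<le>n. saturated R P (N i)) \<and> (\<forall>i<n. N i \<subset> N (Suc i)) \<and> A \<subseteq> N 0 \<and> N n \<subseteq> B)"

definition saturated_length ::
  "('a, 'c) ring_scheme \<Rightarrow> 'a set \<Rightarrow> 'a set \<Rightarrow> 'a set \<Rightarrow> enat" where
  "saturated_length R P A B = Sup {enat n | n. saturated_chain R P A B n}"

lemma saturated_chainD:
  assumes "saturated_chain R P A B n"
  obtains N where "\<And>i. i \<le> n \<Longrightarrow> saturated R P (N i)" "\<And>i. i < n \<Longrightarrow> N i \<subset> N (Suc i)"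
    "A \<subseteq> N 0" "N n \<subseteq> B"
  using assms unfolding saturated_chain_def by blast

lemma saturated_chain_length: "saturated_chain R P A B n \<Longrightarrow> enat n \<le> saturated_length R P A B"
  unfolding saturated_length_def by (rule Sup_upper) blast

lemma saturated_length_le:
  assumes "\<And>n. saturated_chain R P A B n \<Longrightarrow> enat n \<le> e"
  shows "saturated_length R P A B \<le> e"
  unfolding saturated_length_def by (rule Sup_least) (use assms in blast)

lemma saturated_chain_mono:
  assumes "saturated_chain R P A B n" "A' \<subseteq> A" "B \<subseteq> B'"
  shows "saturated_chain R P A' B' n"
  using assms(1)
proof (rule saturated_chainD)
  fix N assume "\<And>i. i \<le> n \<Longrightarrow> saturated R P (N i)" "\<And>i. i < n \<Longrightarrow> N i \<subset> N (Suc i)"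
    "A \<subseteq> N 0" "N n \<subseteq> B"
  then show ?thesis unfolding saturated_chain_def using assms(2,3) by (intro exI[of _ N]) auto
qed

lemma saturated_length_mono:
  assumes "A' \<subseteq> A" "B \<subseteq> B'"
  shows "saturated_length R P A B \<le> saturated_length R P A' B'"
  by (rule saturated_length_le) (rule saturated_chain_length, rule saturated_chain_mono[OF _ assms])

lemma saturated_chain_take:
  assumes "saturated_chain R P A B n" "m \<le> n"
  shows "saturated_chain R P A B m"
  using assms(1)
proof (rule saturated_chainD)
  fix N assume N: "\<And>i. i \<le> n \<Longrightarrow> saturated R P (N i)" "\<And>i. i < n \<Longrightarrow> N i \<subset> N (Suc i)"
    "A \<subseteq> N 0" "N n \<subseteq> B"
  have "N m \<subseteq> N n"
    using assms(2)
  proof (induction rule: inc_induct)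
    case (step k)
    then show ?case using N(2)[of k] by blast
  qed simp
  then show ?thesis unfolding saturated_chain_def
    using N assms(2) by (intro exI[of _ N]) auto
qed

text \<open>The condition \<open>0 < n\<close> guards against the empty supremum: the length is 0
  also when there is no chain at all.\<close>

lemma saturated_chain_of_length:
  assumes "enat n \<le> saturated_length R P A B" "0 < n"
  shows "saturated_chain R P A B n"
proof (rule ccontr)
  assume *: "\<not> ?thesis"
  have "saturated_length R P A B \<le> enat (n - 1)"
  proof (rule saturated_length_le)
    fix m assume "saturated_chain R P A B m"
    then have "\<not> n \<le> m" using saturated_chain_take * by blast
    then show "enat m \<le> enat (n - 1)" by simp
  qed
  then have "enat n \<le> enat (n - 1)" using assms(1) by (rule order_trans[rotated])
  then show False using assms(2) by simp
qed

lemma saturated_chain_append: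
  assumes "saturated_chain R P A B m" "saturated_chain R P B C n"
  shows "saturated_chain R P A C (m + n)"
  using assms(1)
proof (rule saturated_chainD)
  fix N assume N: "\<And>i. i \<le> m \<Longrightarrow> saturated R P (N i)" "\<And>i. i < m \<Longrightarrow> N i \<subset> N (Suc i)"
    "A \<subseteq> N 0" "N m \<subseteq> B"
  show ?thesis
    using assms(2)
  proof (rule saturated_chainD)
    fix K assume K: "\<And>i. i \<le> n \<Longrightarrow> saturated R P (K i)" "\<And>i. i < n \<Longrightarrow> K i \<subset> K (Suc i)"
      "B \<subseteq> K 0" "K n \<subseteq> C"
    \<comment> \<open>\<open>K 0\<close> is left out because it may coincide with
      \<open>N m\<close>; the step from \<open>N m\<close> to \<open>K 1\<close> is strict in any
      case.\<close>
    let ?L = "\<lambda>i. if i \<le> m then N i else K (i - m)"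
    have "?L i \<subset> ?L (Suc i)" if i: "i < m + n" for i
    proof -
      consider "i < m" | "i = m" "0 < n" | "m < i" using i by linarith
      then show ?thesis
      proof cases
        case 2
        then show ?thesis using N(4) K(2)[of 0] K(3) by auto
      next
        case 3
        then show ?thesis using K(2)[of "i - m"] i by (simp add: Suc_diff_le)
      qed (use N in auto)
    qed
    moreover have "?L (m + n) \<subseteq> C" using N(4) K(3,4) by (cases "n = 0") auto
    ultimately show ?thesis unfolding saturated_chain_def
      using N(1,3) K(1) by (intro exI[of _ ?L]) auto
  qed
qed

lemma saturated_length_append:
  assumes "A \<subseteq> B" "B \<subseteq> C"
  shows "saturated_length R P A B + saturated_length R P B C \<le> saturated_length R P A C"
proof (cases "saturated_length R P A C")
  case (enat k)
  have le: "saturated_length R P A B \<le> enat k" "saturated_length R P B C \<le> enat k"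
    using saturated_length_mono[of A A B C R P] saturated_length_mono[of A B C C R P] assms enat by auto
  then obtain i j where ij: "saturated_length R P A B = enat i" "saturated_length R P B C = enat j"
    by (metis enat_ile)
  \<comment> \<open>A length 0 need not come with a chain, so
    \<open>saturated_chain_of_length\<close> says nothing about it; monotonicity settles this
    case.\<close>
  show ?thesis
  proof (cases "i = 0 \<or> j = 0")
    case True
    then show ?thesis using ij le enat by (auto simp: zero_enat_def[symmetric])
  next
    case False
    then have "saturated_chain R P A C (i + j)"
      by (intro saturated_chain_append[where B = B] saturated_chain_of_length) (use ij in auto)
    then show ?thesis using saturated_chain_length ij by fastforce
  qed
qed simp

lemma saturated_length_self: "saturated_length R P A A = 0"
proof -
  have "saturated_length R P A A \<le> enat 0"
  proof (rule saturated_length_le)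
    fix n assume "saturated_chain R P A A n"
    then show "enat n \<le> enat 0"
    proof (rule saturated_chainD)
      fix N assume N: "\<And>i. i < n \<Longrightarrow> N i \<subset> N (Suc i)" "A \<subseteq> N 0" "N n \<subseteq> A"
      show ?thesis
      proof (cases n)
        case (Suc k)
        have "N 0 \<subseteq> N j" if "j \<le> n" for j
          using that
        proof (induction j)
          case (Suc j)
          then show ?case using N(1)[of j] by auto
        qed simp
        then have "N 0 \<subseteq> N k" using Suc by simp
        then show ?thesis using N(1)[of k] N(2,3) Suc by auto
      qed simp
    qed
  qed
  then show ?thesis by (simp add: zero_enat_def[symmetric])
qed

lemma saturated_chain_1: "saturated R P A \<Longrightarrow> saturated R P B \<Longrightarrow> A \<subset> B \<Longrightarrow> saturated_chain R P A B 1"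
  unfolding saturated_chain_def by (intro exI[of _ "\<lambda>i. if i = 0 then A else B"]) auto

lemma saturated_length_pos:
  assumes "saturated R P A" "saturated R P B" "A \<subset> B"
  shows "1 \<le> saturated_length R P A B"
  using saturated_chain_length[OF saturated_chain_1[OF assms]] by (simp add: one_enat_def)

lemma saturated_length_le_1:
  assumes "\<And>J. saturated R P J \<Longrightarrow> A \<subseteq> J \<Longrightarrow> J \<subseteq> B \<Longrightarrow> J = A \<or> J = B"
  shows "saturated_length R P A B \<le> 1"
  unfolding one_enat_def
proof (rule saturated_length_le)
  fix n assume n: "saturated_chain R P A B n"
  show "enat n \<le> enat 1"
  proof (rule ccontr)
    assume "\<not> enat n \<le> enat 1"
    then have "saturated_chain R P A B 2" using saturated_chain_take[OF n, of 2] by simp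
    then show False
    proof (rule saturated_chainD)
      fix N assume N: "\<And>i. i \<le> 2 \<Longrightarrow> saturated R P (N i)" "\<And>i. i < 2 \<Longrightarrow> N i \<subset> N (Suc i)"
        "A \<subseteq> N 0" "N 2 \<subseteq> B"
      have c: "N 0 \<subset> N 1" "N 1 \<subset> N 2" using N(2)[of 0] N(2)[of 1] by (auto simp: numeral_2_eq_2)
      have sub: "A \<subseteq> N 1" "N 1 \<subseteq> B" using c N(3,4) by auto
      have "N 1 = A \<or> N 1 = B" by (rule assms[OF N(1) sub]) simp
      then show False using c N(3,4) by auto
    qed
  qed
qed

text \<open>Prunes repetitions. Intersecting a chain with \<open>B\<close> or adding
  \<open>B\<close> to it preserves inclusions only weakly, and \<open>saturated_length_split\<close>
  counts the steps that survive.\<close>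

lemma saturated_chain_steps:
  assumes "\<And>i. i \<le> n \<Longrightarrow> saturated R P (N i)" "\<And>i. i < n \<Longrightarrow> N i \<subseteq> N (Suc i)" "A \<subseteq> N 0"
  shows "saturated_chain R P A (N n) (card {i. i < n \<and> N i \<noteq> N (Suc i)})"
  using assms
proof (induction n)
  case 0
  then show ?case unfolding saturated_chain_def by (intro exI[of _ "\<lambda>_. N 0"]) auto
next
  case (Suc n)
  have IH: "saturated_chain R P A (N n) (card {i. i < n \<and> N i \<noteq> N (Suc i)})"
    by (rule Suc.IH) (use Suc.prems in auto)
  show ?case
  proof (cases "N n = N (Suc n)")
    case True
    then have "{i. i < Suc n \<and> N i \<noteq> N (Suc i)} = {i. i < n \<and> N i \<noteq> N (Suc i)}"
      by (auto simp: less_Suc_eq)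
    then show ?thesis using IH True by simp
  next
    case False
    then have "{i. i < Suc n \<and> N i \<noteq> N (Suc i)} = insert n {i. i < n \<and> N i \<noteq> N (Suc i)}"
      by (auto simp: less_Suc_eq)
    moreover have "saturated_chain R P (N n) (N (Suc n)) 1"
      by (rule saturated_chain_1) (use Suc.prems False in \<open>auto simp: psubset_eq\<close>)
    ultimately show ?thesis using saturated_chain_append[OF IH] by fastforce
  qed
qed

context cring
begin

text \<open>The modular law up to saturation: an inclusion that is invisible both after intersecting
  with \<open>B\<close> and after adding \<open>B\<close> is an equality.\<close>

lemma saturated_modular:
  assumes sat: "saturated R P A" and B: "ideal B R" and P: "primeideal P R" and "ideal C R"
    and "A \<subseteq> C" "C \<inter> B \<subseteq> A" "C \<subseteq> saturation R P (A <+> B)"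
  shows "A = C"
proof
  show "C \<subseteq> A"
  proof
    fix y assume y: "y \<in> C"
    then obtain s a b where s: "s \<in> carrier R" "s \<notin> P" "a \<in> A" "b \<in> B" "s \<otimes> y = a \<oplus> b"
      using assms(7) unfolding saturation_def set_add_def' by blast
    have c: "y \<in> carrier R" "a \<in> carrier R" "b \<in> carrier R"
      using y s ideal_carr saturatedD(1)[OF sat] B assms(4) by auto
    have "b = s \<otimes> y \<ominus> a" unfolding s(5) using c by algebra
    then have "b \<in> C" using ideal_minus[OF assms(4)] ideal_mult[OF assms(4) y s(1)] s(3) assms(5) by auto
    then have "s \<otimes> y \<in> A" unfolding s(5) using ideal_add[OF saturatedD(1)[OF sat] s(3)] s(4) assms(6) by auto
    then show "y \<in> A" using saturatedD(2)[OF sat s(1,2) c(1)] by simp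
  qed
qed (rule assms(5))

text \<open>By the modular law, each step of a chain from \<open>A\<close> to \<open>C\<close> stays
  strict in the intersections with \<open>B\<close> or in the saturated sums with \<open>B\<close>.
  The former make a chain below \<open>B\<close>, the latter one above it.\<close>

lemma saturated_length_split:
  assumes P: "primeideal P R" and "saturated R P B" "saturated R P C" "A \<subseteq> B" "B \<subseteq> C"
  shows "saturated_length R P A C \<le> saturated_length R P A B + saturated_length R P B C"
proof (rule saturated_length_le)
  fix n assume "saturated_chain R P A C n"
  then show "enat n \<le> saturated_length R P A B + saturated_length R P B C"
  proof (rule saturated_chainD)
    fix N assume N: "\<And>i. i \<le> n \<Longrightarrow> saturated R P (N i)" "\<And>i. i < n \<Longrightarrow> N i \<subset> N (Suc i)"
      "A \<subseteq> N 0" "N n \<subseteq> C"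
    have Ni: "ideal (N i) R" if "i \<le> n" for i using N(1)[OF that] saturatedD by blast
    have Bi: "ideal B R" using assms(2) saturatedD by blast
    define K where "K i = N i \<inter> B" for i
    define L where "L i = saturation R P (N i <+> B)" for i
    have Ls: "saturated R P (L i)" if "i \<le> n" for i
      unfolding L_def by (rule saturated_saturation[OF P add_ideals[OF Ni[OF that] Bi]])
    have sub: "N i \<subseteq> L i" "B \<subseteq> L i" if "i \<le> n" for i
      unfolding L_def using sub_add_ideals[OF Ni[OF that] Bi]
        sub_saturation[OF P add_ideals[OF Ni[OF that] Bi]] by auto
    have mono: "L i \<subseteq> L (Suc i)" if i: "i < n" for i
    proof -
      have "N i <+> B \<subseteq> L (Suc i)"
        by (rule add_ideals_least) (use Ls[of "Suc i"] saturatedD(1) sub[of "Suc i"] N(2)[OF i] i in auto)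
      then show ?thesis using saturation_least[OF Ls] i unfolding L_def by simp
    qed
    have 1: "saturated_chain R P A (K n) (card {i. i < n \<and> K i \<noteq> K (Suc i)})"
      by (rule saturated_chain_steps)
        (use N saturated_Int assms(2,4) in \<open>auto simp: K_def psubset_eq\<close>)
    have 2: "saturated_chain R P B (L n) (card {i. i < n \<and> L i \<noteq> L (Suc i)})"
      by (rule saturated_chain_steps) (use Ls mono sub in auto)
    have "L n \<subseteq> C"
      unfolding L_def by (rule saturation_least[OF assms(3) add_ideals_least])
        (use saturatedD(1)[OF assms(3)] N(4) assms(5) in auto)
    then have 2: "saturated_chain R P B C (card {i. i < n \<and> L i \<noteq> L (Suc i)})"
      using saturated_chain_mono[OF 2] by blast
    have 1: "saturated_chain R P A B (card {i. i < n \<and> K i \<noteq> K (Suc i)})"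
      using saturated_chain_mono[OF 1] unfolding K_def by blast
    have "{..<n} \<subseteq> {i. i < n \<and> K i \<noteq> K (Suc i)} \<union> {i. i < n \<and> L i \<noteq> L (Suc i)}"
    proof
      fix i assume "i \<in> {..<n}"
      then have i: "i < n" "i \<le> n" "Suc i \<le> n" by auto
      show "i \<in> {i. i < n \<and> K i \<noteq> K (Suc i)} \<union> {i. i < n \<and> L i \<noteq> L (Suc i)}"
      proof (rule ccontr)
        assume "\<not> ?thesis"
        then have eq: "K i = K (Suc i)" "L i = L (Suc i)" using i by auto
        have "N i = N (Suc i)"
          by (rule saturated_modular[OF N(1)[OF i(2)] Bi P Ni[OF i(3)]])
            (use eq sub[OF i(3)] N(2)[OF i(1)] in \<open>auto simp: K_def L_def\<close>)
        then show False using N(2)[OF i(1)] by simp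
      qed
    qed
    then have "card {..<n} \<le> card ({i. i < n \<and> K i \<noteq> K (Suc i)} \<union> {i. i < n \<and> L i \<noteq> L (Suc i)})"
      by (intro card_mono) auto
    also have "\<dots> \<le> card {i. i < n \<and> K i \<noteq> K (Suc i)} + card {i. i < n \<and> L i \<noteq> L (Suc i)}"
      by (rule card_Un_le)
    finally have "enat n \<le> enat (card {i. i < n \<and> K i \<noteq> K (Suc i)}) + enat (card {i. i < n \<and> L i \<noteq> L (Suc i)})"
      by simp
    also have "\<dots> \<le> saturated_length R P A B + saturated_length R P B C"
      by (rule add_mono[OF saturated_chain_length[OF 1] saturated_chain_length[OF 2]])
    finally show ?thesis .
  qed
qed

lemma saturated_length_add:
  assumes "primeideal P R" "saturated R P B" "saturated R P C" "A \<subseteq> B" "B \<subseteq> C"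
  shows "saturated_length R P A C = saturated_length R P A B + saturated_length R P B C"
  using saturated_length_split[OF assms] saturated_length_append[OF assms(4,5)] by (rule antisym)

text \<open>Modulo \<open>I\<close> the element \<open>x\<close> is killed by \<open>P\<close>, so
  locally it spans at most a copy of the residue field: an element of \<open>J\<close> outside
  \<open>I\<close> brings some \<open>r x\<close> with \<open>r\<close> outside \<open>P\<close>
  into \<open>J\<close>, and then \<open>x\<close> itself.\<close>

lemma saturated_length_simple:
  assumes P: "primeideal P R" and I: "saturated R P I" and x: "x \<in> carrier R"
    and Px: "\<And>p. p \<in> P \<Longrightarrow> p \<otimes> x \<in> I"
  shows "saturated_length R P I (saturation R P (I <+> PIdl x)) \<le> 1"
proof (rule saturated_length_le_1)
  fix J assume J: "saturated R P J" "I \<subseteq> J" "J \<subseteq> saturation R P (I <+> PIdl x)"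
  have Ii: "ideal I R" and Ji: "ideal J R" using I J saturatedD by blast+
  show "J = I \<or> J = saturation R P (I <+> PIdl x)"
  proof (cases "J \<subseteq> I")
    case False
    then obtain z where z: "z \<in> J" "z \<notin> I" by blast
    then obtain s i r where s: "s \<in> carrier R" "s \<notin> P" "i \<in> I" "r \<in> carrier R" "s \<otimes> z = i \<oplus> r \<otimes> x"
      using J(3) unfolding saturation_def mem_add_PIdl_iff by blast
    have zc: "z \<in> carrier R" using z ideal_carr[OF Ji] by blast
    have "r \<notin> P"
    proof
      assume "r \<in> P"
      then have "s \<otimes> z \<in> I" unfolding s(5) using ideal_add[OF Ii s(3)] Px by simp
      then show False using saturatedD(2)[OF I s(1,2) zc] z by simp
    qed
    moreover have "r \<otimes> x \<in> J"
    proof (rule ideal_cancel[OF Ji])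
      have "r \<otimes> x \<oplus> i = s \<otimes> z" unfolding s(5) using s x ideal_carr[OF Ii] by (simp add: a_comm)
      then show "r \<otimes> x \<oplus> i \<in> J" using ideal_mult[OF Ji z(1) s(1)] by simp
    qed (use s x J(2) in auto)
    ultimately have "x \<in> J" using saturatedD(2)[OF J(1) s(4) _ x] by simp
    then have "saturation R P (I <+> PIdl x) \<subseteq> J"
      by (intro saturation_least[OF J(1)] add_PIdl_least[OF Ji J(2)])
    then show ?thesis using J(3) by blast
  qed (use J(2) in blast)
qed

end

context noetherian_cring
begin

lemma ideal_annihilator_mod:
  assumes "ideal I R" "y \<in> carrier R"
  shows "ideal {z \<in> carrier R. z \<otimes> y \<in> I} R"
  by (rule idealI') (use assms in \<open>auto simp: ideal_zero l_distr ideal_add m_assoc ideal_mult\<close>)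

text \<open>A nonzero element has a nonzero multiple in the socle, because \<open>P\<close> is
  finitely generated and nil modulo \<open>I\<close>. The generators are treated in turn: each
  contributes the highest power of itself that keeps the multiple outside \<open>I\<close>.\<close>

lemma socle_multiple:
  assumes P: "primeideal P R" and I: "ideal I R" and nil: "\<And>q. q \<in> P \<Longrightarrow> \<exists>n::nat. q [^] n \<in> I"
    and x: "x \<in> carrier R" "x \<notin> I"
  obtains q where "q \<in> carrier R" "q \<otimes> x \<notin> I" "\<And>p. p \<in> P \<Longrightarrow> p \<otimes> (q \<otimes> x) \<in> I"
proof -
  obtain A where A: "A \<subseteq> carrier R" "finite A" "P = Idl A"
    using finetely_gen[OF primeD(1)[OF P]] by blast
  have AP: "A \<subseteq> P" unfolding A(3) by (rule genideal_self[OF A(1)])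
  have "\<exists>q\<in>carrier R. q \<otimes> x \<notin> I \<and> (\<forall>p\<in>A. p \<otimes> (q \<otimes> x) \<in> I)"
    using A(2) AP
  proof (induction A rule: finite_induct)
    case empty
    then show ?case using x by (auto intro!: bexI[of _ \<one>])
  next
    case (insert p A)
    then obtain q where q: "q \<in> carrier R" "q \<otimes> x \<notin> I" "\<forall>p\<in>A. p \<otimes> (q \<otimes> x) \<in> I" by auto
    have pc: "p \<in> carrier R" using insert.prems primeD(1)[OF P] ideal_carr by blast
    let ?Q = "\<lambda>n::nat. p [^] n \<otimes> (q \<otimes> x) \<in> I"
    obtain n where "p [^] (n::nat) \<in> I" using nil insert.prems by blast
    then have "?Q n" using ideal_mult'[OF I] q x by simp
    then have L: "?Q (LEAST n. ?Q n)" by (rule LeastI)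
    have "\<not> ?Q 0" using q x by simp
    then obtain k where k: "(LEAST n. ?Q n) = Suc k" using L by (metis not0_implies_Suc)
    then have nk: "\<not> ?Q k" using not_less_Least[of k ?Q] by simp
    have qx: "q \<otimes> x \<in> carrier R" and pk: "p [^] k \<in> carrier R" using q x pc by auto
    have 1: "(p [^] k \<otimes> q) \<otimes> x = p [^] k \<otimes> (q \<otimes> x)" using q x pk m_assoc by simp
    have 2: "p' \<otimes> (p [^] k \<otimes> (q \<otimes> x)) \<in> I" if "p' \<in> insert p A" for p'
    proof (cases "p' = p")
      case True
      have "p \<otimes> (p [^] k \<otimes> (q \<otimes> x)) = p [^] Suc k \<otimes> (q \<otimes> x)"
        using pc pk qx by (simp add: m_assoc m_lcomm)
      then show ?thesis using L k True by simp
    next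
      case False
      then have p': "p' \<in> A" using that by simp
      then have "p' \<in> carrier R" using insert.prems primeD(1)[OF P] ideal_carr by blast
      then have "p' \<otimes> (p [^] k \<otimes> (q \<otimes> x)) = p [^] k \<otimes> (p' \<otimes> (q \<otimes> x))"
        using pk qx m_lcomm by simp
      then show ?thesis using q(3) p' ideal_mult[OF I _ pk] by simp
    qed
    show ?case using nk 2 q pk 1 by (intro bexI[of _ "p [^] k \<otimes> q"]) auto
  qed
  then obtain q where q: "q \<in> carrier R" "q \<otimes> x \<notin> I" "\<forall>p\<in>A. p \<otimes> (q \<otimes> x) \<in> I" by blast
  have qx: "q \<otimes> x \<in> carrier R" using q x by simp
  have "A \<subseteq> {z \<in> carrier R. z \<otimes> (q \<otimes> x) \<in> I}" using A(1) q(3) by blast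
  then have "P \<subseteq> {z \<in> carrier R. z \<otimes> (q \<otimes> x) \<in> I}"
    unfolding A(3) by (rule genideal_minimal[OF ideal_annihilator_mod[OF I qx]])
  then show ?thesis using that q by blast
qed

text \<open>Were the length infinite, take \<open>I\<close> maximal among the ideals of infinite
  colength. Adjoining a socle element modulo \<open>I\<close> costs length at most 1, so the larger
  ideal would still have infinite colength.\<close>

lemma saturated_length_finite:
  assumes P: "primeideal P R" and K: "saturated R P K" and nil: "\<And>q. q \<in> P \<Longrightarrow> \<exists>n::nat. q [^] n \<in> K"
  shows "saturated_length R P K (carrier R) \<noteq> \<infinity>"
proof
  assume inf: "saturated_length R P K (carrier R) = \<infinity>"
  let ?C = "{I. saturated R P I \<and> K \<subseteq> I \<and> saturated_length R P I (carrier R) = \<infinity>}"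
  have ne: "?C \<noteq> {}" using inf K by auto
  obtain I where I: "I \<in> ?C" and Imax: "\<And>J. J \<in> ?C \<Longrightarrow> I \<subseteq> J \<Longrightarrow> J = I"
    by (rule ideal_maximal_exists[OF ne]) (use saturatedD(1) in auto)
  have Is: "saturated R P I" using I by simp
  have Ii: "ideal I R" by (rule saturatedD(1)[OF Is])
  have "I \<noteq> carrier R" using I saturated_length_self[of R P "carrier R"] by auto
  then obtain x where x: "x \<in> carrier R" "x \<notin> I" using ideal_sub[OF Ii] by blast
  have nilI: "\<exists>n::nat. q [^] n \<in> I" if "q \<in> P" for q using nil[OF that] I by auto
  obtain q where q: "q \<in> carrier R" "q \<otimes> x \<notin> I" "\<And>p. p \<in> P \<Longrightarrow> p \<otimes> (q \<otimes> x) \<in> I"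
    by (rule socle_multiple[OF P Ii nilI x]) auto
  let ?y = "q \<otimes> x"
  let ?J = "saturation R P (I <+> PIdl ?y)"
  have y: "?y \<in> carrier R" using q x by simp
  have Js: "saturated R P ?J" by (rule saturated_saturation[OF P add_PIdl_ideal[OF Ii y]])
  have IJ: "I \<subseteq> ?J" "?y \<in> ?J"
    using sub_saturation[OF P add_PIdl_ideal[OF Ii y]] sub_add_PIdl[OF Ii y] self_in_add_PIdl[OF Ii y] by auto
  have "saturated_length R P I (carrier R) \<le> saturated_length R P I ?J + saturated_length R P ?J (carrier R)"
    by (rule saturated_length_split[OF P Js saturated_carrier IJ(1) ideal_sub[OF saturatedD(1)[OF Js]]])
  moreover have "saturated_length R P I ?J \<le> 1" by (rule saturated_length_simple[OF P Is y q(3)])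
  then have "saturated_length R P I ?J \<noteq> \<infinity>" by (auto simp: one_enat_def enat_ile dest!: enat_ile)
  ultimately have "saturated_length R P ?J (carrier R) = \<infinity>" using I by (auto simp: plus_eq_infty_iff_enat)
  then have "?J \<in> ?C" using Js IJ(1) I by auto
  then have "?J = I" using Imax IJ(1) by blast
  then show False using IJ(2) q(2) by blast
qed

text \<open>The first \<open>n\<close> steps of a strictly descending sequence, read backwards, form
  a chain of length \<open>n\<close> above \<open>K\<close>, for every \<open>n\<close>.\<close>

lemma saturated_dcc:
  assumes P: "primeideal P R" and K: "saturated R P K" and nil: "\<And>q. q \<in> P \<Longrightarrow> \<exists>n::nat. q [^] n \<in> K"
    and E: "\<And>k::nat. saturated R P (E k)" "\<And>k. K \<subseteq> E k" "\<And>k. E (Suc k) \<subseteq> E k"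
  shows "\<exists>k. E (Suc k) = E k"
proof (rule ccontr)
  assume "\<not> ?thesis"
  then have strict: "E (Suc k) \<subset> E k" for k using E(3)[of k] by blast
  have "saturated_chain R P K (carrier R) n" for n
    unfolding saturated_chain_def
  proof (intro exI[of _ "\<lambda>i. E (n - i)"] conjI allI impI)
    fix i assume "i < n"
    then show "E (n - i) \<subset> E (n - Suc i)" using strict[of "n - Suc i"] by (simp add: Suc_diff_Suc)
  next
    show "E (n - n) \<subseteq> carrier R" using ideal_sub saturatedD(1) E(1) by blast
  qed (use E in auto)
  then have *: "enat n \<le> saturated_length R P K (carrier R)" for n by (rule saturated_chain_length)
  obtain m where "saturated_length R P K (carrier R) = enat m"
    using saturated_length_finite[OF P K nil] by auto
  then show False using *[of "Suc m"] by simp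
qed

end

section \<open>Dimension and regular sequences\<close>

lemma (in cring) prime_pow_mult:
  assumes "primeideal P R" "x \<in> carrier R" "y \<in> carrier R" "x [^] (n::nat) \<otimes> y \<in> P" "x \<notin> P"
  shows "y \<in> P"
  using primeD(4)[OF assms(1), of "x [^] n" y] prime_pow[OF assms(1,2), of n] assms by auto

context noetherian_cring
begin

text \<open>Locally, \<open>P\<close> is the only prime over \<open>I\<close>. If no power of
  \<open>q\<close> entered the saturation, the products of powers of \<open>q\<close> with elements
  outside \<open>P\<close> would miss \<open>I\<close>; a prime over \<open>I\<close> avoiding them
  lies in \<open>P\<close> and lacks \<open>q\<close>, against minimality.\<close>

lemma saturation_pow:
  assumes P: "primeideal P R" and I: "ideal I R"
    and none: "\<And>P'. primeideal P' R \<Longrightarrow> I \<subseteq> P' \<Longrightarrow> P' \<subseteq> P \<Longrightarrow> P' = P"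
    and q: "q \<in> P"
  shows "\<exists>n::nat. q [^] n \<in> saturation R P I"
proof (rule ccontr)
  assume none_pow: "\<not> ?thesis"
  have qc: "q \<in> carrier R" using q ideal_carr primeD(1)[OF P] by blast
  let ?M = "{s \<otimes> q [^] (n::nat) | s n. s \<in> carrier R - P}"
  have sub: "?M \<subseteq> carrier R" using qc by auto
  have one: "s \<in> ?M" if "s \<in> carrier R - P" for s
    using that qc by (auto intro!: exI[of _ s] exI[of _ "0::nat"])
  have mult: "x \<otimes> y \<in> ?M" if "x \<in> ?M" "y \<in> ?M" for x y
  proof -
    obtain s m s' n where s: "s \<in> carrier R - P" "x = s \<otimes> q [^] (m::nat)"
      "s' \<in> carrier R - P" "y = s' \<otimes> q [^] (n::nat)" using \<open>x \<in> ?M\<close> \<open>y \<in> ?M\<close> by auto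
    have "(s \<otimes> q [^] m) \<otimes> (s' \<otimes> q [^] n) = (s \<otimes> s') \<otimes> (q [^] m \<otimes> q [^] n)"
      using s qc m_assoc m_lcomm by simp
    also have "\<dots> = (s \<otimes> s') \<otimes> q [^] (m + n)" using qc by (simp add: nat_pow_mult)
    finally show ?thesis unfolding s(2,4) using prime_compl[OF P s(1,3)] by blast
  qed
  have disj: "I \<inter> ?M = {}"
  proof (rule ccontr)
    assume "I \<inter> ?M \<noteq> {}"
    then obtain s n where s: "s \<in> carrier R - P" "s \<otimes> q [^] (n::nat) \<in> I" by blast
    then have "q [^] n \<in> saturation R P I" unfolding saturation_def using qc by auto
    then show False using none_pow by blast
  qed
  have "\<one> \<in> ?M" by (rule one) (use primeD(2)[OF P] in simp)
  then obtain P' where P': "primeideal P' R" "I \<subseteq> P'" "P' \<inter> ?M = {}"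
    by (rule prime_avoiding[OF I sub _ mult disj]) auto
  have "P' \<subseteq> P"
    using P'(3) one ideal_carr[OF primeD(1)[OF P'(1)]] by blast
  then have "P' = P" by (rule none[OF P'(1,2)])
  moreover have "\<one> \<otimes> q [^] (1::nat) \<in> ?M" using primeD(2)[OF P] by blast
  then have "q \<in> ?M" using qc by simp
  ultimately show False using P'(3) q by blast
qed

text \<open>
  Krull's principal ideal theorem. Were there no such \<open>Q'\<close>, ideals saturated with respect to
  \<open>P\<close> and containing \<open>Q\<^sub>0 + (t)\<close> would satisfy the descending chain condition. As \<open>t \<notin> Q\<close>,
  Nakayama's lemma would then make the \<open>Q\<close>-saturations of \<open>Q\<^sub>0 + (y\<^sup>k)\<close> stabilise, for any
  \<open>y \<in> Q - Q\<^sub>0\<close>.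
\<close>

lemma principal_ideal_theorem:
  assumes Q0: "primeideal Q0 R" and Q: "primeideal Q R" and P: "primeideal P R"
    and "Q0 \<subset> Q" "Q \<subset> P" "t \<in> P"
  obtains Q' where "primeideal Q' R" "Q0 \<subset> Q'" "Q' \<subset> P" "t \<in> Q'"
proof (cases "t \<in> Q")
  case True
  then show ?thesis using that[OF Q] assms by blast
next
  case False
  note found = that
  note ids = primeD(1)[OF Q0] primeD(1)[OF Q] primeD(1)[OF P]
  have tc: "t \<in> carrier R" using assms(6) ideal_carr[OF ids(3)] by blast
  let ?I = "Q0 <+> PIdl t"
  have I: "ideal ?I R" by (rule add_PIdl_ideal[OF ids(1) tc])
  have tI: "t \<in> ?I" and Q0I: "Q0 \<subseteq> ?I" by (rule self_in_add_PIdl[OF ids(1) tc], rule sub_add_PIdl[OF ids(1) tc])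
  show ?thesis
  proof (rule ccontr)
    assume "\<not> thesis"
    \<comment> \<open>\<open>P\<close> is minimal over \<open>Q0 + (t)\<close>, since a smaller
      prime above it would be the \<open>Q'\<close> sought. So \<open>P\<close> is nil modulo
      \<open>?K\<close>, and the descending chain condition holds above \<open>?K\<close>.\<close>
    have none: "P' = P" if P': "primeideal P' R" "?I \<subseteq> P'" "P' \<subseteq> P" for P'
    proof (rule ccontr)
      assume "P' \<noteq> P"
      then have "P' \<subset> P" using P'(3) by simp
      moreover have t': "t \<in> P'" using tI P'(2) by (rule subsetD[rotated])
      moreover have "Q0 \<subset> P'" using Q0I P'(2) t' False assms(4) by auto
      ultimately show False using found[OF P'(1)] \<open>\<not> thesis\<close> by simp
    qed
    let ?K = "saturation R P ?I"
    have Ks: "saturated R P ?K" by (rule saturated_saturation[OF P I])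
    obtain y where y: "y \<in> Q" "y \<notin> Q0" using assms(4) by blast
    have yc: "y \<in> carrier R" using y ideal_carr[OF ids(2)] by blast
    define F where "F k = saturation R Q (Q0 <+> PIdl (y [^] (k::nat)))" for k
    define E where "E k = saturation R P (F k <+> ?K)" for k
    have yk: "y [^] (k::nat) \<in> carrier R" for k using yc by simp
    have Fs: "saturated R Q (F k)" for k
      unfolding F_def by (rule saturated_saturation[OF Q add_PIdl_ideal[OF ids(1) yk]])
    have Fi: "ideal (F k) R" for k by (rule saturatedD(1)[OF Fs])
    have FsP: "saturated R P (F k)" for k by (rule saturated_mono[OF Fs]) (use assms(5) in blast)
    have Q0F: "Q0 \<subseteq> F k" and ykF: "y [^] k \<in> F k" for k
      unfolding F_def using sub_saturation[OF Q add_PIdl_ideal[OF ids(1) yk]]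
        sub_add_PIdl[OF ids(1) yk] self_in_add_PIdl[OF ids(1) yk] by blast+
    have Fmono: "F (Suc k) \<subseteq> F k" for k
      unfolding F_def[of "Suc k"]
      by (rule saturation_least[OF Fs add_PIdl_least[OF Fi Q0F]]) (use ideal_mult'[OF Fi ykF yc] in simp)
    have FK: "ideal (F k <+> ?K) R" for k by (rule add_ideals[OF Fi saturatedD(1)[OF Ks]])
    have Es: "saturated R P (E k)" for k unfolding E_def by (rule saturated_saturation[OF P FK])
    have FE: "F k \<subseteq> E k" and KE: "?K \<subseteq> E k" for k
      unfolding E_def using sub_add_ideals[OF Fi saturatedD(1)[OF Ks]] sub_saturation[OF P FK] by blast+
    have Emono: "E (Suc k) \<subseteq> E k" for k
      unfolding E_def[of "Suc k"]
      by (rule saturation_least[OF Es add_ideals_least[OF saturatedD(1)[OF Es] _ KE]]) (use Fmono FE in blast)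
    have nilK: "\<exists>n::nat. q [^] n \<in> ?K" if "q \<in> P" for q
      by (rule saturation_pow[OF P I _ that]) (rule none)
    obtain k where k: "E (Suc k) = E k"
      using saturated_dcc[where E = E, OF P Ks nilK Es KE Emono] by blast
    have "F k = F (Suc k)"
    proof (rule saturated_nakayama[OF P FsP FsP Fmono assms(6)])
      fix x assume x: "x \<in> F k"
      then have "x \<in> E (Suc k)" using FE k by blast
      then obtain s f z where s: "s \<in> carrier R" "s \<notin> P" "f \<in> F (Suc k)" "z \<in> ?K" "s \<otimes> x = f \<oplus> z"
        unfolding E_def saturation_def set_add_def' by blast
      obtain s' q a where s': "s' \<in> carrier R" "s' \<notin> P" "q \<in> Q0" "a \<in> carrier R" "s' \<otimes> z = q \<oplus> a \<otimes> t"
        using s(4) unfolding saturation_def mem_add_PIdl_iff by blast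
      have c: "x \<in> carrier R" "f \<in> carrier R" "q \<in> carrier R" "z \<in> carrier R"
        using x s s' ideal_carr Fi ids(1) saturatedD(1)[OF Ks] by blast+
      have "(s' \<otimes> s) \<otimes> x = s' \<otimes> (s \<otimes> x)" using s s' c by (simp add: m_assoc)
      also have "\<dots> = s' \<otimes> f \<oplus> s' \<otimes> z" unfolding s(5) using s s' c by (simp add: r_distr)
      also have "\<dots> = (s' \<otimes> f \<oplus> q) \<oplus> t \<otimes> a"
        unfolding s'(5) using s' c tc by (simp add: a_assoc m_comm)
      finally have eq: "(s' \<otimes> s) \<otimes> x = (s' \<otimes> f \<oplus> q) \<oplus> t \<otimes> a" .
      have f': "s' \<otimes> f \<oplus> q \<in> F (Suc k)"
        using ideal_add[OF Fi ideal_mult[OF Fi s(3) s'(1)]] Q0F s'(3) by blast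
      have "t \<otimes> a \<in> F k"
      proof (rule ideal_cancel[OF Fi])
        show "t \<otimes> a \<oplus> (s' \<otimes> f \<oplus> q) \<in> F k"
          using eq ideal_mult[OF Fi x, of "s' \<otimes> s"] s s' c tc by (simp add: a_comm)
      qed (use f' Fmono tc s' in auto)
      \<comment> \<open>Here \<open>t \<notin> Q\<close> is decisive: \<open>F k\<close> is
        saturated at \<open>Q\<close> and not only at \<open>P\<close>, so \<open>t\<close> can be
        cancelled.\<close>
      then have "a \<in> F k" using saturatedD(2)[OF Fs tc False s'(4)] by blast
      moreover have "s' \<otimes> s \<in> carrier R - P" using prime_compl[OF P, of s' s] s s' by auto
      ultimately show "\<exists>s\<in>carrier R - P. \<exists>i\<in>F (Suc k). \<exists>y\<in>F k. s \<otimes> x = i \<oplus> t \<otimes> y"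
        using eq f' by blast
    qed
    then have "y [^] k \<in> F (Suc k)" using ykF[of k] by simp
    then obtain s q a where s: "s \<in> carrier R" "s \<notin> Q" "q \<in> Q0" "a \<in> carrier R"
      "s \<otimes> y [^] k = q \<oplus> a \<otimes> y [^] Suc k"
      unfolding F_def saturation_def mem_add_PIdl_iff by blast
    have qc: "q \<in> carrier R" using s(3) ideal_carr[OF ids(1)] by blast
    obtain u where u: "u = y [^] k" by blast
    have uc: "u \<in> carrier R" unfolding u by (rule yk)
    \<comment> \<open>Modulo the prime \<open>Q0\<close> the power of \<open>y\<close> cancels and
      leaves \<open>s = a y\<close>, which puts \<open>s\<close> into \<open>Q\<close> although it
      was chosen outside.\<close>
    have "u \<otimes> (s \<ominus> a \<otimes> y) = s \<otimes> u \<ominus> a \<otimes> (u \<otimes> y)"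
      using uc s(1,4) yc by algebra
    also have "\<dots> = (q \<oplus> a \<otimes> (u \<otimes> y)) \<ominus> a \<otimes> (u \<otimes> y)" using s(5) u by simp
    also have "\<dots> = q" using uc qc s(4) yc by algebra
    finally have "y [^] k \<otimes> (s \<ominus> a \<otimes> y) \<in> Q0" using s(3) u by simp
    then have "s \<ominus> a \<otimes> y \<in> Q0" by (rule prime_pow_mult[OF Q0 yc, rotated]) (use s yc y in auto)
    then have "s \<ominus> a \<otimes> y \<in> Q" using assms(4) by blast
    then have "s \<ominus> a \<otimes> y \<oplus> a \<otimes> y \<in> Q" using ideal_add[OF ids(2)] ideal_mult[OF ids(2) y(1) s(4)] by blast
    moreover have "s \<ominus> a \<otimes> y \<oplus> a \<otimes> y = s" using s(1,4) yc by algebra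
    ultimately show False using s(2) by simp
  qed
qed

text \<open>The element \<open>t\<close> sinks from the top of the chain: the principal ideal
  theorem exchanges the prime just below the top for one containing \<open>t\<close>, and the
  induction continues with the shorter chain ending there.\<close>

lemma prime_chain_through:
  assumes "\<And>i. i \<le> Suc k \<Longrightarrow> primeideal (P i) R" "\<And>i. i < Suc k \<Longrightarrow> P i \<subset> P (Suc i)" "t \<in> P (Suc k)"
  shows "\<exists>P'. (\<forall>i\<le>Suc k. primeideal (P' i) R) \<and> (\<forall>i<Suc k. P' i \<subset> P' (Suc i)) \<and>
    P' 0 = P 0 \<and> P' (Suc k) = P (Suc k) \<and> t \<in> P' 1"
  using assms
proof (induction k arbitrary: P)
  case 0
  then show ?case by (intro exI[of _ P]) auto
next
  case (Suc k)
  obtain Q where Q: "primeideal Q R" "P k \<subset> Q" "Q \<subset> P (Suc (Suc k))" "t \<in> Q"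
    by (rule principal_ideal_theorem[of "P k" "P (Suc k)" "P (Suc (Suc k))" t]) (use Suc.prems in auto)
  let ?P = "\<lambda>i. if i \<le> k then P i else Q"
  have "\<exists>P'. (\<forall>i\<le>Suc k. primeideal (P' i) R) \<and> (\<forall>i<Suc k. P' i \<subset> P' (Suc i)) \<and>
    P' 0 = ?P 0 \<and> P' (Suc k) = ?P (Suc k) \<and> t \<in> P' 1"
  proof (rule Suc.IH)
    show "?P i \<subset> ?P (Suc i)" if "i < Suc k" for i
      using that Q(2) Suc.prems(2)[of i] by (cases "i = k") auto
  qed (use Suc.prems Q in auto)
  then obtain P' where P': "\<forall>i\<le>Suc k. primeideal (P' i) R" "\<forall>i<Suc k. P' i \<subset> P' (Suc i)"
    "P' 0 = P 0" "P' (Suc k) = Q" "t \<in> P' 1" by auto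
  let ?P' = "\<lambda>i. if i \<le> Suc k then P' i else P (Suc (Suc k))"
  show ?case
  proof (intro exI[of _ ?P'] conjI allI impI)
    show "?P' i \<subset> ?P' (Suc i)" if "i < Suc (Suc k)" for i
      using that P' Q(3) by (cases "i = Suc k") auto
  qed (use P' Suc.prems in \<open>auto simp: le_Suc_eq\<close>)
qed

end

text \<open>Sequences regular on the quotient by \<open>J\<close>, expressed through ideals so that
  no quotient ring is formed. The quotient by the whole sequence is allowed to vanish.\<close>

fun regular_sequence :: "('a, 'c) ring_scheme \<Rightarrow> 'a set \<Rightarrow> 'a list \<Rightarrow> bool" where
  "regular_sequence R J [] \<longleftrightarrow> True"
| "regular_sequence R J (t # ts) \<longleftrightarrow>
     (\<forall>c\<in>carrier R. c \<otimes>\<^bsub>R\<^esub> t \<in> J \<longrightarrow> c \<in> J) \<and> regular_sequence R (J <+>\<^bsub>R\<^esub> PIdl\<^bsub>R\<^esub> t) ts"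

context noetherian_cring
begin

text \<open>
  By induction: the principal ideal theorem moves \<open>t\<close> into \<open>P 1\<close>, the induction hypothesis gives
  \<open>P 1 = J + (t)\<close>, and then \<open>P 0 = J + t P 0\<close>, so \<open>P 0 = J\<close> by Nakayama's lemma.
\<close>

lemma regular_sequence_of_prime_chain:
  assumes "ideal J R" "set ts \<subseteq> carrier R"
    and "\<And>i. i \<le> length ts \<Longrightarrow> primeideal (P i) R" "\<And>i. i < length ts \<Longrightarrow> P i \<subset> P (Suc i)"
    and "J \<subseteq> P 0" "P (length ts) = Idl (J \<union> set ts)"
    and "\<And>I. ideal I R \<Longrightarrow> saturated R (P (length ts)) I"
  shows "regular_sequence R J ts \<and> P 0 = J"
  using assms
proof (induction ts arbitrary: J P)
  case Nil
  have "Idl J = J" using genideal_minimal[OF Nil(1) order_refl] genideal_self[OF ideal_sub[OF Nil(1)]] by blast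
  then show ?case using Nil by simp
next
  case (Cons t ts)
  have tc: "t \<in> carrier R" and tsc: "set ts \<subseteq> carrier R" using Cons.prems(2) by auto
  note J = Cons.prems(1)
  let ?m = "P (length (t # ts))"
  have m: "primeideal ?m R" using Cons.prems(3) by blast
  have gen: "J \<union> set (t # ts) \<subseteq> carrier R" using Cons.prems(2) ideal_sub[OF J] by auto
  have tm: "t \<in> ?m" using genideal_self[OF gen] unfolding Cons.prems(6) by auto
  obtain P' where P': "\<forall>i\<le>Suc (length ts). primeideal (P' i) R"
    "\<forall>i<Suc (length ts). P' i \<subset> P' (Suc i)" "P' 0 = P 0" "P' (Suc (length ts)) = ?m" "t \<in> P' 1"
    using prime_chain_through[of "length ts" P t] Cons.prems(3,4) tm by auto
  let ?J = "J <+> PIdl t"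
  have J': "ideal ?J R" by (rule add_PIdl_ideal[OF J tc])
  have p0: "primeideal (P 0) R" "primeideal (P' 1) R" "P 0 \<subset> P' 1" using P' by fastforce+
  have JP1: "?J \<subseteq> P' 1"
    by (rule add_PIdl_least[OF primeD(1)[OF p0(2)]]) (use Cons.prems(5) p0(3) P'(5) in auto)
  have IH: "regular_sequence R ?J ts \<and> P' (Suc 0) = ?J"
  proof (rule Cons.IH[OF J' tsc, of "\<lambda>i. P' (Suc i)"])
    show "?J \<subseteq> P' (Suc 0)" using JP1 by simp
    have sub: "?J \<union> set ts \<subseteq> carrier R" using ideal_sub[OF J'] tsc by auto
    have "Idl (J \<union> set (t # ts)) = Idl (?J \<union> set ts)"
    proof
      show "Idl (J \<union> set (t # ts)) \<subseteq> Idl (?J \<union> set ts)"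
        by (rule genideal_minimal[OF genideal_ideal[OF sub]])
          (use genideal_self[OF sub] sub_add_PIdl[OF J tc] self_in_add_PIdl[OF J tc] in auto)
      have "?J \<subseteq> Idl (J \<union> set (t # ts))"
        by (rule add_PIdl_least[OF genideal_ideal[OF gen]]) (use genideal_self[OF gen] in auto)
      then show "Idl (?J \<union> set ts) \<subseteq> Idl (J \<union> set (t # ts))"
        by (intro genideal_minimal[OF genideal_ideal[OF gen]]) (use genideal_self[OF gen] in auto)
    qed
    then show "P' (Suc (length ts)) = Idl (?J \<union> set ts)" using P'(4) Cons.prems(6) by simp
  qed (use P' Cons.prems(7) in auto)
  then have P1: "P' 1 = ?J" by simp
  have tn: "t \<notin> P 0"
  proof
    assume "t \<in> P 0"
    then have "?J \<subseteq> P 0" by (intro add_PIdl_least[OF primeD(1)[OF p0(1)] Cons.prems(5)])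
    then show False using P1 p0(3) by blast
  qed
  have P0: "P 0 = J"
  proof -
    have sat: "saturated R ?m I" if "ideal I R" for I by (rule Cons.prems(7)[OF that])
    show ?thesis
    proof (rule saturated_nakayama[OF m sat[OF J] sat[OF primeD(1)[OF p0(1)]] Cons.prems(5) tm])
      fix x assume x: "x \<in> P 0"
      then obtain j r where j: "j \<in> J" "r \<in> carrier R" "x = j \<oplus> r \<otimes> t"
        using P1 p0(3) mem_add_PIdl_iff by blast
      have c: "j \<in> carrier R" "x \<in> carrier R" using j x ideal_carr J primeD(1)[OF p0(1)] by blast+
      have "r \<otimes> t \<in> P 0"
        by (rule ideal_cancel[OF primeD(1)[OF p0(1)], of _ j])
          (use x j c tc Cons.prems(5) in \<open>auto simp: a_comm\<close>)
      then have "r \<in> P 0" using primeD(4)[OF p0(1) j(2) tc] tn by blast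
      then show "\<exists>s\<in>carrier R - ?m. \<exists>i\<in>J. \<exists>y\<in>P 0. s \<otimes> x = i \<oplus> t \<otimes> y"
        using j c tc primeD(2)[OF m]
        by (intro bexI[of _ \<one>] bexI[of _ j] bexI[of _ r]) (auto simp: m_comm)
    qed
  qed
  have "c \<in> J" if "c \<in> carrier R" "c \<otimes> t \<in> J" for c
    using primeD(4)[OF p0(1) that(1) tc] that(2) tn P0 by blast
  then show ?case using IH P0 by simp
qed

end

section \<open>Exchange and powers in regular sequences\<close>

context cring
begin

lemma nonzerodivisor_pow:
  assumes "t \<in> carrier R" "\<And>c. c \<in> carrier R \<Longrightarrow> c \<otimes> t \<in> J \<Longrightarrow> c \<in> J" "c \<in> carrier R" "c \<otimes> t [^] (n::nat) \<in> J"
  shows "c \<in> J"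
  using assms(3,4)
proof (induction n arbitrary: c)
  case (Suc n)
  have "c \<otimes> t \<otimes> t [^] n \<in> J" using Suc.prems assms(1) by (simp add: m_ac)
  then have "c \<otimes> t \<in> J" using Suc.IH[of "c \<otimes> t"] Suc.prems assms(1) by simp
  then show ?case using assms(2) Suc.prems by blast
qed simp

text \<open>From \<open>c t = j + a s\<close>, regularity of \<open>s\<close> modulo
  \<open>J + (t)\<close> makes \<open>a\<close> a multiple of \<open>t\<close> modulo
  \<open>J\<close>, say \<open>b t\<close>. Then \<open>(c - b s) t\<close> is in \<open>J\<close>
  and \<open>t\<close> cancels.\<close>

lemma nonzerodivisor_swap:
  assumes J: "ideal J R" and tc: "t \<in> carrier R" and sc: "s \<in> carrier R"
    and t: "\<And>c. c \<in> carrier R \<Longrightarrow> c \<otimes> t \<in> J \<Longrightarrow> c \<in> J"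
    and s: "\<And>c. c \<in> carrier R \<Longrightarrow> c \<otimes> s \<in> J <+> PIdl t \<Longrightarrow> c \<in> J <+> PIdl t"
    and c: "c \<in> carrier R" "c \<otimes> t \<in> J <+> PIdl s"
  shows "c \<in> J <+> PIdl s"
proof -
  obtain j a where j: "j \<in> J" "a \<in> carrier R" "c \<otimes> t = j \<oplus> a \<otimes> s" using c(2) mem_add_PIdl_iff by blast
  have jc: "j \<in> carrier R" using j ideal_carr[OF J] by blast
  have "a \<otimes> s = (j \<oplus> a \<otimes> s) \<ominus> j" using jc j(2) sc by algebra
  also have "\<dots> = \<ominus> j \<oplus> c \<otimes> t" using jc j(2) sc c(1) tc unfolding j(3)[symmetric] by (simp add: a_minus_def a_comm)
  finally have "a \<otimes> s = \<ominus> j \<oplus> c \<otimes> t" .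
  then have "a \<otimes> s \<in> J <+> PIdl t" using ideal_neg[OF J j(1)] c(1) mem_add_PIdl_iff by blast
  then have "a \<in> J <+> PIdl t" using s j(2) by blast
  then obtain i b where i: "i \<in> J" "b \<in> carrier R" "a = i \<oplus> b \<otimes> t" using mem_add_PIdl_iff by blast
  have ic: "i \<in> carrier R" using i ideal_carr[OF J] by blast
  have "(c \<ominus> b \<otimes> s) \<otimes> t = c \<otimes> t \<ominus> b \<otimes> s \<otimes> t" using c i sc tc by algebra
  also have "\<dots> = j \<oplus> i \<otimes> s" unfolding j(3) i(3) using i(2) jc ic sc tc by algebra
  also have "\<dots> \<in> J" using ideal_add[OF J j(1) ideal_mult'[OF J i(1) sc]] .
  finally have "c \<ominus> b \<otimes> s \<in> J" using t c i sc by simp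
  moreover have "c = (c \<ominus> b \<otimes> s) \<oplus> b \<otimes> s" using c(1) i(2) sc by algebra
  ultimately show ?thesis using mem_add_PIdl_iff i(2) by blast
qed

text \<open>Induction on the exponent: the hypothesis for \<open>n\<close> gives
  \<open>c = i + b t^n\<close>, and cancelling \<open>t^n\<close> in \<open>c s\<close> leaves
  \<open>b s\<close> in \<open>J + (t)\<close>. So \<open>b\<close> is a multiple of
  \<open>t\<close> modulo \<open>J\<close>, which supplies the missing factor.\<close>

lemma nonzerodivisor_mod_pow:
  assumes J: "ideal J R" and tc: "t \<in> carrier R" and sc: "s \<in> carrier R"
    and t: "\<And>c. c \<in> carrier R \<Longrightarrow> c \<otimes> t \<in> J \<Longrightarrow> c \<in> J"
    and s: "\<And>c. c \<in> carrier R \<Longrightarrow> c \<otimes> s \<in> J <+> PIdl t \<Longrightarrow> c \<in> J <+> PIdl t"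
    and c: "c \<in> carrier R" "c \<otimes> s \<in> J <+> PIdl (t [^] (n::nat))"
  shows "c \<in> J <+> PIdl (t [^] n)"
  using c
proof (induction n arbitrary: c)
  case 0
  have "c = \<zero> \<oplus> c \<otimes> t [^] (0::nat)" using 0 by simp
  then show ?case using ideal_zero[OF J] 0(1) mem_add_PIdl_iff by blast
next
  case (Suc n)
  obtain j a where j: "j \<in> J" "a \<in> carrier R" "c \<otimes> s = j \<oplus> a \<otimes> t [^] Suc n"
    using Suc.prems(2) mem_add_PIdl_iff by blast
  obtain u where u: "u = t [^] n" by blast
  have uc: "u \<in> carrier R" using u tc by simp
  have jc: "j \<in> carrier R" using j ideal_carr[OF J] by blast
  have cs: "c \<otimes> s = j \<oplus> (a \<otimes> t) \<otimes> u" unfolding j(3) u using j(2) tc by (simp add: m_ac)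
  then have "c \<otimes> s \<in> J <+> PIdl (t [^] n)" unfolding u mem_add_PIdl_iff using j(1,2) tc by blast
  then have "c \<in> J <+> PIdl (t [^] n)" using Suc by blast
  then obtain i b where i: "i \<in> J" "b \<in> carrier R" "c = i \<oplus> b \<otimes> u" using mem_add_PIdl_iff u by blast
  have ic: "i \<in> carrier R" using i ideal_carr[OF J] by blast
  have "(b \<otimes> s \<ominus> a \<otimes> t) \<otimes> u = (i \<oplus> b \<otimes> u) \<otimes> s \<ominus> (a \<otimes> t) \<otimes> u \<ominus> i \<otimes> s"
    using i(2) j(2) sc tc uc ic by algebra
  also have "\<dots> = c \<otimes> s \<ominus> (a \<otimes> t) \<otimes> u \<ominus> i \<otimes> s" using i(3) by simp
  also have "\<dots> = j \<ominus> i \<otimes> s" unfolding cs using j(2) jc ic sc tc uc by algebra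
  also have "\<dots> \<in> J" using ideal_minus[OF J j(1) ideal_mult'[OF J i(1) sc]] .
  finally have "b \<otimes> s \<ominus> a \<otimes> t \<in> J" unfolding u
    using nonzerodivisor_pow[OF tc t] i(2) j(2) sc tc by simp
  moreover have "b \<otimes> s = (b \<otimes> s \<ominus> a \<otimes> t) \<oplus> a \<otimes> t" using i(2) j(2) sc tc by algebra
  ultimately have "b \<otimes> s \<in> J <+> PIdl t" using mem_add_PIdl_iff j(2) by blast
  then have "b \<in> J <+> PIdl t" using s i(2) by blast
  then obtain k e where k: "k \<in> J" "e \<in> carrier R" "b = k \<oplus> e \<otimes> t" using mem_add_PIdl_iff by blast
  have kc: "k \<in> carrier R" using k ideal_carr[OF J] by blast
  have "c = (i \<oplus> k \<otimes> u) \<oplus> e \<otimes> t [^] Suc n"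
    unfolding i(3) k(3) nat_pow_Suc u[symmetric] using k(2) kc ic uc tc by algebra
  then show ?case using ideal_add[OF J i(1) ideal_mult'[OF J k(1) uc]] k(2) mem_add_PIdl_iff by blast
qed

lemma add_PIdl_commute:
  assumes "ideal J R" "a \<in> carrier R" "b \<in> carrier R"
  shows "J <+> PIdl a <+> PIdl b = J <+> PIdl b <+> PIdl a"
proof -
  have sub: "J <+> PIdl a <+> PIdl b \<subseteq> J <+> PIdl b <+> PIdl a"
    if ab: "a \<in> carrier R" "b \<in> carrier R" for a b
  proof -
    have i: "ideal (J <+> PIdl b) R" by (rule add_PIdl_ideal[OF assms(1) ab(2)])
    have i2: "ideal (J <+> PIdl b <+> PIdl a) R" by (rule add_PIdl_ideal[OF i ab(1)])
    have 1: "J \<subseteq> J <+> PIdl b" by (rule sub_add_PIdl[OF assms(1) ab(2)])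
    have 2: "J <+> PIdl b \<subseteq> J <+> PIdl b <+> PIdl a" by (rule sub_add_PIdl[OF i ab(1)])
    show ?thesis
      by (intro add_PIdl_least[OF i2])
        (use 1 2 self_in_add_PIdl[OF i ab(1)] self_in_add_PIdl[OF assms(1) ab(2)] in auto)
  qed
  show ?thesis using sub[OF assms(2,3)] sub[OF assms(3,2)] by (rule equalityI)
qed

text \<open>The exponent at \<open>t\<close> is carried past \<open>ss\<close> one element at a
  time. The head \<open>s\<close> stays regular modulo \<open>t^n\<close>, and after the exchange
  \<open>t\<close> is regular modulo \<open>J + (s)\<close>, so the induction applies to that
  ideal.\<close>

lemma regular_sequence_pow_base:
  assumes "ideal J R" "t \<in> carrier R" "set ss \<subseteq> carrier R"
    and "\<And>c. c \<in> carrier R \<Longrightarrow> c \<otimes> t \<in> J \<Longrightarrow> c \<in> J"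
    and "regular_sequence R (J <+> PIdl t) ss"
  shows "regular_sequence R (J <+> PIdl (t [^] (n::nat))) ss"
  using assms
proof (induction ss arbitrary: J)
  case (Cons s ss)
  have sc: "s \<in> carrier R" and ssc: "set ss \<subseteq> carrier R" using Cons.prems(3) by auto
  note J = Cons.prems(1) and tc = Cons.prems(2) and t = Cons.prems(4)
  have s: "c \<in> J <+> PIdl t" if "c \<in> carrier R" "c \<otimes> s \<in> J <+> PIdl t" for c
    using Cons.prems(5) that by simp
  have J': "ideal (J <+> PIdl s) R" by (rule add_PIdl_ideal[OF J sc])
  have tn: "t [^] n \<in> carrier R" using tc by simp
  have "regular_sequence R (J <+> PIdl s <+> PIdl (t [^] n)) ss"
  proof (rule Cons.IH[OF J' tc ssc])
    show "c \<in> J <+> PIdl s" if "c \<in> carrier R" "c \<otimes> t \<in> J <+> PIdl s" for c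
      by (rule nonzerodivisor_swap[OF J tc sc t s that])
    show "regular_sequence R (J <+> PIdl s <+> PIdl t) ss"
      using Cons.prems(5) add_PIdl_commute[OF J tc sc] by simp
  qed
  moreover have "c \<in> J <+> PIdl (t [^] n)"
    if "c \<in> carrier R" "c \<otimes> s \<in> J <+> PIdl (t [^] n)" for c
    by (rule nonzerodivisor_mod_pow[OF J tc sc t s that])
  ultimately show ?case using add_PIdl_commute[OF J tn sc] by simp
qed simp

lemma regular_sequence_pow:
  assumes "ideal J R" "set ts \<subseteq> carrier R" "regular_sequence R J ts"
  shows "regular_sequence R J (map (\<lambda>t. t [^] (n::nat)) ts)"
  using assms
proof (induction ts arbitrary: J)
  case (Cons t ts)
  have tc: "t \<in> carrier R" and tsc: "set ts \<subseteq> carrier R" using Cons.prems(2) by auto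
  have t: "\<And>c. c \<in> carrier R \<Longrightarrow> c \<otimes> t \<in> J \<Longrightarrow> c \<in> J" using Cons.prems(3) by simp
  have "regular_sequence R (J <+> PIdl (t [^] n)) ts"
    by (rule regular_sequence_pow_base[OF Cons.prems(1) tc tsc t]) (use Cons.prems(3) in auto)
  then have "regular_sequence R (J <+> PIdl (t [^] n)) (map (\<lambda>t. t [^] n) ts)"
    by (intro Cons.IH tsc add_PIdl_ideal[OF Cons.prems(1)]) (use tc in auto)
  then show ?case using nonzerodivisor_pow[OF tc t] by simp
qed simp

end

section \<open>The Koszul complex\<close>

text \<open>
  A function on lists of Booleans of length \<open>n\<close> is read as an element of the exterior algebra on
  \<open>e\<^sub>1, \<dots>, e\<^sub>n\<close>: its value at \<open>l\<close> is the coefficient of the product of the \<open>e\<^sub>i\<close> with \<open>l\<close> true at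
  position \<open>i\<close>. Writing it as \<open>z\<^sub>0 + e\<^sub>1 z\<^sub>1\<close>, the Koszul differential is
  \<open>d z = (d z\<^sub>0 + x\<^sub>1 z\<^sub>1) - e\<^sub>1 d z\<^sub>1\<close>.
\<close>

fun koszul :: "('a, 'c) ring_scheme \<Rightarrow> 'a list \<Rightarrow> (bool list \<Rightarrow> 'a) \<Rightarrow> bool list \<Rightarrow> 'a" where
  "koszul R (x # xs) z (b # l) =
     (if b then \<ominus>\<^bsub>R\<^esub> koszul R xs (\<lambda>l. z (True # l)) l
      else koszul R xs (\<lambda>l. z (False # l)) l \<oplus>\<^bsub>R\<^esub> x \<otimes>\<^bsub>R\<^esub> z (True # l))"
| "koszul R _ z _ = \<zero>\<^bsub>R\<^esub>"

text \<open>Exterior multiplication by \<open>u\<^sub>1 e\<^sub>1 + \<dots> + u\<^sub>n e\<^sub>n\<close>.\<close>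

fun wedge :: "('a, 'c) ring_scheme \<Rightarrow> 'a list \<Rightarrow> (bool list \<Rightarrow> 'a) \<Rightarrow> bool list \<Rightarrow> 'a" where
  "wedge R (u # us) z (b # l) =
     (if b then u \<otimes>\<^bsub>R\<^esub> z (False # l) \<oplus>\<^bsub>R\<^esub> \<ominus>\<^bsub>R\<^esub> wedge R us (\<lambda>l. z (True # l)) l
      else wedge R us (\<lambda>l. z (False # l)) l)"
| "wedge R _ z _ = \<zero>\<^bsub>R\<^esub>"

fun dot :: "('a, 'c) ring_scheme \<Rightarrow> 'a list \<Rightarrow> 'a list \<Rightarrow> 'a" where
  "dot R (u # us) (x # xs) = u \<otimes>\<^bsub>R\<^esub> x \<oplus>\<^bsub>R\<^esub> dot R us xs"
| "dot R _ _ = \<zero>\<^bsub>R\<^esub>"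

text \<open>The element y_1 e_1 + ... + y_n e_n of the exterior algebra. The test
  \<open>True \<in> set l\<close> discards products of several e_i.\<close>

fun degree_one :: "('a, 'c) ring_scheme \<Rightarrow> 'a list \<Rightarrow> bool list \<Rightarrow> 'a" where
  "degree_one R (y # ys) (b # l) =
     (if b then (if True \<in> set l then \<zero>\<^bsub>R\<^esub> else y) else degree_one R ys l)"
| "degree_one R _ _ = \<zero>\<^bsub>R\<^esub>"

context cring
begin

lemma koszul_closed:
  "set xs \<subseteq> carrier R \<Longrightarrow> (\<And>l. z l \<in> carrier R) \<Longrightarrow> koszul R xs z l \<in> carrier R"
  by (induction xs arbitrary: z l; case_tac l) auto

lemma wedge_closed:
  "set us \<subseteq> carrier R \<Longrightarrow> (\<And>l. z l \<in> carrier R) \<Longrightarrow> wedge R us z l \<in> carrier R"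
  by (induction us arbitrary: z l; case_tac l) auto

lemma dot_closed: "set us \<subseteq> carrier R \<Longrightarrow> set xs \<subseteq> carrier R \<Longrightarrow> dot R us xs \<in> carrier R"
  by (induction us xs rule: list_induct2') auto

lemma koszul_add:
  assumes "set xs \<subseteq> carrier R" "\<And>l. f l \<in> carrier R" "\<And>l. g l \<in> carrier R"
  shows "koszul R xs (\<lambda>l. f l \<oplus> g l) l = koszul R xs f l \<oplus> koszul R xs g l"
  using assms
proof (induction xs arbitrary: f g l)
  case (Cons x xs)
  note c = Cons.prems koszul_closed[of xs]
  show ?case
  proof (cases l)
    case (Cons b m)
    have IH: "koszul R xs (\<lambda>l. f (b # l) \<oplus> g (b # l)) m
        = koszul R xs (\<lambda>l. f (b # l)) m \<oplus> koszul R xs (\<lambda>l. g (b # l)) m" for b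
      by (rule Cons.IH) (use c in auto)
    show ?thesis unfolding Cons using IH c
      by (auto simp: minus_add r_distr a_ac)
  qed simp
qed simp

lemma koszul_smult:
  assumes "set xs \<subseteq> carrier R" "\<And>l. f l \<in> carrier R" "c \<in> carrier R"
  shows "koszul R xs (\<lambda>l. c \<otimes> f l) l = c \<otimes> koszul R xs f l"
  using assms
proof (induction xs arbitrary: f l)
  case (Cons x xs)
  note c = Cons.prems koszul_closed[of xs]
  show ?case
  proof (cases l)
    case (Cons b m)
    have IH: "koszul R xs (\<lambda>l. c \<otimes> f (b # l)) m = c \<otimes> koszul R xs (\<lambda>l. f (b # l)) m" for b
      by (rule Cons.IH) (use c in auto)
    show ?thesis unfolding Cons using IH c by (auto simp: r_minus r_distr m_lcomm)
  qed (use assms in simp)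
qed simp

lemma koszul_neg:
  assumes "set xs \<subseteq> carrier R" "\<And>l. f l \<in> carrier R"
  shows "koszul R xs (\<lambda>l. \<ominus> f l) l = \<ominus> koszul R xs f l"
  using koszul_smult[where f = f and c = "\<ominus> \<one>" and l = l, OF assms] assms koszul_closed[where z = f, OF assms] by (simp add: l_minus)

lemma wedge_add:
  assumes "set us \<subseteq> carrier R" "\<And>l. f l \<in> carrier R" "\<And>l. g l \<in> carrier R"
  shows "wedge R us (\<lambda>l. f l \<oplus> g l) l = wedge R us f l \<oplus> wedge R us g l"
  using assms
proof (induction us arbitrary: f g l)
  case (Cons x xs)
  note c = Cons.prems wedge_closed[of xs]
  show ?case
  proof (cases l)
    case (Cons b m)
    have IH: "wedge R xs (\<lambda>l. f (b # l) \<oplus> g (b # l)) m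
        = wedge R xs (\<lambda>l. f (b # l)) m \<oplus> wedge R xs (\<lambda>l. g (b # l)) m" for b
      by (rule Cons.IH) (use c in auto)
    show ?thesis unfolding Cons using IH c
      by (auto simp: minus_add r_distr a_ac)
  qed simp
qed simp

lemma wedge_smult:
  assumes "set us \<subseteq> carrier R" "\<And>l. f l \<in> carrier R" "c \<in> carrier R"
  shows "wedge R us (\<lambda>l. c \<otimes> f l) l = c \<otimes> wedge R us f l"
  using assms
proof (induction us arbitrary: f l)
  case (Cons x xs)
  note c = Cons.prems wedge_closed[of xs]
  show ?case
  proof (cases l)
    case (Cons b m)
    have IH: "wedge R xs (\<lambda>l. c \<otimes> f (b # l)) m = c \<otimes> wedge R xs (\<lambda>l. f (b # l)) m" for b
      by (rule Cons.IH) (use c in auto)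
    show ?thesis unfolding Cons using IH c by (auto simp: r_minus r_distr m_lcomm)
  qed (use assms in simp)
qed simp

lemma wedge_neg:
  assumes "set us \<subseteq> carrier R" "\<And>l. f l \<in> carrier R"
  shows "wedge R us (\<lambda>l. \<ominus> f l) l = \<ominus> wedge R us f l"
  using wedge_smult[where f = f and c = "\<ominus> \<one>" and l = l, OF assms] assms wedge_closed[where z = f, OF assms] by (simp add: l_minus)

text \<open>In the part free of e_1, the term \<open>x\<close> times d z_1 appears once by linearity
  of d and once, with a minus sign, from the coefficient of e_1 in d z.\<close>

lemma koszul_koszul:
  assumes "set xs \<subseteq> carrier R" "\<And>l. z l \<in> carrier R"
  shows "koszul R xs (koszul R xs z) l = \<zero>"
  using assms
proof (induction xs arbitrary: z l)
  case (Cons x xs)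
  have c: "set xs \<subseteq> carrier R" "x \<in> carrier R" "\<And>l. z l \<in> carrier R" using Cons.prems by auto
  note cl = koszul_closed[OF c(1)] c
  show ?case
  proof (cases l)
    case (Cons b m)
    have IH: "koszul R xs (koszul R xs (\<lambda>l. z (b # l))) m = \<zero>" for b
      by (rule Cons.IH) (use c in auto)
    have add: "koszul R xs (\<lambda>l. koszul R xs (\<lambda>l. z (False # l)) l \<oplus> x \<otimes> z (True # l)) m
      = koszul R xs (koszul R xs (\<lambda>l. z (False # l))) m \<oplus> x \<otimes> koszul R xs (\<lambda>l. z (True # l)) m"
      using cl by (simp add: koszul_add koszul_smult)
    have neg: "koszul R xs (\<lambda>l. \<ominus> koszul R xs (\<lambda>l. z (True # l)) l) m
      = \<ominus> koszul R xs (koszul R xs (\<lambda>l. z (True # l))) m"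
      using cl by (simp add: koszul_neg)
    show ?thesis unfolding Cons using add neg IH cl by (auto simp: r_minus r_neg)
  qed simp
qed simp

text \<open>This and \<open>homotopy_aux2\<close> are the induction step of
  \<open>koszul_wedge\<close> on coefficients without and with e_1. \<open>D\<close> and
  \<open>H\<close> stand for the two composites of d and exterior multiplication on the shorter
  list, and \<open>D \<oplus> H = k \<otimes> f\<close> is the induction hypothesis.\<close>

lemma homotopy_aux1:
  assumes "D \<in> carrier R" "H \<in> carrier R" "G \<in> carrier R" "f \<in> carrier R" "k \<in> carrier R"
    "u \<in> carrier R" "x \<in> carrier R" "D \<oplus> H = k \<otimes> f"
  shows "(D \<oplus> x \<otimes> (u \<otimes> f \<oplus> \<ominus> G)) \<oplus> (H \<oplus> x \<otimes> G) = (u \<otimes> x \<oplus> k) \<otimes> f"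
proof -
  have "(D \<oplus> x \<otimes> (u \<otimes> f \<oplus> \<ominus> G)) \<oplus> (H \<oplus> x \<otimes> G) = (D \<oplus> H) \<oplus> u \<otimes> x \<otimes> f"
    using assms(1-7) by algebra
  also have "\<dots> = (u \<otimes> x \<oplus> k) \<otimes> f"
    unfolding assms(8) using assms(1-7) by algebra
  finally show ?thesis .
qed

lemma homotopy_aux2:
  assumes "D \<in> carrier R" "H \<in> carrier R" "G \<in> carrier R" "f \<in> carrier R" "k \<in> carrier R"
    "u \<in> carrier R" "x \<in> carrier R" "D \<oplus> H = k \<otimes> f"
  shows "\<ominus> (u \<otimes> G \<oplus> \<ominus> D) \<oplus> (u \<otimes> (G \<oplus> x \<otimes> f) \<oplus> H) = (u \<otimes> x \<oplus> k) \<otimes> f"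
proof -
  have "\<ominus> (u \<otimes> G \<oplus> \<ominus> D) \<oplus> (u \<otimes> (G \<oplus> x \<otimes> f) \<oplus> H) = (D \<oplus> H) \<oplus> u \<otimes> x \<otimes> f"
    using assms(1-7) by algebra
  also have "\<dots> = (u \<otimes> x \<oplus> k) \<otimes> f"
    unfolding assms(8) using assms(1-7) by algebra
  finally show ?thesis .
qed

text \<open>The differential is contraction with the functional e_i -> x_i, hence an antiderivation.
  So d(u z) + u (d z) = (d u) z, and d u is the scalar \<open>dot R us xs\<close>.\<close>

lemma koszul_wedge:
  assumes "length us = length xs" "length l = length xs" "set us \<subseteq> carrier R" "set xs \<subseteq> carrier R"
    "\<And>l. z l \<in> carrier R"
  shows "koszul R xs (wedge R us z) l \<oplus> wedge R us (koszul R xs z) l = dot R us xs \<otimes> z l"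
  using assms
proof (induction us xs arbitrary: z l rule: list_induct2')
  case (4 u us x xs)
  then obtain b m where l: "l = b # m" "length m = length xs" by (cases l) auto
  have c: "set us \<subseteq> carrier R" "set xs \<subseteq> carrier R" "u \<in> carrier R" "x \<in> carrier R" "\<And>l. z l \<in> carrier R"
    using 4 by auto
  note cl = koszul_closed[OF c(2)] wedge_closed[OF c(1)] c dot_closed[OF c(1,2)]
  have IH: "koszul R xs (wedge R us (\<lambda>l. z (b # l))) m \<oplus> wedge R us (koszul R xs (\<lambda>l. z (b # l))) m
    = dot R us xs \<otimes> z (b # m)" for b
    by (rule 4(1)) (use 4 l c in auto)
  have F1: "wedge R us (\<lambda>l. koszul R xs (\<lambda>l. z (False # l)) l \<oplus> x \<otimes> z (True # l)) m
    = wedge R us (koszul R xs (\<lambda>l. z (False # l))) m \<oplus> x \<otimes> wedge R us (\<lambda>l. z (True # l)) m"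
    using cl by (simp add: wedge_add wedge_smult)
  have T1: "koszul R xs (\<lambda>l. u \<otimes> z (False # l) \<oplus> \<ominus> wedge R us (\<lambda>l. z (True # l)) l) m
    = u \<otimes> koszul R xs (\<lambda>l. z (False # l)) m \<oplus> \<ominus> koszul R xs (wedge R us (\<lambda>l. z (True # l))) m"
    using cl by (simp add: koszul_add koszul_smult koszul_neg)
  have T2: "wedge R us (\<lambda>l. \<ominus> koszul R xs (\<lambda>l. z (True # l)) l) m
    = \<ominus> wedge R us (koszul R xs (\<lambda>l. z (True # l))) m"
    using cl by (simp add: wedge_neg)
  show ?case
  proof (cases b)
    case True
    show ?thesis using homotopy_aux2[OF _ _ _ _ _ c(3,4) IH[of True]] cl
      unfolding l by (simp add: True T1 T2 minus_minus)
  next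
    case False
    show ?thesis using homotopy_aux1[OF _ _ _ _ _ c(3,4) IH[of False]] cl
      unfolding l by (simp add: False F1)
  qed
qed auto

lemma koszul_in_ideal:
  assumes "ideal J R" "set xs \<subseteq> carrier R" "\<And>l. length l = length xs \<Longrightarrow> z l \<in> J" "length l = length xs"
  shows "koszul R xs z l \<in> J"
  using assms(2-)
proof (induction xs arbitrary: z l)
  case (Cons x xs)
  then obtain b m where l: "l = b # m" "length m = length xs" by (cases l) auto
  have "koszul R xs (\<lambda>l. z (b # l)) m \<in> J" for b by (rule Cons.IH) (use Cons.prems l in auto)
  moreover have "x \<otimes> z (True # m) \<in> J" using Cons.prems l by (intro ideal_mult[OF assms(1)]) auto
  ultimately show ?case using l ideal_neg[OF assms(1)] ideal_add[OF assms(1)] by auto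
qed (use ideal_zero[OF assms(1)] in auto)

lemma wedge_in_ideal:
  assumes "ideal J R" "set us \<subseteq> carrier R" "\<And>l. length l = length us \<Longrightarrow> z l \<in> J" "length l = length us"
  shows "wedge R us z l \<in> J"
  using assms(2-)
proof (induction us arbitrary: z l)
  case (Cons x xs)
  then obtain b m where l: "l = b # m" "length m = length xs" by (cases l) auto
  have "wedge R xs (\<lambda>l. z (b # l)) m \<in> J" for b by (rule Cons.IH) (use Cons.prems l in auto)
  moreover have "x \<otimes> z (False # m) \<in> J" using Cons.prems l by (intro ideal_mult[OF assms(1)]) auto
  ultimately show ?case using l ideal_neg[OF assms(1)] ideal_add[OF assms(1)] by auto
qed (use ideal_zero[OF assms(1)] in auto)

text \<open>The degree of an index is \<open>count_list l True\<close>, and d lowers it by one. Only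
  a lower bound on degrees is ever tracked, here and in \<open>wedge_vanish\<close>, so no element
  has to be homogeneous.\<close>

lemma koszul_vanish:
  assumes "set xs \<subseteq> carrier R" "\<And>l. count_list l True < Suc p \<Longrightarrow> z l = \<zero>" "count_list l True < p"
  shows "koszul R xs z l = \<zero>"
  using assms
proof (induction xs arbitrary: z l p)
  case (Cons x xs)
  show ?case
  proof (cases l)
    case (Cons b m)
    show ?thesis
    proof (cases b)
      case True
      then obtain p' where p: "p = Suc p'" using Cons Cons.prems(3) by (cases p) auto
      have "koszul R xs (\<lambda>l. z (True # l)) m = \<zero>"
        by (rule Cons.IH[of p']) (use Cons.prems Cons True p in auto)
      then show ?thesis using Cons True by simp
    next
      case False
      have "koszul R xs (\<lambda>l. z (False # l)) m = \<zero>"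
        by (rule Cons.IH[of p]) (use Cons.prems Cons False in auto)
      moreover have "z (True # m) = \<zero>" using Cons.prems Cons False by auto
      ultimately show ?thesis using Cons False Cons.prems(1) by simp
    qed
  qed simp
qed simp

lemma wedge_vanish:
  assumes "set us \<subseteq> carrier R" "\<And>l. count_list l True < p \<Longrightarrow> z l = \<zero>" "count_list l True < Suc p"
  shows "wedge R us z l = \<zero>"
  using assms
proof (induction us arbitrary: z l p)
  case (Cons x xs)
  show ?case
  proof (cases l)
    case (Cons b m)
    show ?thesis
    proof (cases b)
      case True
      then obtain p' where p: "p = Suc p'" using Cons Cons.prems(3) by (cases p) auto
      have "wedge R xs (\<lambda>l. z (True # l)) m = \<zero>"
        by (rule Cons.IH[of p']) (use Cons.prems Cons True p in auto)
      moreover have "z (False # m) = \<zero>" using Cons.prems Cons True by auto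
      ultimately show ?thesis using Cons True Cons.prems(1) by simp
    next
      case False
      have "wedge R xs (\<lambda>l. z (False # l)) m = \<zero>"
        by (rule Cons.IH[of p]) (use Cons.prems Cons False in auto)
      then show ?thesis using Cons False by simp
    qed
  qed simp
qed simp

lemma dot_add:
  "length us = length xs \<Longrightarrow> length vs = length xs \<Longrightarrow> set us \<subseteq> carrier R \<Longrightarrow> set vs \<subseteq> carrier R \<Longrightarrow>
    set xs \<subseteq> carrier R \<Longrightarrow> dot R (map2 (\<oplus>) us vs) xs = dot R us xs \<oplus> dot R vs xs"
proof (induction xs arbitrary: us vs)
  case (Cons x xs)
  then obtain u us' v vs' where uv: "us = u # us'" "vs = v # vs'" by (metis length_Suc_conv)
  then show ?case using Cons dot_closed[of us' xs] dot_closed[of vs' xs] by (simp add: l_distr a_ac)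
qed simp

lemma dot_smult:
  "set us \<subseteq> carrier R \<Longrightarrow> set xs \<subseteq> carrier R \<Longrightarrow> c \<in> carrier R \<Longrightarrow>
    dot R (map ((\<otimes>) c) us) xs = c \<otimes> dot R us xs"
  by (induction us xs rule: list_induct2') (auto simp: r_distr m_assoc dot_closed)

lemma dot_zero: "set xs \<subseteq> carrier R \<Longrightarrow> dot R (replicate n \<zero>) xs = \<zero>"
proof (induction xs arbitrary: n)
  case (Cons x xs)
  then show ?case by (cases n) auto
qed (cases n; simp)

lemma dot_span_ideal:
  assumes "set xs \<subseteq> carrier R"
  shows "ideal {dot R us xs | us. length us = length xs \<and> set us \<subseteq> carrier R} R"
proof (rule idealI')
  show "\<zero> \<in> {dot R us xs | us. length us = length xs \<and> set us \<subseteq> carrier R}"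
    using dot_zero[OF assms, of "length xs"] by (force intro!: exI[of _ "replicate (length xs) \<zero>"])
  fix x y assume "x \<in> {dot R us xs | us. length us = length xs \<and> set us \<subseteq> carrier R}"
    "y \<in> {dot R us xs | us. length us = length xs \<and> set us \<subseteq> carrier R}"
  then obtain us vs where "x = dot R us xs" "y = dot R vs xs" "length us = length xs" "length vs = length xs"
    "set us \<subseteq> carrier R" "set vs \<subseteq> carrier R" by blast
  moreover from this have "set (map2 (\<oplus>) us vs) \<subseteq> carrier R"
    by (auto intro!: a_closed dest: set_zip_leftD set_zip_rightD)
  ultimately show "x \<oplus> y \<in> {dot R us xs | us. length us = length xs \<and> set us \<subseteq> carrier R}"
    using dot_add[of us xs vs] assms
    by (intro CollectI exI[of _ "map2 (\<oplus>) us vs"]) simp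
next
  fix r x assume r: "r \<in> carrier R" and "x \<in> {dot R us xs | us. length us = length xs \<and> set us \<subseteq> carrier R}"
  then obtain us where "x = dot R us xs" "length us = length xs" "set us \<subseteq> carrier R" by blast
  moreover from this have "set (map ((\<otimes>) r) us) \<subseteq> carrier R" using r by auto
  ultimately show "r \<otimes> x \<in> {dot R us xs | us. length us = length xs \<and> set us \<subseteq> carrier R}"
    using dot_smult[of us xs r] r assms by (intro CollectI exI[of _ "map ((\<otimes>) r) us"]) simp
qed (use dot_closed assms in auto)

lemma dot_unit:
  assumes "set xs \<subseteq> carrier R" "x \<in> set xs"
  shows "\<exists>us. length us = length xs \<and> set us \<subseteq> carrier R \<and> dot R us xs = x"
  using assms
proof (induction xs)
  case (Cons a xs)
  show ?case
  proof (cases "x = a")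
    case True
    show ?thesis
      by (rule exI[of _ "\<one> # replicate (length xs) \<zero>"]) (use True Cons.prems dot_zero in auto)
  next
    case False
    then obtain us where "length us = length xs" "set us \<subseteq> carrier R" "dot R us xs = x"
      using Cons by auto
    then show ?thesis using Cons.prems dot_closed[of us xs] by (intro exI[of _ "\<zero> # us"]) auto
  qed
qed simp

lemma Idl_dot:
  assumes "set xs \<subseteq> carrier R" "s \<in> Idl (set xs)"
  obtains us where "length us = length xs" "set us \<subseteq> carrier R" "s = dot R us xs"
proof -
  have "set xs \<subseteq> {dot R us xs | us. length us = length xs \<and> set us \<subseteq> carrier R}"
    using dot_unit[OF assms(1)] by blast
  then have "Idl (set xs) \<subseteq> {dot R us xs | us. length us = length xs \<and> set us \<subseteq> carrier R}"
    by (rule genideal_minimal[OF dot_span_ideal[OF assms(1)]])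
  then show ?thesis using assms(2) that by blast
qed

text \<open>
  Depth sensitivity of the Koszul complex: multiplication by \<open>s \<in> (x\<^sub>1, \<dots>, x\<^sub>n)\<close> is homotopic
  to zero through \<open>wedge\<close>.
\<close>

lemma koszul_exact:
  assumes xs: "set xs \<subseteq> carrier R"
    and "ideal J R" "set ss \<subseteq> Idl (set xs)" "regular_sequence R J ss" "length xs < p + length ss"
    and "\<And>l. z l \<in> carrier R" "\<And>l. count_list l True < p \<Longrightarrow> z l = \<zero>"
    and "\<And>l. length l = length xs \<Longrightarrow> koszul R xs z l \<in> J"
  shows "\<exists>w. (\<forall>l. w l \<in> carrier R) \<and> (\<forall>l. count_list l True < Suc p \<longrightarrow> w l = \<zero>) \<and>
    (\<forall>l. length l = length xs \<longrightarrow> z l \<ominus> koszul R xs w l \<in> J)"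
  using assms(2-)
proof (induction ss arbitrary: J p z)
  case Nil
  have "koszul R xs (\<lambda>_. \<zero>) l = \<zero>" for l
    using koszul_in_ideal[OF zeroideal xs, of "\<lambda>_. \<zero>"] koszul_vanish[OF xs, of "Suc (count_list l True)" "\<lambda>_. \<zero>"] by auto
  \<comment> \<open>With the sequence used up, \<open>p\<close> exceeds the number of the
    \<open>xs\<close>, and no index reaches that degree.\<close>
  moreover have "z l = \<zero>" if "length l = length xs" for l
    using that Nil(4) Nil(6)[of l] count_le_length[of l True] by simp
  ultimately show ?case
    using ideal_zero[OF Nil(1)] by (intro exI[of _ "\<lambda>_. \<zero>"]) (auto simp: a_minus_def)
next
  case (Cons s ss)
  note J = Cons.prems(1) and zc = Cons.prems(5)
  have sI: "s \<in> Idl (set xs)" using Cons.prems(2) by simp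
  have sc: "s \<in> carrier R" using ideal_carr[OF genideal_ideal[OF xs] sI] .
  obtain us where us: "length us = length xs" "set us \<subseteq> carrier R" "s = dot R us xs"
    by (rule Idl_dot[OF xs sI])
  let ?J = "J <+> PIdl s"
  have J': "ideal ?J R" by (rule add_PIdl_ideal[OF J sc])
  let ?h = "wedge R us z"
  have hc: "?h l \<in> carrier R" for l by (rule wedge_closed[OF us(2) zc])
  have dc: "koszul R xs z l \<in> carrier R" for l by (rule koszul_closed[OF xs zc])
  have hd: "wedge R us (koszul R xs z) l \<in> J" if "length l = length xs" for l
    by (rule wedge_in_ideal[OF J us(2)]) (use Cons.prems(7) us(1) that in auto)
  have hom: "koszul R xs ?h l \<oplus> wedge R us (koszul R xs z) l = s \<otimes> z l" if "length l = length xs" for l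
    using koszul_wedge[OF us(1) that us(2) xs zc] us(3) by simp
  have hdc: "wedge R us (koszul R xs z) l \<in> carrier R" for l by (rule wedge_closed[OF us(2) dc])
  have dhc: "koszul R xs ?h l \<in> carrier R" for l by (rule koszul_closed[OF xs hc])
  have dh: "koszul R xs ?h l \<in> ?J" if l: "length l = length xs" for l
  proof (rule ideal_cancel[OF J' _ _ dhc])
    show "wedge R us (koszul R xs z) l \<in> ?J" using hd[OF l] sub_add_PIdl[OF J sc] by blast
    show "koszul R xs ?h l \<oplus> wedge R us (koszul R xs z) l \<in> ?J"
      unfolding hom[OF l] using ideal_mult'[OF J' self_in_add_PIdl[OF J sc] zc] .
  qed
  \<comment> \<open>By the homotopy, u z is a cycle modulo \<open>J + (s)\<close>. It lives one
    degree higher, and this compensates for the loss of \<open>s\<close> in the bound on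
    lengths.\<close>
  have "\<exists>w. (\<forall>l. w l \<in> carrier R) \<and> (\<forall>l. count_list l True < Suc (Suc p) \<longrightarrow> w l = \<zero>) \<and>
    (\<forall>l. length l = length xs \<longrightarrow> ?h l \<ominus> koszul R xs w l \<in> ?J)"
    by (rule Cons.IH[OF J'])
      (use Cons.prems hc dh wedge_vanish[OF us(2), of p z] in auto)
  then obtain w where w: "\<And>l. w l \<in> carrier R" "\<And>l. count_list l True < Suc (Suc p) \<Longrightarrow> w l = \<zero>"
    "\<And>l. length l = length xs \<Longrightarrow> ?h l \<ominus> koszul R xs w l \<in> ?J" by blast
  have dwc: "koszul R xs w l \<in> carrier R" for l by (rule koszul_closed[OF xs w(1)])
  \<comment> \<open>The multiple of \<open>s\<close> in u z - d w is split off. In degrees up to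
    \<open>p\<close> both terms vanish, and there \<open>v\<close> is set to zero to keep the degree
    bound.\<close>
  have "\<exists>v. v \<in> carrier R \<and> (count_list l True < Suc p \<longrightarrow> v = \<zero>) \<and>
    (length l = length xs \<longrightarrow> ?h l \<ominus> koszul R xs w l \<ominus> s \<otimes> v \<in> J)" for l
  proof (cases "count_list l True < Suc p")
    case True
    have "?h l = \<zero>" by (rule wedge_vanish[OF us(2) Cons.prems(6) True])
    moreover have "koszul R xs w l = \<zero>" by (rule koszul_vanish[OF xs w(2) True])
    ultimately show ?thesis using sc ideal_zero[OF J] by (intro exI[of _ \<zero>]) (simp add: a_minus_def)
  next
    case False
    show ?thesis
    proof (cases "length l = length xs")
      case True
      then obtain j v where j: "j \<in> J" "v \<in> carrier R" "?h l \<ominus> koszul R xs w l = j \<oplus> v \<otimes> s"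
        using w(3) mem_add_PIdl_iff by blast
      have jc: "j \<in> carrier R" using j ideal_carr[OF J] by blast
      have "j \<oplus> v \<otimes> s \<ominus> s \<otimes> v = j" using jc j(2) sc by algebra
      then show ?thesis using j False by (intro exI[of _ v]) auto
    qed (use False in \<open>auto intro!: exI[of _ \<zero>]\<close>)
  qed
  then obtain v where v: "\<And>l. v l \<in> carrier R" "\<And>l. count_list l True < Suc p \<Longrightarrow> v l = \<zero>"
    "\<And>l. length l = length xs \<Longrightarrow> ?h l \<ominus> koszul R xs w l \<ominus> s \<otimes> v l \<in> J" by metis
  define j where "j l = ?h l \<ominus> koszul R xs w l \<ominus> s \<otimes> v l" for l
  have jc: "j l \<in> carrier R" for l unfolding j_def using hc dwc sc v(1) by simp
  have dvc: "koszul R xs v l \<in> carrier R" for l by (rule koszul_closed[OF xs v(1)])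
  have djc: "koszul R xs j l \<in> carrier R" for l by (rule koszul_closed[OF xs jc])
  have heq: "?h = (\<lambda>l. koszul R xs w l \<oplus> (s \<otimes> v l \<oplus> j l))"
  proof
    fix l
    obtain a b c where abc: "a = ?h l" "b = koszul R xs w l" "c = v l" by blast
    have "a \<in> carrier R" "b \<in> carrier R" "c \<in> carrier R" using abc hc dwc v(1) by auto
    then have "a = b \<oplus> (s \<otimes> c \<oplus> (a \<ominus> b \<ominus> s \<otimes> c))" using sc by algebra
    then show "?h l = koszul R xs w l \<oplus> (s \<otimes> v l \<oplus> j l)" unfolding j_def abc .
  qed
  have dh_eq: "koszul R xs ?h l = s \<otimes> koszul R xs v l \<oplus> koszul R xs j l" for l
  proof -
    have "koszul R xs ?h l = koszul R xs (koszul R xs w) l \<oplus> (s \<otimes> koszul R xs v l \<oplus> koszul R xs j l)"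
      unfolding heq using dwc sc v(1) jc xs by (simp add: koszul_add koszul_smult)
    then show ?thesis using koszul_koszul[OF xs w(1)] sc dvc djc by simp
  qed
  \<comment> \<open>Applying d to u z = d w + s v + j removes d w. Compared with the homotopy
    formula this leaves s (z - d v) in \<open>J\<close>, and \<open>s\<close> cancels because it is
    regular modulo \<open>J\<close>.\<close>
  have "z l \<ominus> koszul R xs v l \<in> J" if l: "length l = length xs" for l
  proof -
    have dj: "koszul R xs j l \<in> J" by (rule koszul_in_ideal[OF J xs _ l]) (use v(3) j_def in auto)
    obtain a b c e where abc: "a = z l" "b = koszul R xs v l" "c = koszul R xs j l"
      "e = wedge R us (koszul R xs z) l" by blast
    have c': "a \<in> carrier R" "b \<in> carrier R" "c \<in> carrier R" "e \<in> carrier R"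
      using abc zc dvc djc hdc by auto
    have "(a \<ominus> b) \<otimes> s = s \<otimes> a \<ominus> s \<otimes> b" using c' sc by algebra
    also have "\<dots> = (s \<otimes> b \<oplus> c) \<oplus> e \<ominus> s \<otimes> b"
      using hom[OF l] dh_eq[of l] unfolding abc by simp
    also have "\<dots> = c \<oplus> e" using c' sc by algebra
    also have "\<dots> \<in> J" using ideal_add[OF J] dj hd[OF l] abc by simp
    finally have "(a \<ominus> b) \<otimes> s \<in> J" .
    then show ?thesis using Cons.prems(3) c' unfolding abc by simp
  qed
  then show ?case using v by blast
qed

end

text \<open>The sum of the B x_i z_i, where z_i is the coefficient of e_i: only the degree one part
  of \<open>z\<close> is read, and \<open>True # replicate (length xs) False\<close> is the index of
  the first basis vector.\<close>

fun koszul_pairing ::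
  "('a, 'b, 'd) module_scheme \<Rightarrow> ('a \<Rightarrow> 'a \<Rightarrow> 'b) \<Rightarrow> 'a list \<Rightarrow> (bool list \<Rightarrow> 'a) \<Rightarrow> 'b" where
  "koszul_pairing M B [] z = \<zero>\<^bsub>M\<^esub>"
| "koszul_pairing M B (x # xs) z =
     B x (z (True # replicate (length xs) False)) \<oplus>\<^bsub>M\<^esub> koszul_pairing M B xs (\<lambda>l. z (False # l))"

fun pairing_sum :: "('a, 'b, 'd) module_scheme \<Rightarrow> ('a \<Rightarrow> 'a \<Rightarrow> 'b) \<Rightarrow> 'a list \<Rightarrow> 'a list \<Rightarrow> 'b" where
  "pairing_sum M B (x # xs) (y # ys) = B x y \<oplus>\<^bsub>M\<^esub> pairing_sum M B xs ys"
| "pairing_sum M B _ _ = \<zero>\<^bsub>M\<^esub>"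

lemma koszul_pairing_cong:
  assumes "\<And>l. length l = length xs \<Longrightarrow> z l = z' l"
  shows "koszul_pairing M B xs z = koszul_pairing M B xs z'"
  using assms
proof (induction xs arbitrary: z z')
  case (Cons x xs)
  have "koszul_pairing M B xs (\<lambda>l. z (False # l)) = koszul_pairing M B xs (\<lambda>l. z' (False # l))"
    by (rule Cons.IH) (use Cons.prems in auto)
  then show ?case using Cons.prems by simp
qed simp

lemma koszul_pairing_degree_one:
  assumes "length ys = length xs"
  shows "koszul_pairing M B xs (degree_one R ys) = pairing_sum M B xs ys"
  using assms
proof (induction ys xs rule: list_induct2)
  case (Cons y ys x xs)
  have "degree_one R (y # ys) (True # replicate (length xs) False) = y" by simp
  moreover have "(\<lambda>l. degree_one R (y # ys) (False # l)) = degree_one R ys" by (rule ext) simp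
  ultimately show ?case using Cons.IH by simp
qed simp

context cring
begin

lemma degree_one_closed: "set ys \<subseteq> carrier R \<Longrightarrow> degree_one R ys l \<in> carrier R"
proof (induction ys arbitrary: l)
  case (Cons y ys)
  then show ?case by (cases l) auto
qed simp

lemma degree_one_vanish: "count_list l True < 1 \<Longrightarrow> degree_one R ys l = \<zero>"
proof (induction ys arbitrary: l)
  case (Cons y ys)
  then show ?case by (cases l) (auto split: if_splits)
qed simp

lemma koszul_vanish_zero:
  assumes "set xs \<subseteq> carrier R" "\<And>l. True \<in> set l \<Longrightarrow> z l = \<zero>"
  shows "koszul R xs z l = \<zero>"
  using assms
proof (induction xs arbitrary: z l)
  case (Cons x xs)
  show ?case
  proof (cases l)
    case (Cons b m)
    have "koszul R xs (\<lambda>l. z (b # l)) m = \<zero>" for b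
      by (rule Cons.IH) (use Cons.prems in auto)
    moreover have "koszul R xs (\<lambda>l. \<zero>) m = \<zero>" by (rule Cons.IH) (use Cons.prems in auto)
    ultimately show ?thesis using Cons Cons.prems by simp
  qed simp
qed simp

lemma koszul_degree_one:
  assumes "length ys = length xs" "length l = length xs" "set xs \<subseteq> carrier R" "set ys \<subseteq> carrier R"
  shows "koszul R xs (degree_one R ys) l = (if True \<in> set l then \<zero> else dot R ys xs)"
  using assms
proof (induction ys xs arbitrary: l rule: list_induct2)
  case (Cons y ys x xs)
  then obtain b m where l: "l = b # m" "length m = length xs" by (cases l) auto
  have IH: "koszul R xs (degree_one R ys) m = (if True \<in> set m then \<zero> else dot R ys xs)"
    using Cons l by simp
  have T: "koszul R xs (\<lambda>l. if True \<in> set l then \<zero> else y) m = \<zero>"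
    by (rule koszul_vanish_zero) (use Cons.prems in auto)
  have "(\<lambda>l. degree_one R (y # ys) (False # l)) = degree_one R ys"
    "(\<lambda>l. degree_one R (y # ys) (True # l)) = (\<lambda>l. if True \<in> set l then \<zero> else y)"
    by (rule ext, simp)+
  then show ?case unfolding l using IH T Cons.prems dot_closed[of ys xs]
    by (auto simp: a_comm m_comm)
qed simp

end

text \<open>Linearity is asked for in the second argument; symmetry transfers it to the
  first.\<close>

locale symmetric_pairing = module R M for R (structure) and M (structure) +
  fixes D :: "'a set" and B :: "'a \<Rightarrow> 'a \<Rightarrow> 'c"
  assumes D: "ideal D R"
    and B_closed: "\<And>x y. x \<in> D \<Longrightarrow> y \<in> D \<Longrightarrow> B x y \<in> carrier M"
    and B_add: "\<And>x y y'. x \<in> D \<Longrightarrow> y \<in> D \<Longrightarrow> y' \<in> D \<Longrightarrow> B x (y \<oplus> y') = B x y \<oplus>\<^bsub>M\<^esub> B x y'"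
    and B_smult: "\<And>x y r. x \<in> D \<Longrightarrow> y \<in> D \<Longrightarrow> r \<in> carrier R \<Longrightarrow> B x (r \<otimes> y) = r \<odot>\<^bsub>M\<^esub> B x y"
    and B_sym: "\<And>x y. x \<in> D \<Longrightarrow> y \<in> D \<Longrightarrow> B x y = B y x"
begin

lemma B_neg: "x \<in> D \<Longrightarrow> y \<in> D \<Longrightarrow> B x (\<ominus> y) = \<ominus>\<^bsub>M\<^esub> B x y"
  using B_smult[of x y "\<ominus> \<one>"] R.ideal_carr[OF D, of y] B_closed[of x y]
  by (simp add: smult_l_minus R.l_minus)

lemma koszul_pairing_closed:
  assumes "set xs \<subseteq> D" "\<And>l. z l \<in> D"
  shows "koszul_pairing M B xs z \<in> carrier M"
  using assms by (induction xs arbitrary: z) (auto simp: B_closed)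

lemma koszul_pairing_add:
  assumes "set xs \<subseteq> D" "\<And>l. f l \<in> D" "\<And>l. g l \<in> D"
  shows "koszul_pairing M B xs (\<lambda>l. f l \<oplus> g l) = koszul_pairing M B xs f \<oplus>\<^bsub>M\<^esub> koszul_pairing M B xs g"
  using assms
proof (induction xs arbitrary: f g)
  case (Cons x xs)
  have IH: "koszul_pairing M B xs (\<lambda>l. f (False # l) \<oplus> g (False # l))
    = koszul_pairing M B xs (\<lambda>l. f (False # l)) \<oplus>\<^bsub>M\<^esub> koszul_pairing M B xs (\<lambda>l. g (False # l))"
    by (rule Cons.IH) (use Cons.prems in auto)
  have c: "koszul_pairing M B xs (\<lambda>l. f (False # l)) \<in> carrier M"
    "koszul_pairing M B xs (\<lambda>l. g (False # l)) \<in> carrier M"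
    by (rule koszul_pairing_closed; use Cons.prems in auto)+
  show ?case using IH c Cons.prems by (simp add: B_add B_closed M.a_ac)
qed simp

lemma koszul_in_D:
  assumes "set xs \<subseteq> D" "\<And>l. w l \<in> carrier R"
  shows "koszul R xs w l \<in> D"
  using assms
proof (induction xs arbitrary: w l)
  case (Cons x xs)
  show ?case
  proof (cases l)
    case (Cons b m)
    have "koszul R xs (\<lambda>l. w (b # l)) m \<in> D" for b by (rule Cons.IH) (use Cons.prems in auto)
    moreover have "x \<otimes> w (True # m) \<in> D" using Cons.prems R.ideal_mult'[OF D] by auto
    ultimately show ?thesis using Cons R.ideal_add[OF D] R.ideal_neg[OF D] by auto
  qed (use R.ideal_zero[OF D] in simp)
qed (use R.ideal_zero[OF D] in simp)

text \<open>At the all-false index, d w is the sum of the y_i w_i. Symmetry exchanges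
  \<open>x\<close> with each y_i, because B x (y w) = w B x y = w B y x = B y (x w).\<close>

lemma pairing_koszul:
  assumes "set xs \<subseteq> D" "\<And>l. w l \<in> carrier R" "x \<in> D"
  shows "B x (koszul R xs w (replicate (length xs) False)) = koszul_pairing M B xs (\<lambda>l. x \<otimes> w l)"
  using assms(1,2)
proof (induction xs arbitrary: w)
  case Nil
  have "B x \<zero> = \<zero>\<^bsub>M\<^esub>"
    using B_smult[OF assms(3,3), of "\<zero>"] R.ideal_carr[OF D assms(3)] B_closed[OF assms(3,3)] by simp
  then show ?case by simp
next
  case (Cons y xs)
  let ?r = "replicate (length xs) False"
  have y: "y \<in> D" and xs: "set xs \<subseteq> D" using Cons.prems by auto
  have yc: "y \<in> carrier R" and xc: "x \<in> carrier R" using R.ideal_carr[OF D] y assms(3) by auto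
  have wc: "w (True # ?r) \<in> carrier R" using Cons.prems(2) .
  have IH: "B x (koszul R xs (\<lambda>l. w (False # l)) ?r) = koszul_pairing M B xs (\<lambda>l. x \<otimes> w (False # l))"
    by (rule Cons.IH[OF xs]) (use Cons.prems in auto)
  have kD: "koszul R xs (\<lambda>l. w (False # l)) ?r \<in> D" by (rule koszul_in_D[OF xs]) (use Cons.prems in auto)
  have "B x (y \<otimes> w (True # ?r)) = B y (x \<otimes> w (True # ?r))"
    using B_smult[OF assms(3) y wc] B_smult[OF y assms(3) wc] B_sym[OF y assms(3)] R.m_comm[OF wc] yc xc by simp
  moreover have "koszul_pairing M B xs (\<lambda>l. x \<otimes> w (False # l)) \<in> carrier M"
    using B_closed[OF assms(3) kD] IH by simp
  moreover have "y \<otimes> w (True # ?r) \<in> D" "x \<otimes> w (True # ?r) \<in> D"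
    using R.ideal_mult'[OF D _ wc] y assms(3) by auto
  ultimately show ?case
    using IH kD assms(3) y B_add B_closed by (simp add: M.a_comm)
qed

text \<open>Boundaries are antisymmetric and \<open>B\<close> is symmetric. Concretely, for w = w_0
  + e_1 w_1, the coefficient of e_1 in d w contributes -B x (d w_1), and the summand x w_1
  contributes the same with a plus sign by \<open>pairing_koszul\<close>; d w_0 is left to the
  induction.\<close>

lemma koszul_pairing_koszul:
  assumes "set xs \<subseteq> D" "\<And>l. w l \<in> carrier R"
  shows "koszul_pairing M B xs (koszul R xs w) = \<zero>\<^bsub>M\<^esub>"
  using assms
proof (induction xs arbitrary: w)
  case (Cons x xs)
  let ?r = "replicate (length xs) False"
  have x: "x \<in> D" and xs: "set xs \<subseteq> D" using Cons.prems by auto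
  have wc: "w l \<in> carrier R" for l using Cons.prems(2) .
  have xw: "x \<otimes> w l \<in> D" for l using R.ideal_mult'[OF D x wc] .
  have k: "koszul R xs (\<lambda>l. w (b # l)) l \<in> D" for b l by (rule koszul_in_D[OF xs wc])
  let ?p = "koszul_pairing M B xs (\<lambda>l. x \<otimes> w (True # l))"
  have pc: "?p \<in> carrier M" by (rule koszul_pairing_closed[OF xs xw])
  have 1: "B x (koszul R xs (\<lambda>l. w (True # l)) ?r) = ?p"
    by (rule pairing_koszul[OF xs wc x])
  have 2: "koszul_pairing M B xs (\<lambda>l. koszul R xs (\<lambda>l. w (False # l)) l \<oplus> x \<otimes> w (True # l))
    = koszul_pairing M B xs (koszul R xs (\<lambda>l. w (False # l))) \<oplus>\<^bsub>M\<^esub> ?p"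
    by (rule koszul_pairing_add[OF xs k xw])
  have 3: "koszul_pairing M B xs (koszul R xs (\<lambda>l. w (False # l))) = \<zero>\<^bsub>M\<^esub>"
    by (rule Cons.IH[OF xs wc])
  have "koszul_pairing M B (x # xs) (koszul R (x # xs) w) =
    B x (\<ominus> koszul R xs (\<lambda>l. w (True # l)) ?r) \<oplus>\<^bsub>M\<^esub>
    koszul_pairing M B xs (\<lambda>l. koszul R xs (\<lambda>l. w (False # l)) l \<oplus> x \<otimes> w (True # l))"
    by simp
  also have "\<dots> = \<ominus>\<^bsub>M\<^esub> ?p \<oplus>\<^bsub>M\<^esub> ?p"
    unfolding 2 3 B_neg[OF x k] 1 using pc by simp
  also have "\<dots> = \<zero>\<^bsub>M\<^esub>" using pc by (rule M.l_neg)
  finally show ?case .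
qed simp

text \<open>
  All syzygies of \<open>xs\<close> being Koszul syzygies, a symmetric pairing vanishes on them.
\<close>

lemma pairing_sum_syzygy:
  assumes "set xs \<subseteq> D" "set ss \<subseteq> Idl (set xs)" "regular_sequence R {\<zero>} ss" "length ss = length xs"
    and ys: "length ys = length xs" "set ys \<subseteq> carrier R" "dot R ys xs = \<zero>"
  shows "pairing_sum M B xs ys = \<zero>\<^bsub>M\<^esub>"
proof -
  have xs: "set xs \<subseteq> carrier R" using assms(1) R.ideal_sub[OF D] by blast
  let ?z = "degree_one R ys"
  have zc: "?z l \<in> carrier R" for l by (rule R.degree_one_closed[OF ys(2)])
  have "\<exists>w. (\<forall>l. w l \<in> carrier R) \<and> (\<forall>l. count_list l True < Suc 1 \<longrightarrow> w l = \<zero>) \<and>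
    (\<forall>l. length l = length xs \<longrightarrow> ?z l \<ominus> koszul R xs w l \<in> {\<zero>})"
    by (rule R.koszul_exact[OF xs R.zeroideal assms(2,3)])
      (use assms(4) zc R.degree_one_vanish R.koszul_degree_one[OF ys(1) _ xs ys(2)] ys(3) in auto)
  then obtain w where w: "\<And>l. w l \<in> carrier R"
    "\<And>l. length l = length xs \<Longrightarrow> ?z l \<ominus> koszul R xs w l = \<zero>" by auto
  have "?z l = koszul R xs w l" if "length l = length xs" for l
    by (rule R.diff_zeroD[OF zc R.koszul_closed[OF xs w(1)] w(2)[OF that]])
  then have "koszul_pairing M B xs ?z = koszul_pairing M B xs (koszul R xs w)"
    by (rule koszul_pairing_cong)
  then show ?thesis
    using koszul_pairing_koszul[OF assms(1) w(1)] koszul_pairing_degree_one[OF ys(1), of M B R] by simp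
qed

end

section \<open>Extension of homomorphisms\<close>

text \<open>Partial homomorphisms are handled through their graphs.\<close>

definition linear_graph ::
  "('a, 'c) ring_scheme \<Rightarrow> ('a, 'b, 'd) module_scheme \<Rightarrow> ('a, 'e, 'f) module_scheme \<Rightarrow> ('b \<times> 'e) set \<Rightarrow> bool"
where
  "linear_graph R M E G \<longleftrightarrow> G \<subseteq> carrier M \<times> carrier E \<and> (\<zero>\<^bsub>M\<^esub>, \<zero>\<^bsub>E\<^esub>) \<in> G \<and>
     (\<forall>x e x' e'. (x, e) \<in> G \<longrightarrow> (x', e') \<in> G \<longrightarrow> (x \<oplus>\<^bsub>M\<^esub> x', e \<oplus>\<^bsub>E\<^esub> e') \<in> G) \<and>
     (\<forall>r\<in>carrier R. \<forall>x e. (x, e) \<in> G \<longrightarrow> (r \<odot>\<^bsub>M\<^esub> x, r \<odot>\<^bsub>E\<^esub> e) \<in> G) \<and>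
     (\<forall>e. (\<zero>\<^bsub>M\<^esub>, e) \<in> G \<longrightarrow> e = \<zero>\<^bsub>E\<^esub>)"

lemma linear_graphD:
  assumes "linear_graph R M E G"
  shows "\<And>x e. (x, e) \<in> G \<Longrightarrow> x \<in> carrier M" "\<And>x e. (x, e) \<in> G \<Longrightarrow> e \<in> carrier E"
    "(\<zero>\<^bsub>M\<^esub>, \<zero>\<^bsub>E\<^esub>) \<in> G"
    "\<And>x e x' e'. (x, e) \<in> G \<Longrightarrow> (x', e') \<in> G \<Longrightarrow> (x \<oplus>\<^bsub>M\<^esub> x', e \<oplus>\<^bsub>E\<^esub> e') \<in> G"
    "\<And>r x e. r \<in> carrier R \<Longrightarrow> (x, e) \<in> G \<Longrightarrow> (r \<odot>\<^bsub>M\<^esub> x, r \<odot>\<^bsub>E\<^esub> e) \<in> G"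
    "\<And>e. (\<zero>\<^bsub>M\<^esub>, e) \<in> G \<Longrightarrow> e = \<zero>\<^bsub>E\<^esub>"
  using assms unfolding linear_graph_def by auto

lemma module_neg_smult:
  assumes "module R M" "x \<in> carrier M"
  shows "(\<ominus>\<^bsub>R\<^esub> \<one>\<^bsub>R\<^esub>) \<odot>\<^bsub>M\<^esub> x = \<ominus>\<^bsub>M\<^esub> x"
proof -
  interpret module R M by fact
  show ?thesis using smult_l_minus[OF _ assms(2), of "\<one>\<^bsub>R\<^esub>"] assms(2) by simp
qed

lemma linear_graph_neg:
  assumes "module R M" "module R E" "linear_graph R M E G" "(x, e) \<in> G"
  shows "(\<ominus>\<^bsub>M\<^esub> x, \<ominus>\<^bsub>E\<^esub> e) \<in> G"
proof -
  interpret module R M by fact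
  have "\<ominus>\<^bsub>R\<^esub> \<one>\<^bsub>R\<^esub> \<in> carrier R" by simp
  from linear_graphD(5)[OF assms(3) this assms(4)] show ?thesis
    using module_neg_smult[OF assms(1) linear_graphD(1)[OF assms(3,4)]]
      module_neg_smult[OF assms(2) linear_graphD(2)[OF assms(3,4)]] by simp
qed

lemma linear_graph_unique:
  assumes "module R M" "module R E" "linear_graph R M E G" "(x, e) \<in> G" "(x, e') \<in> G"
  shows "e = e'"
proof -
  interpret M: module R M by fact
  interpret E: module R E by fact
  note c = linear_graphD(1,2)[OF assms(3)]
  have "(x \<oplus>\<^bsub>M\<^esub> \<ominus>\<^bsub>M\<^esub> x, e \<oplus>\<^bsub>E\<^esub> \<ominus>\<^bsub>E\<^esub> e') \<in> G"
    by (rule linear_graphD(4)[OF assms(3,4) linear_graph_neg[OF assms(1-3,5)]])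
  then have "e \<oplus>\<^bsub>E\<^esub> \<ominus>\<^bsub>E\<^esub> e' = \<zero>\<^bsub>E\<^esub>"
    using linear_graphD(6)[OF assms(3)] c assms(4) M.M.r_neg by simp
  then show ?thesis using c(2)[OF assms(4)] c(2)[OF assms(5)] by (metis E.M.minus_equality E.M.minus_minus E.M.a_inv_closed)
qed

lemma linear_graph_Union:
  assumes "C \<noteq> {}" "\<And>G. G \<in> C \<Longrightarrow> linear_graph R M E G" "\<And>G H. G \<in> C \<Longrightarrow> H \<in> C \<Longrightarrow> G \<subseteq> H \<or> H \<subseteq> G"
  shows "linear_graph R M E (\<Union>C)"
  unfolding linear_graph_def
proof (intro conjI allI impI ballI)
  show "\<Union>C \<subseteq> carrier M \<times> carrier E" using assms(2) unfolding linear_graph_def by blast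
  show "(\<zero>\<^bsub>M\<^esub>, \<zero>\<^bsub>E\<^esub>) \<in> \<Union>C" using assms(1) linear_graphD(3)[OF assms(2)] by blast
  show "(x \<oplus>\<^bsub>M\<^esub> x', e \<oplus>\<^bsub>E\<^esub> e') \<in> \<Union>C" if in_C: "(x, e) \<in> \<Union>C" "(x', e') \<in> \<Union>C" for x e x' e'
  proof -
    obtain G H where GH: "G \<in> C" "(x, e) \<in> G" "H \<in> C" "(x', e') \<in> H" using in_C by blast
    show ?thesis
    proof (cases "G \<subseteq> H")
      case True
      then show ?thesis using linear_graphD(4)[OF assms(2)[OF GH(3)], of x e x' e'] GH by blast
    next
      case False
      then have "H \<subseteq> G" using assms(3) GH by blast
      then show ?thesis using linear_graphD(4)[OF assms(2)[OF GH(1)], of x e x' e'] GH by blast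
    qed
  qed
  show "(r \<odot>\<^bsub>M\<^esub> x, r \<odot>\<^bsub>E\<^esub> e) \<in> \<Union>C" if r: "r \<in> carrier R" and xe: "(x, e) \<in> \<Union>C" for r x e
  proof -
    obtain G where G: "G \<in> C" "(x, e) \<in> G" using xe by blast
    show ?thesis using linear_graphD(5)[OF assms(2)[OF G(1)] r G(2)] G(1) by blast
  qed
  show "e = \<zero>\<^bsub>E\<^esub>" if e: "(\<zero>\<^bsub>M\<^esub>, e) \<in> \<Union>C" for e
  proof -
    obtain G where G: "G \<in> C" "(\<zero>\<^bsub>M\<^esub>, e) \<in> G" using e by blast
    show ?thesis by (rule linear_graphD(6)[OF assms(2)[OF G(1)] G(2)])
  qed
qed

text \<open>
  Only homomorphisms killed by \<open>\<bb>\<close> are considered, so that \<open>E\<close> is in effect a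
  module over \<open>R/\<bb>\<close>.
\<close>

lemma linear_graph_extension:
  assumes M: "module R M" and E: "module R E" and G0: "linear_graph R M E G0"
    and \<bb>: "\<And>r x. r \<in> \<bb> \<Longrightarrow> x \<in> carrier M \<Longrightarrow> (r \<odot>\<^bsub>M\<^esub> x, \<zero>\<^bsub>E\<^esub>) \<in> G0" "\<bb> \<subseteq> carrier R"
    and baer: "\<And>I f. ideal I R \<Longrightarrow> \<bb> \<subseteq> I \<Longrightarrow> (\<And>r. r \<in> I \<Longrightarrow> f r \<in> carrier E) \<Longrightarrow>
      (\<And>r s. r \<in> I \<Longrightarrow> s \<in> I \<Longrightarrow> f (r \<oplus>\<^bsub>R\<^esub> s) = f r \<oplus>\<^bsub>E\<^esub> f s) \<Longrightarrow>
      (\<And>r s. r \<in> carrier R \<Longrightarrow> s \<in> I \<Longrightarrow> f (r \<otimes>\<^bsub>R\<^esub> s) = r \<odot>\<^bsub>E\<^esub> f s) \<Longrightarrow>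
      (\<And>r. r \<in> \<bb> \<Longrightarrow> f r = \<zero>\<^bsub>E\<^esub>) \<Longrightarrow> \<exists>w\<in>carrier E. \<forall>r\<in>I. f r = r \<odot>\<^bsub>E\<^esub> w"
  obtains G where "linear_graph R M E G" "G0 \<subseteq> G" "fst ` G = carrier M"
proof -
  interpret M: module R M by fact
  interpret E: module R E by fact
  let ?C = "{G. linear_graph R M E G \<and> G0 \<subseteq> G}"
  have "\<exists>G\<in>?C. \<forall>H\<in>?C. G \<subseteq> H \<longrightarrow> H = G"
  proof (rule subset_Zorn_nonempty)
    show "?C \<noteq> {}" using G0 by blast
    fix D assume D: "D \<noteq> {}" "subset.chain ?C D"
    have sub: "D \<subseteq> ?C" and tot: "\<And>G H. G \<in> D \<Longrightarrow> H \<in> D \<Longrightarrow> G \<subseteq> H \<or> H \<subseteq> G"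
      using D(2) unfolding subset_chain_def by auto
    have "linear_graph R M E (\<Union>D)" by (rule linear_graph_Union[OF D(1) _ tot]) (use sub in auto)
    then show "\<Union>D \<in> ?C" using sub D(1) by auto
  qed
  then obtain G where G: "linear_graph R M E G" "G0 \<subseteq> G" and
    max: "\<And>H. linear_graph R M E H \<Longrightarrow> G \<subseteq> H \<Longrightarrow> H = G" by auto
  note Gc = linear_graphD(1,2)[OF G(1)] and G_0 = linear_graphD(3)[OF G(1)]
    and G_add = linear_graphD(4)[OF G(1)] and G_smult = linear_graphD(5)[OF G(1)]
    and G_fun = linear_graphD(6)[OF G(1)]
  have "carrier M \<subseteq> fst ` G"
  proof
    fix x assume x: "x \<in> carrier M"
    \<comment> \<open>The conductor of \<open>x\<close> into the domain of \<open>G\<close>. A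
      \<open>w\<close> with \<open>f r = r w\<close> on it is a consistent value for an extension at
      \<open>x\<close>.\<close>
    define I where "I = {r \<in> carrier R. \<exists>e. (r \<odot>\<^bsub>M\<^esub> x, e) \<in> G}"
    define f where "f r = (SOME e. (r \<odot>\<^bsub>M\<^esub> x, e) \<in> G)" for r
    have fG: "(r \<odot>\<^bsub>M\<^esub> x, f r) \<in> G" if "r \<in> I" for r
      using that unfolding I_def f_def by (auto intro: someI)
    have f_eq: "f r = e" if "(r \<odot>\<^bsub>M\<^esub> x, e) \<in> G" "r \<in> carrier R" for r e
      using linear_graph_unique[OF M E G(1) fG that(1)] that unfolding I_def by blast
    have Iadd: "(r \<oplus>\<^bsub>R\<^esub> s \<in> I) \<and> f (r \<oplus>\<^bsub>R\<^esub> s) = f r \<oplus>\<^bsub>E\<^esub> f s" if rs: "r \<in> I" "s \<in> I" for r s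
    proof -
      have c: "r \<in> carrier R" "s \<in> carrier R" using rs unfolding I_def by auto
      have "((r \<oplus>\<^bsub>R\<^esub> s) \<odot>\<^bsub>M\<^esub> x, f r \<oplus>\<^bsub>E\<^esub> f s) \<in> G"
        using G_add[OF fG[OF rs(1)] fG[OF rs(2)]] M.smult_l_distr[OF c x] by simp
      then show ?thesis using f_eq c unfolding I_def by auto
    qed
    have Ismult: "(r \<otimes>\<^bsub>R\<^esub> s \<in> I) \<and> f (r \<otimes>\<^bsub>R\<^esub> s) = r \<odot>\<^bsub>E\<^esub> f s" if rs: "r \<in> carrier R" "s \<in> I" for r s
    proof -
      have c: "s \<in> carrier R" using rs unfolding I_def by auto
      have "((r \<otimes>\<^bsub>R\<^esub> s) \<odot>\<^bsub>M\<^esub> x, r \<odot>\<^bsub>E\<^esub> f s) \<in> G"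
        using G_smult[OF rs(1) fG[OF rs(2)]] M.smult_assoc1[OF rs(1) c x] by simp
      then show ?thesis using f_eq c rs(1) unfolding I_def by auto
    qed
    have bx: "(r \<odot>\<^bsub>M\<^esub> x, \<zero>\<^bsub>E\<^esub>) \<in> G" if "r \<in> \<bb>" for r using \<bb>(1)[OF that x] G(2) by blast
    have "\<exists>w\<in>carrier E. \<forall>r\<in>I. f r = r \<odot>\<^bsub>E\<^esub> w"
    proof (rule baer)
      show "ideal I R"
      proof (rule M.R.idealI')
        show "I \<subseteq> carrier R" unfolding I_def by blast
        show "\<zero>\<^bsub>R\<^esub> \<in> I" unfolding I_def using G_0 x by auto
      qed (use Iadd Ismult in auto)
      show "\<bb> \<subseteq> I" unfolding I_def using bx \<bb>(2) by blast
      show "f r \<in> carrier E" if "r \<in> I" for r using fG[OF that] Gc by blast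
      show "f r = \<zero>\<^bsub>E\<^esub>" if "r \<in> \<bb>" for r using f_eq[OF bx[OF that]] that \<bb>(2) by blast
    qed (use Iadd Ismult in auto)
    then obtain w where w: "w \<in> carrier E" "\<And>r. r \<in> I \<Longrightarrow> f r = r \<odot>\<^bsub>E\<^esub> w" by blast
    define H where "H = {(n \<oplus>\<^bsub>M\<^esub> r \<odot>\<^bsub>M\<^esub> x, e \<oplus>\<^bsub>E\<^esub> r \<odot>\<^bsub>E\<^esub> w) | n e r. (n, e) \<in> G \<and> r \<in> carrier R}"
    have HI: "(n \<oplus>\<^bsub>M\<^esub> r \<odot>\<^bsub>M\<^esub> x, e \<oplus>\<^bsub>E\<^esub> r \<odot>\<^bsub>E\<^esub> w) \<in> H" if "(n, e) \<in> G" "r \<in> carrier R" for n e r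
      using that unfolding H_def by blast
    have GH: "G \<subseteq> H"
    proof
      fix p assume p: "p \<in> G"
      obtain n e where ne: "p = (n, e)" by (cases p)
      have "n \<oplus>\<^bsub>M\<^esub> \<zero>\<^bsub>R\<^esub> \<odot>\<^bsub>M\<^esub> x = n" "e \<oplus>\<^bsub>E\<^esub> \<zero>\<^bsub>R\<^esub> \<odot>\<^bsub>E\<^esub> w = e"
        using p x w Gc unfolding ne by auto
      then show "p \<in> H" using HI[of n e "\<zero>\<^bsub>R\<^esub>"] p unfolding ne by simp
    qed
    have "linear_graph R M E H"
      unfolding linear_graph_def
    proof (intro conjI allI impI ballI)
      show "H \<subseteq> carrier M \<times> carrier E" unfolding H_def using Gc x w by auto
      show "(\<zero>\<^bsub>M\<^esub>, \<zero>\<^bsub>E\<^esub>) \<in> H" using GH G_0 by blast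
    next
      fix y e y' e' assume "(y, e) \<in> H" "(y', e') \<in> H"
      then obtain n i r n' i' r' where *: "(n, i) \<in> G" "r \<in> carrier R" "(n', i') \<in> G" "r' \<in> carrier R"
        "y = n \<oplus>\<^bsub>M\<^esub> r \<odot>\<^bsub>M\<^esub> x" "e = i \<oplus>\<^bsub>E\<^esub> r \<odot>\<^bsub>E\<^esub> w"
        "y' = n' \<oplus>\<^bsub>M\<^esub> r' \<odot>\<^bsub>M\<^esub> x" "e' = i' \<oplus>\<^bsub>E\<^esub> r' \<odot>\<^bsub>E\<^esub> w" unfolding H_def by blast
      have c: "n \<in> carrier M" "n' \<in> carrier M" "i \<in> carrier E" "i' \<in> carrier E"
        using Gc * by blast+
      have "y \<oplus>\<^bsub>M\<^esub> y' = (n \<oplus>\<^bsub>M\<^esub> n') \<oplus>\<^bsub>M\<^esub> (r \<oplus>\<^bsub>R\<^esub> r') \<odot>\<^bsub>M\<^esub> x"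
        unfolding * using c *(2,4) x by (simp add: M.smult_l_distr M.M.a_ac)
      moreover have "e \<oplus>\<^bsub>E\<^esub> e' = (i \<oplus>\<^bsub>E\<^esub> i') \<oplus>\<^bsub>E\<^esub> (r \<oplus>\<^bsub>R\<^esub> r') \<odot>\<^bsub>E\<^esub> w"
        unfolding * using c *(2,4) w by (simp add: E.smult_l_distr E.M.a_ac)
      ultimately show "(y \<oplus>\<^bsub>M\<^esub> y', e \<oplus>\<^bsub>E\<^esub> e') \<in> H"
        using HI[OF G_add[OF *(1,3)], of "r \<oplus>\<^bsub>R\<^esub> r'"] *(2,4) by simp
    next
      fix s y e assume s: "s \<in> carrier R" and "(y, e) \<in> H"
      then obtain n i r where *: "(n, i) \<in> G" "r \<in> carrier R"
        "y = n \<oplus>\<^bsub>M\<^esub> r \<odot>\<^bsub>M\<^esub> x" "e = i \<oplus>\<^bsub>E\<^esub> r \<odot>\<^bsub>E\<^esub> w" unfolding H_def by blast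
      have c: "n \<in> carrier M" "i \<in> carrier E" using Gc * by blast+
      have "s \<odot>\<^bsub>M\<^esub> y = s \<odot>\<^bsub>M\<^esub> n \<oplus>\<^bsub>M\<^esub> (s \<otimes>\<^bsub>R\<^esub> r) \<odot>\<^bsub>M\<^esub> x"
        unfolding * using c *(2) x s by (simp add: M.smult_r_distr M.smult_assoc1)
      moreover have "s \<odot>\<^bsub>E\<^esub> e = s \<odot>\<^bsub>E\<^esub> i \<oplus>\<^bsub>E\<^esub> (s \<otimes>\<^bsub>R\<^esub> r) \<odot>\<^bsub>E\<^esub> w"
        unfolding * using c *(2) w s by (simp add: E.smult_r_distr E.smult_assoc1)
      ultimately show "(s \<odot>\<^bsub>M\<^esub> y, s \<odot>\<^bsub>E\<^esub> e) \<in> H"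
        using HI[OF G_smult[OF s *(1)], of "s \<otimes>\<^bsub>R\<^esub> r"] *(2) s by simp
    next
      \<comment> \<open>Single-valuedness: here \<open>r x\<close> is already in the domain of
        \<open>G\<close>, and \<open>w\<close> was chosen to reproduce the values of
        \<open>G\<close> there.\<close>
      fix e assume "(\<zero>\<^bsub>M\<^esub>, e) \<in> H"
      then obtain n i r where *: "(n, i) \<in> G" "r \<in> carrier R"
        "\<zero>\<^bsub>M\<^esub> = n \<oplus>\<^bsub>M\<^esub> r \<odot>\<^bsub>M\<^esub> x" "e = i \<oplus>\<^bsub>E\<^esub> r \<odot>\<^bsub>E\<^esub> w" unfolding H_def by blast
      have c: "n \<in> carrier M" "i \<in> carrier E" using Gc * by blast+
      have "r \<odot>\<^bsub>M\<^esub> x \<oplus>\<^bsub>M\<^esub> n = \<zero>\<^bsub>M\<^esub>" using *(3) c(1) *(2) x by (simp add: M.M.a_comm)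
      then have "r \<odot>\<^bsub>M\<^esub> x = \<ominus>\<^bsub>M\<^esub> n" using M.M.minus_equality[OF _ c(1)] *(2) x by simp
      then have "(r \<odot>\<^bsub>M\<^esub> x, \<ominus>\<^bsub>E\<^esub> i) \<in> G" using linear_graph_neg[OF M E G(1) *(1)] by simp
      moreover from this have "r \<in> I" unfolding I_def using *(2) by blast
      ultimately have "r \<odot>\<^bsub>E\<^esub> w = \<ominus>\<^bsub>E\<^esub> i" using f_eq *(2) w(2) by metis
      then show "e = \<zero>\<^bsub>E\<^esub>" using *(4) c(2) E.M.r_neg by simp
    qed
    then have "H = G" using max GH by blast
    moreover have "(\<zero>\<^bsub>M\<^esub> \<oplus>\<^bsub>M\<^esub> \<one>\<^bsub>R\<^esub> \<odot>\<^bsub>M\<^esub> x, \<zero>\<^bsub>E\<^esub> \<oplus>\<^bsub>E\<^esub> \<one>\<^bsub>R\<^esub> \<odot>\<^bsub>E\<^esub> w) \<in> H" by (rule HI[OF G_0]) simp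
    ultimately have "(x, w) \<in> G" using x w by simp
    then show "x \<in> fst ` G" by force
  qed
  then have "fst ` G = carrier M" using Gc by force
  then show ?thesis using that G by blast
qed

section \<open>Self-injectivity of rings with simple socle\<close>

lemma mod_homD:
  assumes "f \<in> mod_hom R M N"
  shows "\<And>x. x \<in> carrier M \<Longrightarrow> f x \<in> carrier N" "f \<in> extensional (carrier M)"
    "\<And>x y. x \<in> carrier M \<Longrightarrow> y \<in> carrier M \<Longrightarrow> f (x \<oplus>\<^bsub>M\<^esub> y) = f x \<oplus>\<^bsub>N\<^esub> f y"
    "\<And>r x. r \<in> carrier R \<Longrightarrow> x \<in> carrier M \<Longrightarrow> f (r \<odot>\<^bsub>M\<^esub> x) = r \<odot>\<^bsub>N\<^esub> f x"
  using assms unfolding mod_hom_def by (auto simp: PiE_iff)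

lemma mod_homI:
  assumes "\<And>x. x \<in> carrier M \<Longrightarrow> f x \<in> carrier N"
    "\<And>x y. x \<in> carrier M \<Longrightarrow> y \<in> carrier M \<Longrightarrow> f (x \<oplus>\<^bsub>M\<^esub> y) = f x \<oplus>\<^bsub>N\<^esub> f y"
    "\<And>r x. r \<in> carrier R \<Longrightarrow> x \<in> carrier M \<Longrightarrow> f (r \<odot>\<^bsub>M\<^esub> x) = r \<odot>\<^bsub>N\<^esub> f x"
    and "module R M"
  shows "restrict f (carrier M) \<in> mod_hom R M N"
proof -
  interpret module R M by fact
  show ?thesis unfolding mod_hom_def using assms(1-3) by auto
qed

lemma mod_hom_zero:
  assumes "module R M" "module R N" "f \<in> mod_hom R M N"
  shows "f \<zero>\<^bsub>M\<^esub> = \<zero>\<^bsub>N\<^esub>"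
proof -
  interpret M: module R M by fact
  interpret N: module R N by fact
  have "f (\<zero>\<^bsub>R\<^esub> \<odot>\<^bsub>M\<^esub> \<zero>\<^bsub>M\<^esub>) = \<zero>\<^bsub>R\<^esub> \<odot>\<^bsub>N\<^esub> f \<zero>\<^bsub>M\<^esub>" by (rule mod_homD(4)[OF assms(3)]) auto
  then show ?thesis using mod_homD(1)[OF assms(3) M.M.zero_closed] by simp
qed

lemma mod_hom_of_graph:
  assumes "module R M" "module R E" "linear_graph R M E G" "fst ` G = carrier M"
  shows "\<exists>g\<in>mod_hom R M E. \<forall>x e. (x, e) \<in> G \<longrightarrow> g x = e"
proof -
  note u = linear_graph_unique[OF assms(1-3)]
  define g where "g x = (SOME e. (x, e) \<in> G)" for x
  have g: "(x, g x) \<in> G" if x: "x \<in> carrier M" for x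
  proof -
    have "\<exists>e. (x, e) \<in> G" using x assms(4) by force
    then show ?thesis unfolding g_def by (rule someI_ex)
  qed
  have "restrict g (carrier M) \<in> mod_hom R M E"
  proof (rule mod_homI[OF _ _ _ assms(1)])
    interpret M: module R M by fact
    show "g x \<in> carrier E" if "x \<in> carrier M" for x using linear_graphD(2)[OF assms(3) g[OF that]] .
    show "g (x \<oplus>\<^bsub>M\<^esub> y) = g x \<oplus>\<^bsub>E\<^esub> g y" if "x \<in> carrier M" "y \<in> carrier M" for x y
      by (rule u[OF g linear_graphD(4)[OF assms(3) g g]]) (use that in auto)
    show "g (r \<odot>\<^bsub>M\<^esub> x) = r \<odot>\<^bsub>E\<^esub> g x" if "r \<in> carrier R" "x \<in> carrier M" for r x
      by (rule u[OF g linear_graphD(5)[OF assms(3) _ g]]) (use that in auto)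
  qed
  moreover have "restrict g (carrier M) x = e" if "(x, e) \<in> G" for x e
    using u[OF g that] linear_graphD(1)[OF assms(3) that] by simp
  ultimately show ?thesis by blast
qed

text \<open>Baer's criterion. The graph of \<open>f\<close> transported along \<open>i\<close> is
  single-valued because \<open>i\<close> is injective.\<close>

lemma injective_moduleI:
  assumes E: "module R E"
    and baer: "\<And>I f. ideal I R \<Longrightarrow> (\<And>r. r \<in> I \<Longrightarrow> f r \<in> carrier E) \<Longrightarrow>
      (\<And>r s. r \<in> I \<Longrightarrow> s \<in> I \<Longrightarrow> f (r \<oplus>\<^bsub>R\<^esub> s) = f r \<oplus>\<^bsub>E\<^esub> f s) \<Longrightarrow>
      (\<And>r s. r \<in> carrier R \<Longrightarrow> s \<in> I \<Longrightarrow> f (r \<otimes>\<^bsub>R\<^esub> s) = r \<odot>\<^bsub>E\<^esub> f s) \<Longrightarrow>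
      \<exists>w\<in>carrier E. \<forall>r\<in>I. f r = r \<odot>\<^bsub>E\<^esub> w"
  shows "injective_module R E"
  unfolding injective_module_def
proof (intro conjI allI impI)
  fix A B :: "('a, 'a) module" and i f
  assume H: "module R A \<and> module R B \<and> i \<in> mod_hom R A B \<and> inj_on i (carrier A) \<and> f \<in> mod_hom R A E"
  then have A: "module R A" and B: "module R B" and i: "i \<in> mod_hom R A B" "inj_on i (carrier A)"
    and f: "f \<in> mod_hom R A E" by auto
  interpret A: module R A by fact
  interpret B: module R B by fact
  interpret E: module R E by fact
  define G0 where "G0 = (\<lambda>a. (i a, f a)) ` carrier A"
  have G0I: "(y, e) \<in> G0" if "a \<in> carrier A" "y = i a" "e = f a" for a y e
    using that unfolding G0_def by auto
  have lin: "linear_graph R B E G0"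
    unfolding linear_graph_def
  proof (intro conjI allI impI ballI)
    show "G0 \<subseteq> carrier B \<times> carrier E" unfolding G0_def using mod_homD(1)[OF i(1)] mod_homD(1)[OF f] by auto
    show "(\<zero>\<^bsub>B\<^esub>, \<zero>\<^bsub>E\<^esub>) \<in> G0"
      by (rule G0I[of "\<zero>\<^bsub>A\<^esub>"]) (use mod_hom_zero[OF A B i(1)] mod_hom_zero[OF A E f] in auto)
    show "(x \<oplus>\<^bsub>B\<^esub> x', e \<oplus>\<^bsub>E\<^esub> e') \<in> G0" if xe: "(x, e) \<in> G0" "(x', e') \<in> G0" for x e x' e'
    proof -
      obtain a a' where a: "a \<in> carrier A" "a' \<in> carrier A" "x = i a" "e = f a" "x' = i a'" "e' = f a'"
        using xe unfolding G0_def by auto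
      show ?thesis
        by (rule G0I[of "a \<oplus>\<^bsub>A\<^esub> a'"]) (use a mod_homD(3)[OF i(1)] mod_homD(3)[OF f] in auto)
    qed
    show "(r \<odot>\<^bsub>B\<^esub> x, r \<odot>\<^bsub>E\<^esub> e) \<in> G0" if r: "r \<in> carrier R" and xe: "(x, e) \<in> G0" for r x e
    proof -
      obtain a where a: "a \<in> carrier A" "x = i a" "e = f a" using xe unfolding G0_def by auto
      show ?thesis
        by (rule G0I[of "r \<odot>\<^bsub>A\<^esub> a"]) (use a r mod_homD(4)[OF i(1)] mod_homD(4)[OF f] in auto)
    qed
    show "e = \<zero>\<^bsub>E\<^esub>" if e: "(\<zero>\<^bsub>B\<^esub>, e) \<in> G0" for e
    proof -
      obtain a where a: "a \<in> carrier A" "\<zero>\<^bsub>B\<^esub> = i a" "e = f a" using e unfolding G0_def by auto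
      have "a = \<zero>\<^bsub>A\<^esub>"
        by (rule inj_onD[OF i(2) _ a(1)]) (use a(2) mod_hom_zero[OF A B i(1)] in auto)
      then show ?thesis using a(3) mod_hom_zero[OF A E f] by simp
    qed
  qed
  \<comment> \<open>With the empty set in place of \<open>\<bb>\<close> the extension lemma is the
    usual Baer argument over \<open>R\<close>.\<close>
  obtain G where G: "linear_graph R B E G" "G0 \<subseteq> G" "fst ` G = carrier B"
  proof (rule linear_graph_extension[OF B E lin, of "{}"])
  qed (use baer in auto)
  obtain g where g: "g \<in> mod_hom R B E" "\<And>x e. (x, e) \<in> G \<Longrightarrow> g x = e"
    using mod_hom_of_graph[OF B E G(1,3)] by blast
  have "g (i a) = f a" if "a \<in> carrier A" for a
    by (rule g(2)) (use G(2) G0I[OF that] in auto)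
  then show "\<exists>g\<in>mod_hom R B E. \<forall>a\<in>carrier A. g (i a) = f a" using g(1) by blast
qed (rule E)

lemma ring_module_sel [simp]:
  "carrier (ring_module R) = carrier R" "ring.add (ring_module R) = ring.add R"
  "ring.zero (ring_module R) = ring.zero R" "smult (ring_module R) = monoid.mult R"
  by (simp_all add: ring_module_def)

lemma (in cring) ring_module_minus: "x \<in> carrier R \<Longrightarrow> \<ominus>\<^bsub>ring_module R\<^esub> x = \<ominus> x"
  by (simp add: a_inv_def ring_module_def m_inv_def)

lemma (in cring) module_ring_module: "module R (ring_module R)"
proof (rule moduleI)
  show "cring R" by (rule cring_axioms)
  show "abelian_group (ring_module R)"
    by (rule abelian_groupI) (auto simp: a_ac intro: l_neg)
qed (auto simp: l_distr r_distr m_assoc)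

lemma (in cring) submodule_ring_module_iff: "submodule I R (ring_module R) \<longleftrightarrow> ideal I R"
proof
  assume "submodule I R (ring_module R)"
  then show "ideal I R"
    by (intro idealI') (use module.submoduleE[OF module_ring_module] submodule.axioms subgroup.one_closed in fastforce)+
next
  assume I: "ideal I R"
  show "submodule I R (ring_module R)"
    by (rule module.submoduleI[OF module_ring_module])
      (use ideal_sub[OF I] ideal_zero[OF I] ideal_neg[OF I] ideal_add[OF I] ideal_mult[OF I] ideal_carr[OF I]
        in \<open>auto simp: ring_module_minus\<close>)
qed

text \<open>Links \<open>ring_length\<close> to lengths of saturated chains; by
  \<open>saturated_of_units\<close> the hypothesis holds for a local ring and its maximal
  ideal.\<close>

lemma (in cring) module_length_ring_module:
  assumes "\<And>I. ideal I R \<Longrightarrow> saturated R P I"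
  shows "ring_length R = saturated_length R P {\<zero>} (carrier R)"
proof -
  have "(\<exists>N :: nat \<Rightarrow> 'a set. (\<forall>i\<le>n. ideal (N i) R) \<and> (\<forall>i<n. N i \<subset> N (Suc i)))
    \<longleftrightarrow> saturated_chain R P {\<zero>} (carrier R) n" for n
  proof
    assume "\<exists>N :: nat \<Rightarrow> 'a set. (\<forall>i\<le>n. ideal (N i) R) \<and> (\<forall>i<n. N i \<subset> N (Suc i))"
    then obtain N :: "nat \<Rightarrow> 'a set" where "\<forall>i\<le>n. ideal (N i) R" "\<forall>i<n. N i \<subset> N (Suc i)" by blast
    then show "saturated_chain R P {\<zero>} (carrier R) n"
      unfolding saturated_chain_def using assms ideal_zero ideal_sub by (intro exI[of _ N]) auto
  qed (auto simp: saturated_chain_def saturated_def)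
  then show ?thesis
    unfolding ring_length_def module_length_def saturated_length_def submodule_ring_module_iff by simp
qed

text \<open>An elementwise description of Gorenstein Artin local rings: \<open>n\<close> is the set
  of nonunits and is nil, and the socle is spanned by the single element \<open>e\<close>. Duality
  and injectivity are derived from this alone.\<close>

locale zero_dimensional_simple_socle = noetherian_cring +
  fixes n :: "'a set" and e :: 'a
  assumes n: "maximalideal n R"
    and units: "\<And>x. x \<in> carrier R \<Longrightarrow> x \<notin> n \<Longrightarrow> x \<in> Units R"
    and nilpotent: "\<And>q. q \<in> n \<Longrightarrow> \<exists>k::nat. q [^] k = \<zero>"
    and e: "e \<in> carrier R" "e \<noteq> \<zero>" "\<And>p. p \<in> n \<Longrightarrow> p \<otimes> e = \<zero>"
    and socle: "\<And>x. x \<in> carrier R \<Longrightarrow> (\<And>p. p \<in> n \<Longrightarrow> p \<otimes> x = \<zero>) \<Longrightarrow> \<exists>r\<in>carrier R. x = r \<otimes> e"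

lemma (in cring) saturated_of_units:
  assumes "\<And>x. x \<in> carrier R \<Longrightarrow> x \<notin> P \<Longrightarrow> x \<in> Units R" "ideal I R"
  shows "saturated R P I"
  unfolding saturated_def
proof (intro conjI ballI impI)
  fix s x assume s: "s \<in> carrier R - P" and x: "x \<in> carrier R" "s \<otimes> x \<in> I"
  then have u: "s \<in> Units R" using assms(1) by blast
  have "inv s \<otimes> (s \<otimes> x) \<in> I" by (rule ideal_mult[OF assms(2) x(2)]) (use u in simp)
  moreover have "inv s \<otimes> (s \<otimes> x) = x" using u x(1) s by (simp add: m_assoc[symmetric])
  ultimately show "x \<in> I" by simp
qed (rule assms(2))

section \<open>Annihilators and lengths\<close>

context zero_dimensional_simple_socle
begin

lemma n_prime: "primeideal n R"
  by (rule maximalideal_prime[OF n])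

lemma sat: "ideal I R \<Longrightarrow> saturated R n I"
  by (rule saturated_of_units[OF units])

abbreviation len :: "'a set \<Rightarrow> 'a set \<Rightarrow> enat" where
  "len \<equiv> saturated_length R n"

abbreviation ann :: "'a set \<Rightarrow> 'a set" where
  "ann \<equiv> colon_ideal R {\<zero>}"

lemma len_add: "ideal B R \<Longrightarrow> ideal C R \<Longrightarrow> A \<subseteq> B \<Longrightarrow> B \<subseteq> C \<Longrightarrow> len A C = len A B + len B C"
  by (rule saturated_length_add[OF n_prime sat sat])

lemma len_finite: "len {\<zero>} (carrier R) \<noteq> \<infinity>"
  by (rule saturated_length_finite[OF n_prime sat[OF zeroideal]]) (use nilpotent in auto)

lemma len_finite': "ideal A R \<Longrightarrow> B \<subseteq> carrier R \<Longrightarrow> len A B \<noteq> \<infinity>"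
  using len_finite saturated_length_mono[of "{\<zero>}" A B "carrier R" R n] ideal_zero by (cases "len A B") auto

lemma ann_ideal: "I \<subseteq> carrier R \<Longrightarrow> ideal (ann I) R"
  unfolding colon_ideal_def
  by (rule idealI') (auto simp: l_distr m_assoc subset_eq)

lemma ann_antimono: "I \<subseteq> J \<Longrightarrow> ann J \<subseteq> ann I"
  unfolding colon_ideal_def by blast

lemma ann_zero: "ann {\<zero>} = carrier R"
  unfolding colon_ideal_def by auto

lemma ann_carrier: "ann (carrier R) = {\<zero>}"
  unfolding colon_ideal_def by (auto dest: bspec[of _ _ \<one>])

lemma mem_ann: "z \<in> ann I \<longleftrightarrow> z \<in> carrier R \<and> (\<forall>x\<in>I. z \<otimes> x = \<zero>)"
  unfolding colon_ideal_def by auto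

text \<open>Multiplication by \<open>x\<close> embeds \<open>ann I\<close> modulo
  \<open>ann (I + (x))\<close> into the socle, which is spanned by \<open>e\<close>. So as soon as
  one \<open>z\<close> has \<open>z x\<close> nonzero, every other element of \<open>ann I\<close>
  agrees with a multiple of \<open>z\<close> modulo \<open>ann (I + (x))\<close>.\<close>

lemma ann_step:
  assumes I: "ideal I R" and x: "x \<in> carrier R" and nx: "\<And>p. p \<in> n \<Longrightarrow> p \<otimes> x \<in> I"
  shows "len (ann (I <+> PIdl x)) (ann I) \<le> 1"
proof (rule saturated_length_le_1)
  let ?I = "I <+> PIdl x"
  fix J assume J: "saturated R n J" "ann ?I \<subseteq> J" "J \<subseteq> ann I"
  have Ji: "ideal J R" by (rule saturatedD(1)[OF J(1)])
  have in_ann: "z \<in> ann ?I" if z: "z \<in> ann I" "z \<otimes> x = \<zero>" for z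
  proof -
    have "z \<otimes> y = \<zero>" if y: "y \<in> ?I" for y
    proof -
      obtain i r where i: "i \<in> I" "r \<in> carrier R" "y = i \<oplus> r \<otimes> x" using y mem_add_PIdl_iff by blast
      have c: "z \<in> carrier R" "i \<in> carrier R" using z i ideal_carr[OF I] mem_ann by auto
      have "z \<otimes> y = z \<otimes> i \<oplus> r \<otimes> (z \<otimes> x)" unfolding i(3) using c i(2) x by (simp add: r_distr m_lcomm)
      then show ?thesis using z i mem_ann by simp
    qed
    then show ?thesis using z mem_ann by simp
  qed
  have zx: "\<exists>r\<in>carrier R. z \<otimes> x = r \<otimes> e" if z: "z \<in> ann I" for z
  proof (rule socle)
    show "z \<otimes> x \<in> carrier R" using z mem_ann x by simp
    show "p \<otimes> (z \<otimes> x) = \<zero>" if "p \<in> n" for p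
    proof -
      have pc: "p \<in> carrier R" using that ideal_carr[OF primeD(1)[OF n_prime]] by blast
      have "p \<otimes> (z \<otimes> x) = z \<otimes> (p \<otimes> x)" using pc z mem_ann x by (simp add: m_lcomm)
      then show ?thesis using nx[OF that] z mem_ann by simp
    qed
  qed
  show "J = ann ?I \<or> J = ann I"
  proof (cases "J \<subseteq> ann ?I")
    case False
    then obtain z where z: "z \<in> J" "z \<notin> ann ?I" by blast
    have za: "z \<in> ann I" using z J(3) by blast
    obtain r where r: "r \<in> carrier R" "z \<otimes> x = r \<otimes> e" using zx[OF za] by blast
    have zc: "z \<in> carrier R" using za mem_ann by simp
    have "r \<notin> n" using r e(3) in_ann[OF za] z(2) by auto
    then have u: "r \<in> Units R" using units r(1) by blast
    have "ann I \<subseteq> J"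
    proof
      fix y assume y: "y \<in> ann I"
      obtain q where q: "q \<in> carrier R" "y \<otimes> x = q \<otimes> e" using zx[OF y] by blast
      have yc: "y \<in> carrier R" using y mem_ann by simp
      let ?a = "q \<otimes> inv r"
      have a: "?a \<in> carrier R" using q u by simp
      have "?a \<otimes> (z \<otimes> x) = (q \<otimes> (inv r \<otimes> r)) \<otimes> e"
        unfolding r(2) using q(1) u r(1) e(1) by (simp add: m_assoc del: Units_l_inv)
      also have "\<dots> = y \<otimes> x" using q u by simp
      finally have az: "?a \<otimes> (z \<otimes> x) = y \<otimes> x" .
      have aza: "?a \<otimes> z \<in> ann I" by (rule ideal_mult[OF ann_ideal[OF ideal_sub[OF I]] za a])
      have "(y \<ominus> ?a \<otimes> z) \<otimes> x = y \<otimes> x \<ominus> ?a \<otimes> (z \<otimes> x)"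
        using yc a zc x by (simp add: a_minus_def l_distr l_minus m_assoc)
      also have "\<dots> = \<zero>" unfolding az using yc x by (simp add: a_minus_def r_neg)
      finally have "y \<ominus> ?a \<otimes> z \<in> ann ?I"
        by (intro in_ann ideal_minus[OF ann_ideal[OF ideal_sub[OF I]] y aza])
      then have "y \<ominus> ?a \<otimes> z \<oplus> ?a \<otimes> z \<in> J" using J(2) ideal_add[OF Ji] ideal_mult[OF Ji z(1) a] by blast
      moreover have "y \<ominus> ?a \<otimes> z \<oplus> ?a \<otimes> z = y" using yc a zc by (simp add: a_minus_def a_assoc l_neg)
      ultimately show "y \<in> J" by simp
    qed
    then show ?thesis using J(3) by blast
  qed (use J(2) in blast)
qed

text \<open>\<open>I'\<close> grows to \<open>I\<close> by socle elements. Each one uses up at least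
  1 of the length between them and, by \<open>ann_step\<close>, lowers the annihilator by length at
  most 1.\<close>

lemma ann_length:
  assumes "ideal I R" "ideal I' R" "I' \<subseteq> I"
  shows "len (ann I) (ann I') \<le> len I' I"
proof -
  \<comment> \<open>The induction runs over a finite bound for the length, with \<open>I'\<close>
    moving.\<close>
  have "len (ann I) (ann I') \<le> len I' I" if "len I' I \<le> enat k" "ideal I' R" "I' \<subseteq> I" for k I'
    using that
  proof (induction k arbitrary: I')
    case 0
    have "I' = I"
    proof (rule ccontr)
      assume "I' \<noteq> I"
      then have "1 \<le> len I' I"
        by (intro saturated_length_pos sat assms 0) (use 0(3) in auto)
      then have "1 \<le> enat 0" using 0(1) by (rule order_trans)
      then show False by (simp add: one_enat_def)
    qed
    then show ?case by (simp add: saturated_length_self)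
  next
    case (Suc k)
    note I' = \<open>ideal I' R\<close>
    show ?case
    proof (cases "I' = I")
      case True
      then show ?thesis by (simp add: saturated_length_self)
    next
      case False
      then obtain x where x: "x \<in> I" "x \<notin> I'" using Suc.prems(3) by blast
      have xc: "x \<in> carrier R" using x ideal_carr[OF assms(1)] by blast
      have nil: "\<exists>k::nat. q [^] k \<in> I'" if "q \<in> n" for q
        using nilpotent[OF that] ideal_zero[OF I'] by metis
      obtain q where q: "q \<in> carrier R" "q \<otimes> x \<notin> I'" "\<And>p. p \<in> n \<Longrightarrow> p \<otimes> (q \<otimes> x) \<in> I'"
        by (rule socle_multiple[OF n_prime I' nil xc x(2)]) auto
      let ?y = "q \<otimes> x"
      let ?J = "I' <+> PIdl ?y"
      have yc: "?y \<in> carrier R" using q xc by simp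
      have J: "ideal ?J R" by (rule add_PIdl_ideal[OF I' yc])
      have IJ: "I' \<subseteq> ?J" by (rule sub_add_PIdl[OF I' yc])
      have JI: "?J \<subseteq> I"
        by (rule add_PIdl_least[OF assms(1) Suc.prems(3)]) (rule ideal_mult[OF assms(1) x(1) q(1)])
      have "I' \<subset> ?J" using IJ self_in_add_PIdl[OF I' yc] q(2) by blast
      then have "1 \<le> len I' ?J" by (rule saturated_length_pos[OF sat[OF I'] sat[OF J]])
      then have le: "1 + len ?J I \<le> len I' I"
        by (rule order_trans[OF add_right_mono saturated_length_append[OF IJ JI]])
      have "len ?J I \<le> enat k"
      proof -
        have le': "1 + len ?J I \<le> enat (Suc k)" using le Suc.prems(1) by (rule order_trans)
        then show ?thesis by (cases "len ?J I") (auto simp: one_enat_def)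
      qed
      then have IH: "len (ann I) (ann ?J) \<le> len ?J I" by (rule Suc.IH[OF _ J JI])
      have "len (ann I) (ann I') = len (ann I) (ann ?J) + len (ann ?J) (ann I')"
        by (rule len_add) (use ann_ideal ideal_sub I' J ann_antimono[OF IJ] ann_antimono[OF JI] in auto)
      also have "\<dots> \<le> len ?J I + 1"
        by (rule add_mono[OF IH ann_step[OF I' yc q(3)]])
      also have "\<dots> \<le> len I' I" using le by (simp add: add.commute)
      finally show ?thesis .
    qed
  qed
  moreover obtain k where "len I' I = enat k" using len_finite'[OF assms(2) ideal_sub[OF assms(1)]] by auto
  ultimately show ?thesis using assms(2,3) by (metis order_refl)
qed

text \<open>The inequalities \<open>ann_length\<close> for the pairs {0}, \<open>I\<close> and
  \<open>I\<close>, \<open>R\<close> add up to an equality of the length of \<open>R\<close> with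
  itself, which is finite, so neither can be strict.\<close>

lemma ann_length_eq:
  assumes I: "ideal I R"
  shows "len (ann I) (carrier R) = len {\<zero>} I" "len {\<zero>} (ann I) = len I (carrier R)"
proof -
  have Ic: "I \<subseteq> carrier R" and I0: "{\<zero>} \<subseteq> I" using ideal_sub[OF I] ideal_zero[OF I] by auto
  have A: "ideal (ann I) R" by (rule ann_ideal[OF Ic])
  have le: "len (ann I) (carrier R) \<le> len {\<zero>} I" "len {\<zero>} (ann I) \<le> len I (carrier R)"
    using ann_length[OF I zeroideal I0] ann_length[OF oneideal I Ic] unfolding ann_zero ann_carrier by auto
  have 1: "len {\<zero>} (carrier R) = len {\<zero>} I + len I (carrier R)"
    by (rule len_add[OF I oneideal I0 Ic])
  have 2: "len {\<zero>} (carrier R) = len {\<zero>} (ann I) + len (ann I) (carrier R)"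
    by (rule len_add[OF A oneideal]) (use ideal_zero[OF A] ideal_sub[OF A] in auto)
  obtain a b c d where "len (ann I) (carrier R) = enat a" "len {\<zero>} I = enat b"
    "len {\<zero>} (ann I) = enat c" "len I (carrier R) = enat d"
    using len_finite'[OF A order_refl] len_finite'[OF zeroideal Ic] len_finite'[OF zeroideal ideal_sub[OF A]]
      len_finite'[OF I order_refl] by auto
  then show "len (ann I) (carrier R) = len {\<zero>} I" "len {\<zero>} (ann I) = len I (carrier R)"
    using le 1 2 by auto
qed

text \<open>One inclusion is clear, and both ideals have the same finite colength.\<close>

lemma ann_ann:
  assumes I: "ideal I R"
  shows "ann (ann I) = I"
proof -
  have Ic: "I \<subseteq> carrier R" by (rule ideal_sub[OF I])
  have A: "ideal (ann I) R" by (rule ann_ideal[OF Ic])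
  have AA: "ideal (ann (ann I)) R" by (rule ann_ideal[OF ideal_sub[OF A]])
  have sub: "I \<subseteq> ann (ann I)" 
  proof
    fix x assume x: "x \<in> I"
    have "x \<otimes> z = \<zero>" if "z \<in> ann I" for z
      using that x m_comm[of x z] ideal_carr[OF I x] mem_ann by simp
    then show "x \<in> ann (ann I)" using ideal_carr[OF I x] mem_ann by simp
  qed
  have "len (ann (ann I)) (carrier R) = len I (carrier R)"
    using ann_length_eq(1)[OF A] ann_length_eq(2)[OF I] by simp
  moreover have "len I (carrier R) = len I (ann (ann I)) + len (ann (ann I)) (carrier R)"
    by (rule len_add[OF AA oneideal sub ideal_sub[OF AA]])
  ultimately have "len I (ann (ann I)) = 0" using len_finite'[OF I order_refl] by (cases "len I (ann (ann I))") (auto simp: zero_enat_def)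
  then show ?thesis
    using saturated_length_pos[OF sat[OF I] sat[OF AA]] sub by (cases "I = ann (ann I)") auto
qed

end

section \<open>Quotients\<close>

text \<open>The scalar action of \<open>quotient_module\<close> is a union over representatives; all
  members of this union are the same coset, so it collapses to the expected one.\<close>

lemma (in cring) quotient_module_sel:
  assumes I: "ideal I R"
  shows "carrier (quotient_module (ring_module R) I) = (\<lambda>x. I +> x) ` carrier R"
    "\<And>x y. x \<in> carrier R \<Longrightarrow> y \<in> carrier R \<Longrightarrow>
      (I +> x) \<oplus>\<^bsub>quotient_module (ring_module R) I\<^esub> (I +> y) = I +> (x \<oplus> y)"
    "\<And>r x. r \<in> carrier R \<Longrightarrow> x \<in> carrier R \<Longrightarrow>
      r \<odot>\<^bsub>quotient_module (ring_module R) I\<^esub> (I +> x) = I +> (r \<otimes> x)"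
    "\<zero>\<^bsub>quotient_module (ring_module R) I\<^esub> = I"
proof -
  have coset: "a_r_coset (ring_module R) = a_r_coset R"
    by (intro ext) (simp add: a_r_coset_def')
  have sum: "set_add (ring_module R) = set_add R"
    by (intro ext) (simp add: set_add_def')
  show "carrier (quotient_module (ring_module R) I) = (\<lambda>x. I +> x) ` carrier R"
    by (auto simp: quotient_module_def A_RCOSETS_def' coset)
  show "(I +> x) \<oplus>\<^bsub>quotient_module (ring_module R) I\<^esub> (I +> y) = I +> (x \<oplus> y)"
    if "x \<in> carrier R" "y \<in> carrier R" for x y
    using ideal.a_rcos_sum[OF I that] by (simp add: quotient_module_def sum)
  show "\<zero>\<^bsub>quotient_module (ring_module R) I\<^esub> = I" by (simp add: quotient_module_def)
  show "r \<odot>\<^bsub>quotient_module (ring_module R) I\<^esub> (I +> x) = I +> (r \<otimes> x)"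
    if rx: "r \<in> carrier R" "x \<in> carrier R" for r x
  proof -
    have *: "I +> (r \<otimes> y) = I +> (r \<otimes> x)" if y: "y \<in> I +> x" for y
    proof -
      obtain i where i: "i \<in> I" "y = i \<oplus> x" using y unfolding a_r_coset_def' by blast
      have ic: "i \<in> carrier R" using i ideal_carr[OF I] by blast
      have "r \<otimes> y \<ominus> r \<otimes> x = r \<otimes> i"
        unfolding i(2) using rx ic by algebra
      then have "r \<otimes> y \<ominus> r \<otimes> x \<in> I" using ideal_mult[OF I i(1) rx(1)] by simp
      then show ?thesis using quotient_eq_iff_same_a_r_cos[OF I, of "r \<otimes> y" "r \<otimes> x"] rx ic i(2) by simp
    qed
    have x: "x \<in> I +> x"
      unfolding a_r_coset_def' using ideal_zero[OF I] rx(2) by force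
    have "(\<Union>y\<in>I +> x. I +> (r \<otimes> y)) = (\<Union>y\<in>I +> x. I +> (r \<otimes> x))"
      by (rule SUP_cong[OF refl *])
    also have "\<dots> = I +> (r \<otimes> x)" using x by blast
    finally have "(\<Union>y\<in>I +> x. I +> (r \<otimes> y)) = I +> (r \<otimes> x)" .
    then show ?thesis by (simp add: quotient_module_def coset)
  qed
qed

lemma (in cring) module_quotient_module:
  assumes I: "ideal I R"
  shows "module R (quotient_module (ring_module R) I)"
proof (rule moduleI[OF cring_axioms])
  note sel = quotient_module_sel[OF I]
  let ?Q = "quotient_module (ring_module R) I"
  have coset0: "I = I +> \<zero>" using a_rcos_zero[OF I ideal_zero[OF I]] by simp
  have zero: "\<zero>\<^bsub>?Q\<^esub> = I +> \<zero>" using sel(4) coset0 by simp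
  show "abelian_group ?Q"
  proof (rule abelian_groupI)
    show "\<exists>y\<in>carrier ?Q. y \<oplus>\<^bsub>?Q\<^esub> x = \<zero>\<^bsub>?Q\<^esub>" if x: "x \<in> carrier ?Q" for x
    proof -
      obtain a where a: "a \<in> carrier R" "x = I +> a" using x sel(1) by auto
      then show ?thesis unfolding zero using sel(1,2) by (intro bexI[of _ "I +> (\<ominus> a)"]) (auto simp: l_neg)
    qed
  qed (auto simp: sel(1,2) zero a_ac)
qed (auto simp: quotient_module_sel[OF I] l_distr r_distr m_assoc)

text \<open>Submodules of the quotient and ideals above \<open>I\<close> correspond; strictness
  survives in both directions because each ideal in the chain contains \<open>I\<close>.\<close>

lemma (in cring) module_length_quotient_module:
  assumes I: "ideal I R" and sat: "\<And>I. ideal I R \<Longrightarrow> saturated R P I"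
  shows "module_length R (quotient_module (ring_module R) I) = saturated_length R P I (carrier R)"
proof -
  let ?Q = "quotient_module (ring_module R) I"
  note sel = quotient_module_sel[OF I]
  interpret Q: module R ?Q by (rule module_quotient_module[OF I])
  have cos: "I +> x = I +> y \<longleftrightarrow> x \<ominus> y \<in> I" if "x \<in> carrier R" "y \<in> carrier R" for x y
    using quotient_eq_iff_same_a_r_cos[OF I that] by simp
  have pre: "ideal {x \<in> carrier R. I +> x \<in> N} R" "I \<subseteq> {x \<in> carrier R. I +> x \<in> N}"
    if N: "submodule N R ?Q" for N
  proof -
    note N' = Q.submoduleE[OF N]
    have I_N: "I \<in> N" using submodule.axioms(1)[OF N] subgroup.one_closed sel(4) by fastforce
    then have *: "I +> x \<in> N" if "x \<in> I" for x using a_rcos_zero[OF I that] by simp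
    show "I \<subseteq> {x \<in> carrier R. I +> x \<in> N}" using * ideal_carr[OF I] by blast
    show "ideal {x \<in> carrier R. I +> x \<in> N} R"
    proof (rule idealI')
      show "\<zero> \<in> {x \<in> carrier R. I +> x \<in> N}" using * ideal_zero[OF I] by simp
      show "x \<oplus> y \<in> {x \<in> carrier R. I +> x \<in> N}"
        if "x \<in> {x \<in> carrier R. I +> x \<in> N}" "y \<in> {x \<in> carrier R. I +> x \<in> N}" for x y
        using that N'(5)[of "I +> x" "I +> y"] sel(2) by auto
      show "r \<otimes> x \<in> {x \<in> carrier R. I +> x \<in> N}"
        if "r \<in> carrier R" "x \<in> {x \<in> carrier R. I +> x \<in> N}" for r x
        using that N'(4)[of r "I +> x"] sel(3) by auto
    qed auto
  qed
  have img: "submodule ((\<lambda>x. I +> x) ` K) R ?Q" if K: "ideal K R" for K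
  proof (rule Q.submoduleI)
    note Kc = ideal_carr[OF K]
    show sub: "(\<lambda>x. I +> x) ` K \<subseteq> carrier ?Q" using Kc sel(1) by auto
    show "\<zero>\<^bsub>?Q\<^esub> \<in> (\<lambda>x. I +> x) ` K"
      using sel(4) a_rcos_zero[OF I ideal_zero[OF I]] ideal_zero[OF K] by force
    show sm: "r \<odot>\<^bsub>?Q\<^esub> x \<in> (\<lambda>x. I +> x) ` K" if "r \<in> carrier R" "x \<in> (\<lambda>x. I +> x) ` K" for r x
      using that sel(3) Kc ideal_mult[OF K] by auto
    show "x \<oplus>\<^bsub>?Q\<^esub> y \<in> (\<lambda>x. I +> x) ` K" if "x \<in> (\<lambda>x. I +> x) ` K" "y \<in> (\<lambda>x. I +> x) ` K" for x y
      using that sel(2) Kc ideal_add[OF K] by auto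
    show "\<ominus>\<^bsub>?Q\<^esub> x \<in> (\<lambda>x. I +> x) ` K" if "x \<in> (\<lambda>x. I +> x) ` K" for x
      using sm[OF _ that, of "\<ominus> \<one>"] module_neg_smult[OF module_quotient_module[OF I]] sub that by auto
  qed
  have "(\<exists>N :: nat \<Rightarrow> 'a set set. (\<forall>i\<le>n. submodule (N i) R ?Q) \<and> (\<forall>i<n. N i \<subset> N (Suc i)))
    \<longleftrightarrow> saturated_chain R P I (carrier R) n" for n
  proof
    assume "\<exists>N :: nat \<Rightarrow> 'a set set. (\<forall>i\<le>n. submodule (N i) R ?Q) \<and> (\<forall>i<n. N i \<subset> N (Suc i))"
    then obtain N :: "nat \<Rightarrow> 'a set set" where N: "\<forall>i\<le>n. submodule (N i) R ?Q" "\<forall>i<n. N i \<subset> N (Suc i)" by blast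
    show "saturated_chain R P I (carrier R) n"
      unfolding saturated_chain_def
    proof (intro exI[of _ "\<lambda>i. {x \<in> carrier R. I +> x \<in> N i}"] conjI allI impI)
      fix i assume "i \<le> n"
      then show "saturated R P {x \<in> carrier R. I +> x \<in> N i}" using sat pre N(1) by blast
    next
      fix i assume i: "i < n"
      then obtain C where C: "C \<in> N (Suc i)" "C \<notin> N i" using N(2) by blast
      moreover have "C \<in> carrier ?Q" using C(1) N(1) i Q.submoduleE(1)[of "N (Suc i)"] by auto
      then obtain x where "x \<in> carrier R" "C = I +> x" using sel(1) by auto
      ultimately show "{x \<in> carrier R. I +> x \<in> N i} \<subset> {x \<in> carrier R. I +> x \<in> N (Suc i)}"
        using N(2) i by blast
    next
      show "I \<subseteq> {x \<in> carrier R. I +> x \<in> N 0}" using pre(2) N(1) by blast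
    qed auto
  next
    assume "saturated_chain R P I (carrier R) n"
    then show "\<exists>N :: nat \<Rightarrow> 'a set set. (\<forall>i\<le>n. submodule (N i) R ?Q) \<and> (\<forall>i<n. N i \<subset> N (Suc i))"
    proof (rule saturated_chainD)
      fix K assume K: "\<And>i. i \<le> n \<Longrightarrow> saturated R P (K i)" "\<And>i. i < n \<Longrightarrow> K i \<subset> K (Suc i)"
        "I \<subseteq> K 0" "K n \<subseteq> carrier R"
      have Ki: "ideal (K i) R" if "i \<le> n" for i using K(1)[OF that] saturatedD by blast
      have IK: "I \<subseteq> K i" if "i \<le> n" for i
        using that
      proof (induction i)
        case (Suc i)
        then show ?case using K(2)[of i] by auto
      qed (use K in simp)
      have "(\<lambda>x. I +> x) ` K i \<subset> (\<lambda>x. I +> x) ` K (Suc i)" if i: "i < n" for i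
      proof -
        obtain x where x: "x \<in> K (Suc i)" "x \<notin> K i" using K(2)[OF i] by blast
        have xc: "x \<in> carrier R" using x(1) ideal_carr[OF Ki[of "Suc i"]] i by auto
        have "I +> x \<notin> (\<lambda>x. I +> x) ` K i"
        proof
          assume "I +> x \<in> (\<lambda>x. I +> x) ` K i"
          then obtain y where y: "y \<in> K i" "I +> x = I +> y" by blast
          have yc: "y \<in> carrier R" using y(1) ideal_carr[OF Ki[of i]] i by auto
          have "x \<ominus> y \<in> K i" using cos[OF xc yc] y(2) IK[of i] i by auto
          then have "x \<ominus> y \<oplus> y \<in> K i" using ideal_add[OF Ki[of i]] y(1) i by auto
          moreover have "x \<ominus> y \<oplus> y = x" using xc yc by (simp add: a_minus_def a_assoc l_neg)
          ultimately show False using x(2) by simp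
        qed
        then show ?thesis using x(1) K(2)[OF i] by blast
      qed
      then show ?thesis using img Ki by (intro exI[of _ "\<lambda>i. (\<lambda>x. I +> x) ` K i"]) auto
    qed
  qed
  then show ?thesis unfolding module_length_def saturated_length_def by simp
qed

section \<open>Ideals along a surjective ring homomorphism\<close>

locale surjective_ring_hom = S: cring S + R: cring R for S (structure) and R (structure) +
  fixes h
  assumes hom: "h \<in> ring_hom S R" and surj: "h ` carrier S = carrier R"
begin

lemma h_closed: "x \<in> carrier S \<Longrightarrow> h x \<in> carrier R"
  by (rule ring_hom_closed[OF hom])

lemma h_add: "x \<in> carrier S \<Longrightarrow> y \<in> carrier S \<Longrightarrow> h (x \<oplus> y) = h x \<oplus>\<^bsub>R\<^esub> h y"
  by (rule ring_hom_add[OF hom])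

lemma h_mult: "x \<in> carrier S \<Longrightarrow> y \<in> carrier S \<Longrightarrow> h (x \<otimes> y) = h x \<otimes>\<^bsub>R\<^esub> h y"
  by (rule ring_hom_mult[OF hom])

lemma h_one: "h \<one> = \<one>\<^bsub>R\<^esub>"
  by (rule ring_hom_one[OF hom])

lemma h_zero: "h \<zero> = \<zero>\<^bsub>R\<^esub>"
  by (rule ring_hom_zero[OF hom S.ring_axioms R.ring_axioms])

lemma h_neg: "x \<in> carrier S \<Longrightarrow> h (\<ominus> x) = \<ominus>\<^bsub>R\<^esub> h x"
  using h_add[of "\<ominus> x" x] h_zero h_closed R.minus_equality[of "h (\<ominus> x)" "h x"] by (simp add: S.l_neg)

lemma h_minus: "x \<in> carrier S \<Longrightarrow> y \<in> carrier S \<Longrightarrow> h (x \<ominus> y) = h x \<ominus>\<^bsub>R\<^esub> h y"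
  by (simp add: S.minus_eq R.minus_eq h_add h_neg)

lemma h_pow: "x \<in> carrier S \<Longrightarrow> h (x [^] (n::nat)) = h x [^]\<^bsub>R\<^esub> n"
  by (induction n) (auto simp: h_one h_mult)

lemma vimage_ideal: "ideal I R \<Longrightarrow> ideal {x \<in> carrier S. h x \<in> I} S"
  by (rule S.idealI') (auto simp: h_add h_mult h_zero R.ideal_zero R.ideal_add R.ideal_mult h_closed)

lemma image_ideal:
  assumes "ideal I S"
  shows "ideal (h ` I) R"
proof (rule R.idealI')
  note c = S.ideal_carr[OF assms]
  show "h ` I \<subseteq> carrier R" using c h_closed by auto
  show "\<zero>\<^bsub>R\<^esub> \<in> h ` I" using h_zero S.ideal_zero[OF assms] by force
  show "x \<oplus>\<^bsub>R\<^esub> y \<in> h ` I" if xy: "x \<in> h ` I" "y \<in> h ` I" for x y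
  proof -
    obtain a b where ab: "a \<in> I" "b \<in> I" "x = h a" "y = h b" using xy by blast
    then have "x \<oplus>\<^bsub>R\<^esub> y = h (a \<oplus> b)" using h_add c by simp
    then show ?thesis using S.ideal_add[OF assms ab(1,2)] by blast
  qed
  show "r \<otimes>\<^bsub>R\<^esub> x \<in> h ` I" if rx: "r \<in> carrier R" "x \<in> h ` I" for r x
  proof -
    obtain a where a1: "a \<in> I" "x = h a" using rx(2) by blast
    obtain s where s1: "s \<in> carrier S" "r = h s" using rx(1) unfolding surj[symmetric] by blast
    note a = a1 s1
    have "r \<otimes>\<^bsub>R\<^esub> x = h (s \<otimes> a)" using a h_mult c by simp
    then show ?thesis using S.ideal_mult[OF assms a(1,3)] by blast
  qed
qed

lemma image_mem:
  assumes "ideal I S" "{x \<in> carrier S. h x = \<zero>\<^bsub>R\<^esub>} \<subseteq> I" "x \<in> carrier S"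
  shows "h x \<in> h ` I \<longleftrightarrow> x \<in> I"
proof
  assume "h x \<in> h ` I"
  then obtain y where y: "y \<in> I" "h x = h y" by blast
  have yc: "y \<in> carrier S" using y S.ideal_carr[OF assms(1)] by blast
  have "h (x \<ominus> y) = \<zero>\<^bsub>R\<^esub>" using h_minus[OF assms(3) yc] y(2) h_closed[OF yc] by (simp add: R.minus_eq R.r_neg)
  then have "x \<ominus> y \<in> I" using assms(2,3) yc by auto
  then have "x \<ominus> y \<oplus> y \<in> I" using S.ideal_add[OF assms(1)] y(1) by blast
  moreover have "x \<ominus> y \<oplus> y = x" using assms(3) yc by (simp add: S.minus_eq S.a_assoc S.l_neg)
  ultimately show "x \<in> I" by simp
qed simp

text \<open>The correspondence between ideals of \<open>R\<close> and ideals of \<open>S\<close>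
  above the kernel. It allows lengths over different quotients to be compared inside one
  ring.\<close>

lemma saturated_length_vimage:
  assumes J: "ideal J R" and S: "\<And>I. ideal I S \<Longrightarrow> saturated S P I" and R: "\<And>I. ideal I R \<Longrightarrow> saturated R Q I"
  shows "saturated_length R Q J (carrier R) = saturated_length S P {x \<in> carrier S. h x \<in> J} (carrier S)"
proof -
  have "saturated_chain R Q J (carrier R) n \<longleftrightarrow> saturated_chain S P {x \<in> carrier S. h x \<in> J} (carrier S) n" for n
  proof
    assume "saturated_chain R Q J (carrier R) n"
    then show "saturated_chain S P {x \<in> carrier S. h x \<in> J} (carrier S) n"
    proof (rule saturated_chainD)
      fix N assume N: "\<And>i. i \<le> n \<Longrightarrow> saturated R Q (N i)" "\<And>i. i < n \<Longrightarrow> N i \<subset> N (Suc i)"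
        "J \<subseteq> N 0" "N n \<subseteq> carrier R"
      show ?thesis
        unfolding saturated_chain_def
      proof (intro exI[of _ "\<lambda>i. {x \<in> carrier S. h x \<in> N i}"] conjI allI impI)
        fix i assume i: "i < n"
        then obtain y where y: "y \<in> N (Suc i)" "y \<notin> N i" using N(2) by blast
        have "y \<in> carrier R" using R.ideal_carr[OF R.saturatedD(1)[OF N(1)[of "Suc i"]] y(1)] i by simp
        then obtain x where "x \<in> carrier S" "y = h x" using surj by auto
        then show "{x \<in> carrier S. h x \<in> N i} \<subset> {x \<in> carrier S. h x \<in> N (Suc i)}"
          using y N(2)[OF i] by blast
      next
        fix i assume "i \<le> n"
        then show "saturated S P {x \<in> carrier S. h x \<in> N i}"
          by (intro S vimage_ideal R.saturatedD(1)[OF N(1)])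
      qed (use N in auto)
    qed
  next
    assume "saturated_chain S P {x \<in> carrier S. h x \<in> J} (carrier S) n"
    then show "saturated_chain R Q J (carrier R) n"
    proof (rule saturated_chainD)
      fix N assume N: "\<And>i. i \<le> n \<Longrightarrow> saturated S P (N i)" "\<And>i. i < n \<Longrightarrow> N i \<subset> N (Suc i)"
        "{x \<in> carrier S. h x \<in> J} \<subseteq> N 0" "N n \<subseteq> carrier S"
      have Ni: "ideal (N i) S" if "i \<le> n" for i using N(1)[OF that] S.saturatedD(1) by blast
      have ker: "{x \<in> carrier S. h x = \<zero>\<^bsub>R\<^esub>} \<subseteq> N i" if "i \<le> n" for i
        using that
      proof (induction i)
        case 0
        then show ?case using N(3) R.ideal_zero[OF J] by auto
      next
        case (Suc i)
        then show ?case using N(2)[of i] by auto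
      qed
      show ?thesis
        unfolding saturated_chain_def
      proof (intro exI[of _ "\<lambda>i. h ` N i"] conjI allI impI)
        fix i assume "i \<le> n"
        then show "saturated R Q (h ` N i)" using R image_ideal Ni by blast
      next
        fix i assume i: "i < n"
        then obtain x where x: "x \<in> N (Suc i)" "x \<notin> N i" using N(2) by blast
        have "x \<in> carrier S" using x(1) S.ideal_carr[OF Ni[of "Suc i"]] i by simp
        then have "h x \<notin> h ` N i" using image_mem[OF Ni[of i] ker[of i]] x(2) i by simp
        then show "h ` N i \<subset> h ` N (Suc i)" using x(1) N(2)[OF i] by blast
      next
        show "J \<subseteq> h ` N 0"
        proof
          fix y assume y: "y \<in> J"
          then obtain x where "x \<in> carrier S" "y = h x" using surj R.ideal_carr[OF J] by blast
          then show "y \<in> h ` N 0" using y N(3) by blast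
        qed
        show "h ` N n \<subseteq> carrier R" using N(4) h_closed by blast
      qed
    qed
  qed
  then show ?thesis unfolding saturated_length_def by simp
qed

end

section \<open>Self-injectivity and the Gorenstein property\<close>

context zero_dimensional_simple_socle
begin

text \<open>Take \<open>J\<close> maximal such that \<open>f\<close> is multiplication by some
  \<open>w\<close> on \<open>J\<close>. If \<open>y\<close> is a socle element modulo
  \<open>J\<close>, the defect \<open>f y - y w\<close> lies in the socle. By \<open>ann_ann\<close>
  some \<open>v\<close> kills \<open>J\<close> but not \<open>y\<close>, so a multiple of
  \<open>v\<close> corrects \<open>w\<close> at \<open>y\<close> without disturbing
  \<open>J\<close>.\<close>

lemma baer:
  assumes I: "ideal I R" and fc: "\<And>r. r \<in> I \<Longrightarrow> f r \<in> carrier R"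
    and fadd: "\<And>r s. r \<in> I \<Longrightarrow> s \<in> I \<Longrightarrow> f (r \<oplus> s) = f r \<oplus> f s"
    and fmult: "\<And>r s. r \<in> carrier R \<Longrightarrow> s \<in> I \<Longrightarrow> f (r \<otimes> s) = r \<otimes> f s"
  shows "\<exists>w\<in>carrier R. \<forall>r\<in>I. f r = r \<otimes> w"
proof -
  let ?C = "{J. ideal J R \<and> J \<subseteq> I \<and> (\<exists>w\<in>carrier R. \<forall>r\<in>J. f r = r \<otimes> w)}"
  have "f \<zero> = \<zero>" using fmult[OF zero_closed ideal_zero[OF I]] fc[OF ideal_zero[OF I]] by simp
  then have "{\<zero>} \<in> ?C" using zeroideal ideal_zero[OF I] by auto
  then have ne: "?C \<noteq> {}" by blast
  obtain J where J: "J \<in> ?C" and Jmax: "\<And>K. K \<in> ?C \<Longrightarrow> J \<subseteq> K \<Longrightarrow> K = J"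
    by (rule ideal_maximal_exists[OF ne]) auto
  have Ji: "ideal J R" and JI: "J \<subseteq> I" using J by auto
  obtain w where w: "w \<in> carrier R" "\<And>r. r \<in> J \<Longrightarrow> f r = r \<otimes> w" using J by blast
  have "J = I"
  proof (rule ccontr)
    assume "J \<noteq> I"
    then obtain x where x: "x \<in> I" "x \<notin> J" using JI by blast
    have xc: "x \<in> carrier R" using x ideal_carr[OF I] by blast
    have nil: "\<exists>k::nat. q [^] k \<in> J" if "q \<in> n" for q
      using nilpotent[OF that] ideal_zero[OF Ji] by metis
    obtain q where q: "q \<in> carrier R" "q \<otimes> x \<notin> J" "\<And>p. p \<in> n \<Longrightarrow> p \<otimes> (q \<otimes> x) \<in> J"
      by (rule socle_multiple[OF n_prime Ji nil xc x(2)]) auto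
    obtain y where y: "y = q \<otimes> x" by blast
    have yI: "y \<in> I" unfolding y by (rule ideal_mult[OF I x(1) q(1)])
    have yc: "y \<in> carrier R" using yI ideal_carr[OF I] by blast
    have yJ: "y \<notin> J" and ny: "\<And>p. p \<in> n \<Longrightarrow> p \<otimes> y \<in> J" using q unfolding y by auto
    have nc: "p \<in> carrier R" if "p \<in> n" for p using that ideal_carr[OF primeD(1)[OF n_prime]] by blast
    have "\<exists>r\<in>carrier R. f y \<ominus> y \<otimes> w = r \<otimes> e"
    proof (rule socle)
      show "f y \<ominus> y \<otimes> w \<in> carrier R" using fc[OF yI] yc w by simp
      fix p assume p: "p \<in> n"
      have "p \<otimes> (f y \<ominus> y \<otimes> w) = f (p \<otimes> y) \<ominus> (p \<otimes> y) \<otimes> w"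
        using fmult[OF nc[OF p] yI] fc[OF yI] nc[OF p] yc w by (simp add: minus_eq r_distr r_minus m_assoc)
      then show "p \<otimes> (f y \<ominus> y \<otimes> w) = \<zero>" using w(2)[OF ny[OF p]] nc[OF p] yc w(1) by (simp add: minus_eq r_neg)
    qed
    then obtain r where r: "r \<in> carrier R" "f y \<ominus> y \<otimes> w = r \<otimes> e" by blast
    have "y \<notin> ann (ann J)" using ann_ann[OF Ji] yJ by simp
    then obtain v where v: "v \<in> ann J" "y \<otimes> v \<noteq> \<zero>" using yc mem_ann by auto
    have vc: "v \<in> carrier R" and vJ: "\<And>j. j \<in> J \<Longrightarrow> v \<otimes> j = \<zero>" using v(1) mem_ann by auto
    have "\<exists>s\<in>carrier R. y \<otimes> v = s \<otimes> e"
    proof (rule socle)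
      fix p assume p: "p \<in> n"
      have "p \<otimes> (y \<otimes> v) = v \<otimes> (p \<otimes> y)" using nc[OF p] yc vc by (simp add: m_ac)
      then show "p \<otimes> (y \<otimes> v) = \<zero>" using vJ[OF ny[OF p]] by simp
    qed (use yc vc in simp)
    then obtain s where s: "s \<in> carrier R" "y \<otimes> v = s \<otimes> e" by blast
    have "s \<notin> n" using e(3) s v(2) by auto
    then have u: "s \<in> Units R" using units s(1) by blast
    \<comment> \<open>\<open>y v = s e\<close> with \<open>s\<close> a unit, so \<open>y\<close>
      times the correction \<open>r (inv s) v\<close> is \<open>r e\<close>, exactly the
      defect.\<close>
    let ?w = "w \<oplus> r \<otimes> inv s \<otimes> v"
    have wc: "?w \<in> carrier R" using w r u vc by simp
    have "y \<otimes> (r \<otimes> inv s \<otimes> v) = r \<otimes> (inv s \<otimes> (y \<otimes> v))" using yc r u vc by (simp add: m_ac)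
    also have "\<dots> = r \<otimes> ((inv s \<otimes> s) \<otimes> e)" unfolding s(2) using u s(1) e(1) by (simp add: m_assoc del: Units_l_inv)
    also have "\<dots> = f y \<ominus> y \<otimes> w" using u e(1) r by simp
    finally have "y \<otimes> ?w = y \<otimes> w \<oplus> (f y \<ominus> y \<otimes> w)" using yc w r u vc by (simp add: r_distr)
    then have wy: "f y = y \<otimes> ?w" using fc[OF yI] yc w(1) by (simp add: minus_eq a_lcomm[of "y \<otimes> w" "f y"] r_neg)
    have wJ: "f j = j \<otimes> ?w" if j: "j \<in> J" for j
    proof -
      have jc: "j \<in> carrier R" using j ideal_carr[OF Ji] by blast
      have "j \<otimes> (r \<otimes> inv s \<otimes> v) = (r \<otimes> inv s) \<otimes> (v \<otimes> j)" using jc r u vc by (simp add: m_ac)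
      then have "j \<otimes> ?w = j \<otimes> w" using jc w r u vc vJ[OF j] by (simp add: r_distr)
      then show ?thesis using w(2)[OF j] by simp
    qed
    let ?K = "J <+> PIdl y"
    have "f z = z \<otimes> ?w" if z: "z \<in> ?K" for z
    proof -
      obtain j c where j: "j \<in> J" "c \<in> carrier R" "z = j \<oplus> c \<otimes> y" using z mem_add_PIdl_iff by blast
      have jc: "j \<in> carrier R" using j ideal_carr[OF Ji] by blast
      have "f z = f j \<oplus> c \<otimes> f y"
        unfolding j(3) using fadd[OF _ ideal_mult[OF I yI j(2)]] fmult[OF j(2) yI] j(1) JI by auto
      also have "\<dots> = z \<otimes> ?w"
        unfolding wJ[OF j(1)] wy j(3) using jc j(2) yc wc by (simp add: l_distr m_assoc)
      finally show ?thesis .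
    qed
    then have "?K \<in> ?C"
      using add_PIdl_ideal[OF Ji yc] add_PIdl_least[OF I JI yI] wc by auto
    then have "?K = J" using Jmax sub_add_PIdl[OF Ji yc] by blast
    then show False using self_in_add_PIdl[OF Ji yc] yJ by simp
  qed
  then show ?thesis using w by blast
qed

lemma injective_ring_module: "injective_module R (ring_module R)"
proof (rule injective_moduleI[OF module_ring_module])
  fix I f assume "ideal I R" "\<And>r. r \<in> I \<Longrightarrow> f r \<in> carrier (ring_module R)"
    "\<And>r s. r \<in> I \<Longrightarrow> s \<in> I \<Longrightarrow> f (r \<oplus> s) = f r \<oplus>\<^bsub>ring_module R\<^esub> f s"
    "\<And>r s. r \<in> carrier R \<Longrightarrow> s \<in> I \<Longrightarrow> f (r \<otimes> s) = r \<odot>\<^bsub>ring_module R\<^esub> f s"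
  then show "\<exists>w\<in>carrier (ring_module R). \<forall>r\<in>I. f r = r \<odot>\<^bsub>ring_module R\<^esub> w"
    using baer[of I f] by simp
qed

text \<open>The residue field embeds by sending the class of \<open>\<one>\<close> to
  \<open>e\<close>. This is essential because every nonzero ideal contains a nonzero socle element,
  a multiple of \<open>e\<close>.\<close>

lemma injective_hull_ring_module: "injective_hull R (residue_field_module R n) (ring_module R)"
  unfolding injective_hull_def residue_field_module_def
proof (intro conjI injective_ring_module)
  let ?Q = "quotient_module (ring_module R) n"
  have ni: "ideal n R" by (rule primeD(1)[OF n_prime])
  note sel = quotient_module_sel[OF ni]
  interpret Q: module R ?Q by (rule module_quotient_module[OF ni])
  have self: "x \<in> n +> x" if "x \<in> carrier R" for x
    unfolding a_r_coset_def' using ideal_zero[OF ni] that by force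
  \<comment> \<open>The representative does not matter, as \<open>n\<close> annihilates
    \<open>e\<close>.\<close>
  define g where "g C = (SOME x. x \<in> C) \<otimes> e" for C
  have g: "g (n +> x) = x \<otimes> e" if x: "x \<in> carrier R" for x
  proof -
    have "(SOME y. y \<in> n +> x) \<in> n +> x" using self[OF x] by (rule someI)
    then obtain p where p: "p \<in> n" "(SOME y. y \<in> n +> x) = p \<oplus> x" unfolding a_r_coset_def' by blast
    have "p \<in> carrier R" using p ideal_carr[OF ni] by blast
    then show ?thesis unfolding g_def p(2) using x e(1) e(3)[OF p(1)] by (simp add: l_distr)
  qed
  have hom: "restrict g (carrier ?Q) \<in> mod_hom R ?Q (ring_module R)"
    by (rule mod_homI[OF _ _ _ Q.module_axioms]) (use sel g e in \<open>auto simp: l_distr m_assoc\<close>)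
  have img: "restrict g (carrier ?Q) ` carrier ?Q = (\<lambda>x. x \<otimes> e) ` carrier R"
    using sel(1) g by (auto simp: image_image)
  have inj: "inj_on (restrict g (carrier ?Q)) (carrier ?Q)"
  proof (rule inj_onI)
    fix C D assume C: "C \<in> carrier ?Q" "D \<in> carrier ?Q" "restrict g (carrier ?Q) C = restrict g (carrier ?Q) D"
    then obtain x y where xy: "x \<in> carrier R" "C = n +> x" "y \<in> carrier R" "D = n +> y" using sel(1) by auto
    have "(x \<ominus> y) \<otimes> e = x \<otimes> e \<ominus> y \<otimes> e" using xy e(1) by (simp add: minus_eq l_distr l_minus)
    also have "\<dots> = \<zero>" using C xy g e(1) by (simp add: minus_eq r_neg)
    finally have *: "(x \<ominus> y) \<otimes> e = \<zero>" .
    have "x \<ominus> y \<in> n"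
    proof (rule ccontr)
      assume "x \<ominus> y \<notin> n"
      then have u: "x \<ominus> y \<in> Units R" using units xy by simp
      then have "e = inv (x \<ominus> y) \<otimes> ((x \<ominus> y) \<otimes> e)" using e(1) xy(1,3) by (simp add: m_assoc[symmetric])
      then show False using * u e(2) by simp
    qed
    then show "C = D" using quotient_eq_iff_same_a_r_cos[OF ni xy(1,3)] xy by simp
  qed
  have ess: "U = {\<zero>}" if U: "submodule U R (ring_module R)" "U \<inter> (\<lambda>x. x \<otimes> e) ` carrier R = {\<zero>}" for U
  proof (rule ccontr)
    assume neq: "U \<noteq> {\<zero>}"
    have Ui: "ideal U R" using U(1) submodule_ring_module_iff by blast
    then obtain u where u: "u \<in> U" "u \<noteq> \<zero>" using neq ideal_zero[OF Ui] by blast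
    have uc: "u \<in> carrier R" using u ideal_carr[OF Ui] by blast
    obtain q where q: "q \<in> carrier R" "q \<otimes> u \<notin> {\<zero>}" "\<And>p. p \<in> n \<Longrightarrow> p \<otimes> (q \<otimes> u) \<in> {\<zero>}"
      by (rule socle_multiple[OF n_prime zeroideal _ uc]) (use nilpotent u in auto)
    have "\<exists>r\<in>carrier R. q \<otimes> u = r \<otimes> e" by (rule socle) (use q uc in auto)
    then have "q \<otimes> u \<in> U \<inter> (\<lambda>x. x \<otimes> e) ` carrier R" using ideal_mult[OF Ui u(1) q(1)] by auto
    then show False using U(2) q(2) by blast
  qed
  show "\<exists>i\<in>mod_hom R ?Q (ring_module R). inj_on i (carrier ?Q) \<and>
    (\<forall>U. submodule U R (ring_module R) \<and> U \<inter> i ` carrier ?Q = {\<zero>\<^bsub>ring_module R\<^esub>} \<longrightarrow>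
      U = {\<zero>\<^bsub>ring_module R\<^esub>})"
    by (rule bexI[OF _ hom]) (use inj ess img in auto)
qed

lemma local_ring_n: "local_ring R n"
  unfolding local_ring_def
proof (intro conjI allI impI cring_axioms n)
  fix M assume M: "maximalideal M R"
  have Mp: "primeideal M R" by (rule maximalideal_prime[OF M])
  have "M \<subseteq> n"
    by (rule saturated_proper[OF sat[OF primeD(1)[OF Mp]] primeD(3)[OF Mp]])
  then show "M = n"
    using maximalideal.I_maximal[OF M primeD(1)[OF n_prime]] primeD(3)[OF n_prime] ideal_sub[OF primeD(1)[OF n_prime]] by blast
qed

text \<open>From a member of least length on, the lengths agree; since they are finite, so do the
  ideals.\<close>

lemma descending_chain_condition:
  assumes "\<And>k::nat. ideal (I k) R" "\<And>k. I (Suc k) \<subseteq> I k"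
  shows "\<exists>m. \<forall>k\<ge>m. I k = I m"
proof -
  let ?l = "\<lambda>k. len {\<zero>} (I k)"
  define L where "L = (LEAST l. \<exists>m. l = ?l m)"
  have "\<exists>m. L = ?l m" unfolding L_def by (rule LeastI_ex) blast
  then obtain m where m: "L = ?l m" by blast
  have least: "?l m \<le> ?l k" for k unfolding m[symmetric] L_def by (rule Least_le) blast
  have anti: "I k \<subseteq> I m" if "m \<le> k" for k
    using that by (induction k rule: dec_induct) (use assms(2) in auto)
  have "I k = I m" if k: "m \<le> k" for k
  proof -
    have eq: "?l m = ?l k + len (I k) (I m)"
      by (rule len_add[OF assms(1,1) _ anti[OF k]]) (use ideal_zero[OF assms(1)] in auto)
    obtain a b c where "?l m = enat a" "?l k = enat b" "len (I k) (I m) = enat c"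
      using len_finite'[OF zeroideal ideal_sub[OF assms(1)]] len_finite'[OF assms(1) ideal_sub[OF assms(1)]] by (meson not_infinity_eq)
    then have "len (I k) (I m) = 0" using eq least[of k] by (auto simp: zero_enat_def)
    then show ?thesis
      using saturated_length_pos[OF sat[OF assms(1)] sat[OF assms(1)], of k m] anti[OF k] by (cases "I k = I m") auto
  qed
  then show ?thesis by blast
qed

lemma gorenstein: "gorenstein_artin_local_ring R"
  unfolding gorenstein_artin_local_ring_def artinian_local_ring_def canonical_module_def
  using local_ring_n injective_hull_ring_module descending_chain_condition by blast

end

section \<open>The Gorenstein cover\<close>

lemma ideal_module_sel [simp]:
  "carrier (ideal_module R I) = I" "ring.add (ideal_module R I) = ring.add R"
  "ring.zero (ideal_module R I) = ring.zero R" "smult (ideal_module R I) = monoid.mult R"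
  by (simp_all add: ideal_module_def ring_module_def)

lemma (in cring) module_ideal_module:
  assumes I: "ideal I R"
  shows "module R (ideal_module R I)"
proof (rule moduleI)
  note c = ideal_carr[OF I]
  show "cring R" by (rule cring_axioms)
  show "abelian_group (ideal_module R I)"
  proof (rule abelian_groupI)
    show "\<exists>y\<in>carrier (ideal_module R I). y \<oplus>\<^bsub>ideal_module R I\<^esub> x = \<zero>\<^bsub>ideal_module R I\<^esub>"
      if "x \<in> carrier (ideal_module R I)" for x
      using that c ideal_neg[OF I] l_neg by auto
  qed (use c ideal_zero[OF I] ideal_add[OF I] in \<open>auto simp: a_ac\<close>)
qed (use ideal_carr[OF I] ideal_mult[OF I] in \<open>auto simp: l_distr r_distr m_assoc\<close>)

text \<open>
  \<open>E\<close> stands for the canonical module of \<open>R = T/\<bb>\<close>, regarded as a module over \<open>T\<close>, and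
  \<open>B x y\<close> for \<open>\<phi>(x)(y)\<close>.
\<close>

locale gorenstein_construction = noetherian_cring T + E: module T E for T (structure) and E (structure) +
  fixes \<mm> \<aa> \<bb> :: "'a set" and B :: "'a \<Rightarrow> 'a \<Rightarrow> 'c" and xs ss :: "'a list"
  assumes \<mm>: "primeideal \<mm> T" and \<aa>: "ideal \<aa> T" and \<bb>: "ideal \<bb> T"
    and nilpotent: "\<And>q. q \<in> \<mm> \<Longrightarrow> \<exists>k::nat. q [^] k \<in> \<bb>"
    and xs: "set xs \<subseteq> carrier T"
    and incl: "\<bb> \<subseteq> Idl (set xs)" "Idl (set xs) \<subseteq> \<aa>" "\<aa> \<subseteq> \<mm>"
    and colon: "colon_ideal T \<bb> \<aa> \<subseteq> Idl (set xs)"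
    and ss: "set ss \<subseteq> Idl (set xs)" "regular_sequence T {\<zero>} ss" "length ss = length xs"
    and \<bb>_E: "\<And>r w. r \<in> \<bb> \<Longrightarrow> w \<in> carrier E \<Longrightarrow> r \<odot>\<^bsub>E\<^esub> w = \<zero>\<^bsub>E\<^esub>"
    and baer_E: "\<And>I f. ideal I T \<Longrightarrow> \<bb> \<subseteq> I \<Longrightarrow> (\<And>r. r \<in> I \<Longrightarrow> f r \<in> carrier E) \<Longrightarrow>
      (\<And>r s. r \<in> I \<Longrightarrow> s \<in> I \<Longrightarrow> f (r \<oplus> s) = f r \<oplus>\<^bsub>E\<^esub> f s) \<Longrightarrow>
      (\<And>r s. r \<in> carrier T \<Longrightarrow> s \<in> I \<Longrightarrow> f (r \<otimes> s) = r \<odot>\<^bsub>E\<^esub> f s) \<Longrightarrow>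
      (\<And>r. r \<in> \<bb> \<Longrightarrow> f r = \<zero>\<^bsub>E\<^esub>) \<Longrightarrow> \<exists>w\<in>carrier E. \<forall>r\<in>I. f r = r \<odot>\<^bsub>E\<^esub> w"
    and socle_E: "\<And>v w. v \<in> carrier E \<Longrightarrow> w \<in> carrier E \<Longrightarrow> v \<noteq> \<zero>\<^bsub>E\<^esub> \<Longrightarrow>
      (\<And>p. p \<in> \<mm> \<Longrightarrow> p \<odot>\<^bsub>E\<^esub> v = \<zero>\<^bsub>E\<^esub>) \<Longrightarrow> (\<And>p. p \<in> \<mm> \<Longrightarrow> p \<odot>\<^bsub>E\<^esub> w = \<zero>\<^bsub>E\<^esub>) \<Longrightarrow>
      \<exists>r\<in>carrier T. w = r \<odot>\<^bsub>E\<^esub> v"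
    and B_closed: "\<And>x y. x \<in> Idl (set xs) \<Longrightarrow> y \<in> \<aa> \<Longrightarrow> B x y \<in> carrier E"
    and B_add_left: "\<And>x x' y. x \<in> Idl (set xs) \<Longrightarrow> x' \<in> Idl (set xs) \<Longrightarrow> y \<in> \<aa> \<Longrightarrow>
      B (x \<oplus> x') y = B x y \<oplus>\<^bsub>E\<^esub> B x' y"
    and B_smult_left: "\<And>r x y. r \<in> carrier T \<Longrightarrow> x \<in> Idl (set xs) \<Longrightarrow> y \<in> \<aa> \<Longrightarrow>
      B (r \<otimes> x) y = r \<odot>\<^bsub>E\<^esub> B x y"
    and B_add_right: "\<And>x y y'. x \<in> Idl (set xs) \<Longrightarrow> y \<in> \<aa> \<Longrightarrow> y' \<in> \<aa> \<Longrightarrow>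
      B x (y \<oplus> y') = B x y \<oplus>\<^bsub>E\<^esub> B x y'"
    and B_smult_right: "\<And>r x y. r \<in> carrier T \<Longrightarrow> x \<in> Idl (set xs) \<Longrightarrow> y \<in> \<aa> \<Longrightarrow>
      B x (r \<otimes> y) = r \<odot>\<^bsub>E\<^esub> B x y"
    and B_sym: "\<And>x y. x \<in> Idl (set xs) \<Longrightarrow> y \<in> Idl (set xs) \<Longrightarrow> B x y = B y x"
    and B_\<bb>: "\<And>x y. x \<in> \<bb> \<Longrightarrow> y \<in> \<aa> \<Longrightarrow> B x y = \<zero>\<^bsub>E\<^esub>"
    and B_nondeg: "\<And>x. x \<in> Idl (set xs) \<Longrightarrow> (\<And>y. y \<in> \<aa> \<Longrightarrow> B x y = \<zero>\<^bsub>E\<^esub>) \<Longrightarrow> x \<in> \<bb>"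
begin

abbreviation \<dd> :: "'a set" where "\<dd> \<equiv> Idl (set xs)"

lemma \<dd>: "ideal \<dd> T"
  by (rule genideal_ideal[OF xs])

lemma xs_\<dd>: "set xs \<subseteq> \<dd>"
  by (rule genideal_self[OF xs])

lemma \<aa>_carr: "y \<in> \<aa> \<Longrightarrow> y \<in> carrier T"
  by (rule ideal_carr[OF \<aa>])

lemma symmetric: "symmetric_pairing T E \<dd> B"
proof (rule symmetric_pairing.intro[OF E.module_axioms], rule symmetric_pairing_axioms.intro)
  have sub: "x \<in> \<aa>" if "x \<in> \<dd>" for x using incl(2) that by (rule subsetD)
  show "ideal \<dd> T" by (rule \<dd>)
  show "B x y \<in> carrier E" if "x \<in> \<dd>" "y \<in> \<dd>" for x y
    by (rule B_closed[OF that(1) sub[OF that(2)]])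
  show "B x (y \<oplus> y') = B x y \<oplus>\<^bsub>E\<^esub> B x y'" if "x \<in> \<dd>" "y \<in> \<dd>" "y' \<in> \<dd>" for x y y'
    by (rule B_add_right[OF that(1) sub[OF that(2)] sub[OF that(3)]])
  show "B x (r \<otimes> y) = r \<odot>\<^bsub>E\<^esub> B x y" if "x \<in> \<dd>" "y \<in> \<dd>" "r \<in> carrier T" for x y r
    by (rule B_smult_right[OF that(3,1) sub[OF that(2)]])
  show "B x y = B y x" if "x \<in> \<dd>" "y \<in> \<dd>" for x y by (rule B_sym[OF that])
qed

lemma pairing_sum_closed:
  "set zs \<subseteq> \<dd> \<Longrightarrow> set ys \<subseteq> \<aa> \<Longrightarrow> pairing_sum E B zs ys \<in> carrier E"
  by (induction zs ys rule: list_induct2') (auto intro: B_closed)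

lemma dot_\<aa>: "set zs \<subseteq> carrier T \<Longrightarrow> set ys \<subseteq> \<aa> \<Longrightarrow> dot T ys zs \<in> \<aa>"
  by (induction ys zs rule: list_induct2')
    (auto intro: ideal_zero[OF \<aa>] ideal_add[OF \<aa>] ideal_mult'[OF \<aa>])

lemma pairing_sum_add:
  assumes "length ys = length zs" "length ys' = length zs" "set zs \<subseteq> \<dd>" "set ys \<subseteq> \<aa>" "set ys' \<subseteq> \<aa>"
  shows "pairing_sum E B zs (map2 (\<oplus>) ys ys') = pairing_sum E B zs ys \<oplus>\<^bsub>E\<^esub> pairing_sum E B zs ys'"
  using assms
proof (induction zs arbitrary: ys ys')
  case (Cons z zs)
  obtain y ys1 where y: "ys = y # ys1" using Cons.prems(1) by (cases ys) auto
  obtain y' ys1' where y': "ys' = y' # ys1'" using Cons.prems(2) by (cases ys') auto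
  have IH: "pairing_sum E B zs (map2 (\<oplus>) ys1 ys1') = pairing_sum E B zs ys1 \<oplus>\<^bsub>E\<^esub> pairing_sum E B zs ys1'"
    by (rule Cons.IH) (use Cons.prems y y' in auto)
  have c: "pairing_sum E B zs ys1 \<in> carrier E" "pairing_sum E B zs ys1' \<in> carrier E"
    "B z y \<in> carrier E" "B z y' \<in> carrier E" "B z (y \<oplus> y') = B z y \<oplus>\<^bsub>E\<^esub> B z y'"
    using Cons.prems y y' pairing_sum_closed[of zs] B_closed[of z] B_add_right[of z] by auto
  show ?case using IH c unfolding y y' by (simp add: E.M.a_ac)
qed simp

lemma pairing_sum_smult:
  assumes "length ys = length zs" "set zs \<subseteq> \<dd>" "set ys \<subseteq> \<aa>" "r \<in> carrier T"
  shows "pairing_sum E B zs (map ((\<otimes>) r) ys) = r \<odot>\<^bsub>E\<^esub> pairing_sum E B zs ys"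
  using assms
proof (induction zs arbitrary: ys)
  case (Cons z zs)
  obtain y ys1 where y: "ys = y # ys1" using Cons.prems(1) by (cases ys) auto
  have IH: "pairing_sum E B zs (map ((\<otimes>) r) ys1) = r \<odot>\<^bsub>E\<^esub> pairing_sum E B zs ys1"
    by (rule Cons.IH) (use Cons.prems y in auto)
  have c: "pairing_sum E B zs ys1 \<in> carrier E" "B z y \<in> carrier E" "B z (r \<otimes> y) = r \<odot>\<^bsub>E\<^esub> B z y"
    using Cons.prems y pairing_sum_closed[of zs] B_closed[of z] B_smult_right[of r z] by auto
  show ?case using IH c assms(4) unfolding y by (simp add: E.smult_r_distr)
qed simp

text \<open>If x is the combination of the z_i with coefficients u_i, then x y is the one with
  coefficients u_i y, which lie in \<open>\<aa>\<close>. So the formula for the map on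
  \<open>\<aa>\<dd>\<close> gives \<open>B x y\<close> at x y.\<close>

lemma pairing_sum_product:
  assumes "length us = length zs" "set zs \<subseteq> \<dd>" "set us \<subseteq> carrier T" "y \<in> \<aa>"
  shows "dot T (map (\<lambda>u. u \<otimes> y) us) zs = dot T us zs \<otimes> y \<and>
    pairing_sum E B zs (map (\<lambda>u. u \<otimes> y) us) = B (dot T us zs) y \<and> dot T us zs \<in> \<dd>"
  using assms
proof (induction zs arbitrary: us)
  case Nil
  have "B \<zero> y = \<zero>\<^bsub>E\<^esub>" by (rule B_\<bb>[OF ideal_zero[OF \<bb>] assms(4)])
  then show ?case using Nil \<aa>_carr ideal_zero[OF \<dd>] by auto
next
  case (Cons z zs)
  obtain u us1 where u: "us = u # us1" using Cons.prems(1) by (cases us) auto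
  have IH: "dot T (map (\<lambda>u. u \<otimes> y) us1) zs = dot T us1 zs \<otimes> y"
    "pairing_sum E B zs (map (\<lambda>u. u \<otimes> y) us1) = B (dot T us1 zs) y" "dot T us1 zs \<in> \<dd>"
    using Cons.IH[of us1] Cons.prems u by auto
  have z: "z \<in> \<dd>" "u \<in> carrier T" using Cons.prems u by auto
  have c: "z \<in> carrier T" "y \<in> carrier T" "dot T us1 zs \<in> carrier T"
    using z IH(3) ideal_carr[OF \<dd>] \<aa>_carr[OF assms(4)] by auto
  have uz: "u \<otimes> z \<in> \<dd>" by (rule ideal_mult[OF \<dd> z])
  have "u \<otimes> y \<otimes> z \<oplus> dot T us1 zs \<otimes> y = (u \<otimes> z \<oplus> dot T us1 zs) \<otimes> y"
    using c z(2) by (simp add: l_distr r_distr m_ac)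
  moreover have "B (u \<otimes> z \<oplus> dot T us1 zs) y = B z (u \<otimes> y) \<oplus>\<^bsub>E\<^esub> B (dot T us1 zs) y"
    using B_add_left[OF uz IH(3) assms(4)] B_smult_left[OF z(2,1) assms(4)] B_smult_right[OF z(2,1) assms(4)] by simp
  ultimately show ?case unfolding u using IH ideal_add[OF \<dd> uz IH(3)] by simp
qed

lemma extension:
  obtains \<Psi> where "\<Psi> \<in> mod_hom T (ideal_module T \<aa>) E"
    "\<And>x y. x \<in> \<dd> \<Longrightarrow> y \<in> \<aa> \<Longrightarrow> \<Psi> (x \<otimes> y) = B x y"
proof -
  let ?M = "ideal_module T \<aa>"
  have M: "module T ?M" by (rule module_ideal_module[OF \<aa>])
  \<comment> \<open>One pair for each way of writing an element of \<open>\<aa>\<dd>\<close>.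
    Independence of the way is the last clause of \<open>linear_graph\<close>.\<close>
  define G0 where "G0 = {(dot T ys xs, pairing_sum E B xs ys) | ys. length ys = length xs \<and> set ys \<subseteq> \<aa>}"
  have G0I: "(dot T ys xs, pairing_sum E B xs ys) \<in> G0" if "length ys = length xs" "set ys \<subseteq> \<aa>" for ys
    using that unfolding G0_def by blast
  have G0E: "\<exists>ys. x = dot T ys xs \<and> e = pairing_sum E B xs ys \<and> length ys = length xs \<and> set ys \<subseteq> \<aa>"
    if "(x, e) \<in> G0" for x e using that unfolding G0_def by blast
  have sub_\<aa>: "set ys \<subseteq> carrier T" if "set ys \<subseteq> \<aa>" for ys using that \<aa>_carr by blast
  have prod: "(x \<otimes> y, B x y) \<in> G0" if x: "x \<in> \<dd>" and y: "y \<in> \<aa>" for x y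
  proof -
    obtain us where us: "length us = length xs" "set us \<subseteq> carrier T" "x = dot T us xs"
      by (rule Idl_dot[OF xs x])
    have "set (map (\<lambda>u. u \<otimes> y) us) \<subseteq> \<aa>" using us(2) ideal_mult[OF \<aa> y] by auto
    then show ?thesis
      using G0I[of "map (\<lambda>u. u \<otimes> y) us"] pairing_sum_product[OF us(1) xs_\<dd> us(2) y] us by simp
  qed
  have lin: "linear_graph T ?M E G0"
    unfolding linear_graph_def
  proof (intro conjI allI impI ballI)
    show "G0 \<subseteq> carrier ?M \<times> carrier E"
      unfolding G0_def using dot_\<aa>[OF xs] pairing_sum_closed[OF xs_\<dd>] by auto
    have "(\<zero> \<otimes> \<zero>, B \<zero> \<zero>) \<in> G0" by (rule prod[OF ideal_zero[OF \<dd>] ideal_zero[OF \<aa>]])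
    then show "(\<zero>\<^bsub>?M\<^esub>, \<zero>\<^bsub>E\<^esub>) \<in> G0" using B_\<bb>[OF ideal_zero[OF \<bb>] ideal_zero[OF \<aa>]] by simp
    show "(x \<oplus>\<^bsub>?M\<^esub> x', e \<oplus>\<^bsub>E\<^esub> e') \<in> G0" if xe: "(x, e) \<in> G0" "(x', e') \<in> G0" for x e x' e'
    proof -
      obtain ys ys' where y: "x = dot T ys xs" "e = pairing_sum E B xs ys" "length ys = length xs" "set ys \<subseteq> \<aa>"
        "x' = dot T ys' xs" "e' = pairing_sum E B xs ys'" "length ys' = length xs" "set ys' \<subseteq> \<aa>"
        using G0E[OF xe(1)] G0E[OF xe(2)] by auto
      have "set (map2 (\<oplus>) ys ys') \<subseteq> \<aa>"
        using y(4,8) by (auto intro!: ideal_add[OF \<aa>] dest: set_zip_leftD set_zip_rightD)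
      then show ?thesis
        using G0I[of "map2 (\<oplus>) ys ys'"] y dot_add[OF y(3,7) sub_\<aa>[OF y(4)] sub_\<aa>[OF y(8)] xs]
          pairing_sum_add[OF y(3,7) xs_\<dd> y(4,8)] by simp
    qed
    show "(r \<odot>\<^bsub>?M\<^esub> x, r \<odot>\<^bsub>E\<^esub> e) \<in> G0" if r: "r \<in> carrier T" and xe: "(x, e) \<in> G0" for r x e
    proof -
      obtain ys where y: "x = dot T ys xs" "e = pairing_sum E B xs ys" "length ys = length xs" "set ys \<subseteq> \<aa>"
        using G0E[OF xe] by auto
      have "set (map ((\<otimes>) r) ys) \<subseteq> \<aa>" using y(4) ideal_mult[OF \<aa> _ r] by auto
      then show ?thesis
        using G0I[of "map ((\<otimes>) r) ys"] y dot_smult[OF sub_\<aa>[OF y(4)] xs r]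
          pairing_sum_smult[OF y(3) xs_\<dd> y(4) r] by simp
    qed
    \<comment> \<open>Although the \<open>ys\<close> are only known to lie in \<open>\<aa>\<close>,
      the relation is a Koszul syzygy; its entries are in \<open>\<dd>\<close>, where
      \<open>B\<close> is symmetric.\<close>
    show "e = \<zero>\<^bsub>E\<^esub>" if e: "(\<zero>\<^bsub>?M\<^esub>, e) \<in> G0" for e
    proof -
      obtain ys where y: "\<zero> = dot T ys xs" "e = pairing_sum E B xs ys" "length ys = length xs" "set ys \<subseteq> \<aa>"
        using G0E[OF e] by auto
      show ?thesis
        unfolding y(2)
        by (rule symmetric_pairing.pairing_sum_syzygy[OF symmetric xs_\<dd> ss(1,2,3) y(3) sub_\<aa>[OF y(4)] y(1)[symmetric]])
    qed
  qed
  \<comment> \<open>Since \<open>\<bb> \<subseteq> \<dd>\<close>, such a product is in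
    \<open>\<aa>\<dd>\<close> with value \<open>B r x\<close>. This gives the compatibility with
    \<open>\<bb>\<close> under which \<open>E\<close> may be treated as injective.\<close>
  have b0: "(r \<odot>\<^bsub>?M\<^esub> x, \<zero>\<^bsub>E\<^esub>) \<in> G0" if "r \<in> \<bb>" "x \<in> carrier ?M" for r x
    using prod[of r x] B_\<bb>[of r x] that incl(1) by auto
  obtain G where G: "linear_graph T ?M E G" "G0 \<subseteq> G" "fst ` G = carrier ?M"
  proof (rule linear_graph_extension[OF M E.module_axioms lin b0 ideal_sub[OF \<bb>]])
  qed (use baer_E in auto)
  obtain \<Psi> where \<Psi>: "\<Psi> \<in> mod_hom T ?M E" "\<And>x e. (x, e) \<in> G \<Longrightarrow> \<Psi> x = e"
    using mod_hom_of_graph[OF M E.module_axioms G(1,3)] by blast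
  show ?thesis
  proof (rule that[OF \<Psi>(1)])
    show "\<Psi> (x \<otimes> y) = B x y" if "x \<in> \<dd>" "y \<in> \<aa>" for x y
      using \<Psi>(2) prod[OF that] G(2) by blast
  qed
qed

text \<open>What is needed about \<open>T/\<cc>\<close>, expressed in \<open>T\<close>:
  \<open>\<bb>\<close> is the colon ideal of \<open>\<cc>\<close> by \<open>\<aa>\<close>,
  \<open>\<mm>\<close> is nil modulo \<open>\<cc>\<close>, and \<open>s\<close> represents a
  generator of the socle.\<close>

lemma simple_socle_ideal:
  obtains \<cc> s where "ideal \<cc> T" "\<cc> \<subseteq> \<bb>"
    "\<And>r. r \<in> carrier T \<Longrightarrow> (\<forall>y\<in>\<aa>. r \<otimes> y \<in> \<cc>) \<longleftrightarrow> r \<in> \<bb>"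
    "\<And>q. q \<in> \<mm> \<Longrightarrow> \<exists>k::nat. q [^] k \<in> \<cc>"
    "s \<in> carrier T" "s \<notin> \<cc>" "\<And>p. p \<in> \<mm> \<Longrightarrow> p \<otimes> s \<in> \<cc>"
    "\<And>x. x \<in> carrier T \<Longrightarrow> (\<And>p. p \<in> \<mm> \<Longrightarrow> p \<otimes> x \<in> \<cc>) \<Longrightarrow>
      \<exists>r\<in>carrier T. x \<ominus> r \<otimes> s \<in> \<cc>"
proof -
  note found = that
  obtain \<Psi> where \<Psi>: "\<Psi> \<in> mod_hom T (ideal_module T \<aa>) E"
    "\<And>x y. x \<in> \<dd> \<Longrightarrow> y \<in> \<aa> \<Longrightarrow> \<Psi> (x \<otimes> y) = B x y" by (rule extension) blast
  have \<Psi>c: "\<Psi> x \<in> carrier E" if "x \<in> \<aa>" for x using mod_homD(1)[OF \<Psi>(1)] that by simp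
  have \<Psi>add: "\<Psi> (x \<oplus> y) = \<Psi> x \<oplus>\<^bsub>E\<^esub> \<Psi> y" if "x \<in> \<aa>" "y \<in> \<aa>" for x y
    using mod_homD(3)[OF \<Psi>(1)] that by simp
  have \<Psi>smult: "\<Psi> (r \<otimes> x) = r \<odot>\<^bsub>E\<^esub> \<Psi> x" if "r \<in> carrier T" "x \<in> \<aa>" for r x
    using mod_homD(4)[OF \<Psi>(1)] that by simp
  have \<Psi>0: "\<Psi> \<zero> = \<zero>\<^bsub>E\<^esub>"
    using \<Psi>smult[OF zero_closed ideal_zero[OF \<aa>]] \<Psi>c[OF ideal_zero[OF \<aa>]] by simp
  have \<bb>\<aa>: "\<bb> \<subseteq> \<aa>" using incl by blast
  define \<cc> where "\<cc> = {z \<in> \<aa>. \<Psi> z = \<zero>\<^bsub>E\<^esub>}"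
  have \<cc>: "ideal \<cc> T"
    by (rule idealI')
      (auto simp: \<cc>_def \<aa>_carr ideal_zero[OF \<aa>] \<Psi>0 ideal_add[OF \<aa>] \<Psi>add ideal_mult[OF \<aa>] \<Psi>smult)
  have faithful: "r \<in> \<bb>" if r: "r \<in> carrier T" "\<And>y. y \<in> \<aa> \<Longrightarrow> r \<otimes> y \<in> \<cc>" for r
  proof (rule ccontr)
    assume rb: "r \<notin> \<bb>"
    obtain q where q: "q \<in> carrier T" "q \<otimes> r \<notin> \<bb>" "\<And>p. p \<in> \<mm> \<Longrightarrow> p \<otimes> (q \<otimes> r) \<in> \<bb>"
      by (rule socle_multiple[OF \<mm> \<bb> nilpotent r(1) rb]) auto
    have qr: "q \<otimes> r \<in> carrier T" using q r by simp
    have "q \<otimes> r \<in> colon_ideal T \<bb> \<aa>"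
      unfolding colon_ideal_def using q(3) incl(3) qr m_comm \<aa>_carr by auto
    then have qd: "q \<otimes> r \<in> \<dd>" using colon by blast
    have "q \<otimes> r \<in> \<bb>"
    proof (rule B_nondeg[OF qd])
      fix y assume y: "y \<in> \<aa>"
      have ry: "r \<otimes> y \<in> \<aa>" "\<Psi> (r \<otimes> y) = \<zero>\<^bsub>E\<^esub>" using r(2)[OF y] unfolding \<cc>_def by auto
      have "B (q \<otimes> r) y = \<Psi> (q \<otimes> r \<otimes> y)" using \<Psi>(2)[OF qd y] by simp
      also have "q \<otimes> r \<otimes> y = q \<otimes> (r \<otimes> y)" using q r \<aa>_carr[OF y] by (simp add: m_assoc)
      finally show "B (q \<otimes> r) y = \<zero>\<^bsub>E\<^esub>" using \<Psi>smult[OF q(1) ry(1)] ry(2) q(1) by simp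
    qed
    then show False using q(2) by simp
  qed
  have \<bb>\<cc>: "r \<otimes> y \<in> \<cc>" if "r \<in> \<bb>" "y \<in> \<aa>" for r y
    unfolding \<cc>_def using \<Psi>smult[OF _ that(2)] \<bb>_E[OF that(1) \<Psi>c[OF that(2)]]
      ideal_mult[OF \<aa> that(2)] ideal_carr[OF \<bb> that(1)] by simp
  have \<cc>\<bb>: "\<cc> \<subseteq> \<bb>"
  proof
    fix z assume z: "z \<in> \<cc>"
    have zc: "z \<in> carrier T" by (rule ideal_carr[OF \<cc> z])
    show "z \<in> \<bb>" by (rule faithful[OF zc]) (rule ideal_mult'[OF \<cc> z \<aa>_carr])
  qed
  have nil: "\<exists>k::nat. q [^] k \<in> \<cc>" if q: "q \<in> \<mm>" for q
  proof -
    obtain k where k: "q [^] (k::nat) \<in> \<bb>" using nilpotent[OF q] by blast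
    have "q \<in> carrier T" using q ideal_carr primeD(1)[OF \<mm>] by blast
    \<comment> \<open>Products of \<open>\<bb>\<close> with \<open>\<aa>\<close> lie in
      \<open>\<cc>\<close>, and the power \<open>q [^] k\<close> belongs to both ideals.\<close>
    then have "q [^] (k + k) = q [^] k \<otimes> q [^] k" by (simp add: nat_pow_mult)
    then show ?thesis using \<bb>\<cc>[OF k] k \<bb>\<aa> by (metis subsetD)
  qed
  have one: "\<one> \<notin> \<cc>" using \<cc>\<bb> \<bb>\<aa> incl(3) primeD(2)[OF \<mm>] by blast
  obtain s where s: "s \<in> carrier T" "s \<otimes> \<one> \<notin> \<cc>" "\<And>p. p \<in> \<mm> \<Longrightarrow> p \<otimes> (s \<otimes> \<one>) \<in> \<cc>"
    by (rule socle_multiple[OF \<mm> \<cc> nil one_closed one]) auto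
  have s': "s \<notin> \<cc>" "\<And>p. p \<in> \<mm> \<Longrightarrow> p \<otimes> s \<in> \<cc>" using s by auto
  have soc: "x \<in> \<aa> \<and> (\<forall>p\<in>\<mm>. p \<odot>\<^bsub>E\<^esub> \<Psi> x = \<zero>\<^bsub>E\<^esub>)"
    if x: "x \<in> carrier T" "\<And>p. p \<in> \<mm> \<Longrightarrow> p \<otimes> x \<in> \<cc>" for x
  proof -
    \<comment> \<open>As \<open>\<aa> \<subseteq> \<mm>\<close>, a socle element modulo
      \<open>\<cc>\<close> carries \<open>\<aa>\<close> into \<open>\<cc>\<close> and hence lies in
      \<open>\<bb>\<close>. So it is in \<open>\<aa>\<close>, where \<open>\<Psi>\<close> is
      defined.\<close>
    have "x \<in> \<bb>"
    proof (rule faithful[OF x(1)])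
      fix y assume y: "y \<in> \<aa>"
      then have "y \<otimes> x \<in> \<cc>" using x(2) incl(3) by blast
      then show "x \<otimes> y \<in> \<cc>" using m_comm[OF x(1) \<aa>_carr[OF y]] by simp
    qed
    then have xa: "x \<in> \<aa>" using \<bb>\<aa> by blast
    have "p \<odot>\<^bsub>E\<^esub> \<Psi> x = \<zero>\<^bsub>E\<^esub>" if p: "p \<in> \<mm>" for p
      using x(2)[OF p] \<Psi>smult[OF _ xa, of p] ideal_carr[OF primeD(1)[OF \<mm>] p] unfolding \<cc>_def by simp
    then show ?thesis using xa by blast
  qed
  have "\<exists>r\<in>carrier T. x \<ominus> r \<otimes> s \<in> \<cc>"
    if x: "x \<in> carrier T" "\<And>p. p \<in> \<mm> \<Longrightarrow> p \<otimes> x \<in> \<cc>" for x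
  proof -
    have sa: "s \<in> \<aa>" and sE: "\<And>p. p \<in> \<mm> \<Longrightarrow> p \<odot>\<^bsub>E\<^esub> \<Psi> s = \<zero>\<^bsub>E\<^esub>" using soc[OF s(1) s'(2)] by auto
    have xa: "x \<in> \<aa>" and xE: "\<And>p. p \<in> \<mm> \<Longrightarrow> p \<odot>\<^bsub>E\<^esub> \<Psi> x = \<zero>\<^bsub>E\<^esub>" using soc[OF x] by auto
    have "\<Psi> s \<noteq> \<zero>\<^bsub>E\<^esub>" using sa s'(1) unfolding \<cc>_def by simp
    then obtain r where r: "r \<in> carrier T" "\<Psi> x = r \<odot>\<^bsub>E\<^esub> \<Psi> s"
      using socle_E[OF \<Psi>c[OF sa] \<Psi>c[OF xa] _ sE xE] by blast
    have rs: "r \<otimes> s \<in> \<aa>" by (rule ideal_mult[OF \<aa> sa r(1)])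
    have xrs: "x \<ominus> r \<otimes> s \<in> \<aa>" by (rule ideal_minus[OF \<aa> xa rs])
    have "(x \<ominus> r \<otimes> s) \<oplus> r \<otimes> s = x"
      using x(1) r(1) s(1) by (simp add: minus_eq a_assoc l_neg)
    then have "\<Psi> (x \<ominus> r \<otimes> s) \<oplus>\<^bsub>E\<^esub> \<Psi> (r \<otimes> s) = \<Psi> (r \<otimes> s)"
      using \<Psi>add[OF xrs rs] r(2) \<Psi>smult[OF r(1) sa] by simp
    then have "\<Psi> (x \<ominus> r \<otimes> s) = \<zero>\<^bsub>E\<^esub>"
      using \<Psi>c[OF xrs] \<Psi>c[OF rs] by (metis E.M.add.r_cancel_one')
    then show ?thesis using xrs r(1) unfolding \<cc>_def by blast
  qed
  then show ?thesis
    by (intro found[OF \<cc> \<cc>\<bb> _ nil s(1) s']) (use faithful \<bb>\<cc> in auto)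
qed

end

text \<open>
  A quotient of finite length of a local ring has a composition series with factors isomorphic
  to the residue field, so its elements are coded by lists of residue classes.
\<close>

lemma (in noetherian_cring) list_representation:
  fixes \<sigma> :: "'r \<Rightarrow> 'a"
  assumes P: "primeideal P R" and C: "ideal C R" and nil: "\<And>q. q \<in> P \<Longrightarrow> \<exists>k::nat. q [^] k \<in> C"
    and \<sigma>: "\<And>r. r \<in> carrier R \<Longrightarrow> \<exists>\<rho>. \<sigma> \<rho> \<in> carrier R \<and> r \<ominus> \<sigma> \<rho> \<in> P"
  shows "\<exists>F :: 'r list \<Rightarrow> 'a. \<forall>z\<in>carrier R. \<exists>l. F l \<in> carrier R \<and> z \<ominus> F l \<in> C"
proof -
  let ?Q = "\<lambda>N (F :: 'r list \<Rightarrow> 'a). \<forall>z\<in>N. \<exists>l. F l \<in> carrier R \<and> z \<ominus> F l \<in> C"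
  let ?C = "{N. ideal N R \<and> C \<subseteq> N \<and> (\<exists>F. ?Q N F)}"
  have "?Q C (\<lambda>_. \<zero>)" using ideal_carr[OF C] by (simp add: minus_eq)
  then have ne: "?C \<noteq> {}" using C by auto
  obtain N where N: "N \<in> ?C" and Nmax: "\<And>K. K \<in> ?C \<Longrightarrow> N \<subseteq> K \<Longrightarrow> K = N"
    by (rule ideal_maximal_exists[OF ne]) auto
  have Ni: "ideal N R" and CN: "C \<subseteq> N" using N by auto
  obtain F where F: "?Q N F" using N by blast
  have "N = carrier R"
  proof (rule ccontr)
    assume "N \<noteq> carrier R"
    then obtain x where x: "x \<in> carrier R" "x \<notin> N" using ideal_sub[OF Ni] by blast
    have nilN: "\<exists>k::nat. q [^] k \<in> N" if "q \<in> P" for q using nil[OF that] CN by blast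
    obtain q where q: "q \<in> carrier R" "q \<otimes> x \<notin> N" "\<And>p. p \<in> P \<Longrightarrow> p \<otimes> (q \<otimes> x) \<in> N"
      by (rule socle_multiple[OF P Ni nilN x]) auto
    obtain y where y: "y = q \<otimes> x" by blast
    have yc: "y \<in> carrier R" unfolding y using q x by simp
    \<comment> \<open>A new first letter records the coefficient of \<open>y\<close>. Its residue
      class is enough, because \<open>P\<close> carries \<open>y\<close> into \<open>N\<close>, and
      the rest of the list takes care of the error in \<open>N\<close>.\<close>
    define F' where "F' l = (case l of [] \<Rightarrow> \<zero> | \<rho> # l' \<Rightarrow> F l' \<oplus> \<sigma> \<rho> \<otimes> y)" for l
    have "?Q (N <+> PIdl y) F'"
    proof
      fix z assume "z \<in> N <+> PIdl y"
      then obtain m r where m: "m \<in> N" "r \<in> carrier R" "z = m \<oplus> r \<otimes> y" using mem_add_PIdl_iff by blast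
      obtain \<rho> where \<rho>: "\<sigma> \<rho> \<in> carrier R" "r \<ominus> \<sigma> \<rho> \<in> P" using \<sigma>[OF m(2)] by blast
      have "m \<oplus> (r \<ominus> \<sigma> \<rho>) \<otimes> y \<in> N" using ideal_add[OF Ni m(1)] q(3)[OF \<rho>(2)] y by simp
      then obtain l where l: "F l \<in> carrier R" "m \<oplus> (r \<ominus> \<sigma> \<rho>) \<otimes> y \<ominus> F l \<in> C" using F by blast
      obtain a b where ab: "a = \<sigma> \<rho>" "b = F l" by blast
      have c: "a \<in> carrier R" "b \<in> carrier R" "m \<in> carrier R"
        using \<rho>(1) l(1) ideal_carr[OF Ni m(1)] ab by auto
      have "z \<ominus> (b \<oplus> a \<otimes> y) = m \<oplus> (r \<ominus> a) \<otimes> y \<ominus> b"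
        unfolding m(3) using c m(2) yc by algebra
      then have "F' (\<rho> # l) \<in> carrier R \<and> z \<ominus> F' (\<rho> # l) \<in> C"
        using l c yc unfolding F'_def ab by simp
      then show "\<exists>l. F' l \<in> carrier R \<and> z \<ominus> F' l \<in> C" by blast
    qed
    then have "N <+> PIdl y \<in> ?C"
      using add_PIdl_ideal[OF Ni yc] sub_add_PIdl[OF Ni yc] CN by blast
    then have "N <+> PIdl y = N" using Nmax sub_add_PIdl[OF Ni yc] by blast
    then show False using self_in_add_PIdl[OF Ni yc] q(2) y by simp
  qed
  then show ?thesis using F by blast
qed

text \<open>Congruent elements have the same codes, so \<open>SOME\<close> selects the same one for
  both; elements with a common code are congruent. Thus \<open>f\<close> is injective on cosets, and
  \<open>image_ring\<close> carries the quotient by \<open>C\<close> over to lists.\<close>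

lemma (in noetherian_cring) weak_ring_morphism_list:
  fixes \<sigma> :: "'r \<Rightarrow> 'a"
  assumes P: "primeideal P R" and C: "ideal C R" and nil: "\<And>q. q \<in> P \<Longrightarrow> \<exists>k::nat. q [^] k \<in> C"
    and \<sigma>: "\<And>r. r \<in> carrier R \<Longrightarrow> \<exists>\<rho>. \<sigma> \<rho> \<in> carrier R \<and> r \<ominus> \<sigma> \<rho> \<in> P"
  shows "\<exists>f :: 'a \<Rightarrow> 'r list. weak_ring_morphism f C R"
proof -
  obtain F :: "'r list \<Rightarrow> 'a" where F: "\<And>z. z \<in> carrier R \<Longrightarrow> \<exists>l. F l \<in> carrier R \<and> z \<ominus> F l \<in> C"
    using list_representation[OF P C nil \<sigma>] by blast
  define f where "f z = (SOME l. F l \<in> carrier R \<and> z \<ominus> F l \<in> C)" for z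
  have f: "F (f z) \<in> carrier R \<and> z \<ominus> F (f z) \<in> C" if "z \<in> carrier R" for z
    unfolding f_def using F[OF that] by (rule someI_ex)
  have "weak_ring_morphism f C R"
  proof (rule weak_ring_morphismI[OF C])
    fix a b assume ab: "a \<in> carrier R" "b \<in> carrier R"
    have trans: "x \<ominus> z \<in> C" if "x \<ominus> y \<in> C" "y \<ominus> z \<in> C" "x \<in> carrier R" "y \<in> carrier R" "z \<in> carrier R" for x y z
    proof -
      have "x \<ominus> z = (x \<ominus> y) \<oplus> (y \<ominus> z)" using that(3-5) by algebra
      then show ?thesis using ideal_add[OF C that(1,2)] by simp
    qed
    have sym: "y \<ominus> x \<in> C" if "x \<ominus> y \<in> C" "x \<in> carrier R" "y \<in> carrier R" for x y
    proof -
      have "y \<ominus> x = \<ominus> (x \<ominus> y)" using that(2,3) by algebra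
      then show ?thesis using ideal_neg[OF C that(1)] by simp
    qed
    show "f a = f b \<longleftrightarrow> a \<ominus> b \<in> C"
    proof
      assume "f a = f b"
      then show "a \<ominus> b \<in> C" using f[OF ab(1)] f[OF ab(2)] ab trans sym by metis
    next
      assume d: "a \<ominus> b \<in> C"
      have "(F l \<in> carrier R \<and> a \<ominus> F l \<in> C) = (F l \<in> carrier R \<and> b \<ominus> F l \<in> C)" for l
        using trans[OF d, of "F l"] trans[OF sym[OF d], of "F l"] ab by blast
      then show "f a = f b" unfolding f_def by simp
    qed
  qed
  then show ?thesis by blast
qed

lemma (in cring) image_ring_surjective:
  assumes "weak_ring_morphism f C R"
  shows "surjective_ring_hom R (image_ring f R) f"
proof -
  interpret I: ring "image_ring f R" by (rule image_ring_is_ring[OF assms])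
  have f: "f \<in> ring_hom R (image_ring f R)" by (rule weak_ring_morphism_is_hom[OF assms])
  have surj: "f ` carrier R = carrier (image_ring f R)" by (simp add: image_ring_carrier)
  have "cring (image_ring f R)"
  proof (rule cring.intro[OF I.ring_axioms comm_monoid.intro[OF I.monoid_axioms comm_monoid_axioms.intro]])
    fix x y assume "x \<in> carrier (image_ring f R)" "y \<in> carrier (image_ring f R)"
    then obtain a b where ab: "a \<in> carrier R" "b \<in> carrier R" "x = f a" "y = f b"
      unfolding surj[symmetric] by blast
    then show "x \<otimes>\<^bsub>image_ring f R\<^esub> y = y \<otimes>\<^bsub>image_ring f R\<^esub> x"
      using ring_hom_mult[OF f ab(1,2)] ring_hom_mult[OF f ab(2,1)] m_comm[OF ab(1,2)] by simp
  qed
  then show ?thesis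
    by (intro surjective_ring_hom.intro surjective_ring_hom_axioms.intro cring_axioms f surj)
qed

lemma (in cring) weak_ring_morphism_zero_iff:
  assumes "weak_ring_morphism f C R" "x \<in> carrier R"
  shows "f x = \<zero>\<^bsub>image_ring f R\<^esub> \<longleftrightarrow> x \<in> C"
  using weak_ring_morphism.inj_mod_ideal[OF assms(1,2), of \<zero>] assms(2)
  by (simp add: image_ring_zero minus_eq)

section \<open>Local and Gorenstein properties of the image\<close>

context surjective_ring_hom
begin

lemma image_Units:
  assumes "\<And>x. x \<in> carrier S \<Longrightarrow> x \<notin> P \<Longrightarrow> x \<in> Units S" "y \<in> carrier R" "y \<notin> h ` P"
  shows "y \<in> Units R"
proof -
  obtain x where x: "x \<in> carrier S" "y = h x" using assms(2) unfolding surj[symmetric] by blast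
  then have "x \<in> Units S" using assms(1,3) by blast
  then obtain z where z: "z \<in> carrier S" "z \<otimes> x = \<one>" unfolding Units_def by blast
  have "h z \<otimes>\<^bsub>R\<^esub> y = \<one>\<^bsub>R\<^esub>" using h_mult[OF z(1) x(1)] z(2) h_one x(2) by simp
  then show ?thesis unfolding Units_def
    using h_closed[OF z(1)] assms(2) R.m_comm[of "h z" y] by auto
qed

lemma image_maximal:
  assumes P: "maximalideal P S" and ker: "{x \<in> carrier S. h x = \<zero>\<^bsub>R\<^esub>} \<subseteq> P"
  shows "maximalideal (h ` P) R"
proof (rule maximalidealI)
  have Pp: "primeideal P S" by (rule S.maximalideal_prime[OF P])
  note Pi = S.primeD(1)[OF Pp]
  show "ideal (h ` P) R" by (rule image_ideal[OF Pi])
  have "h \<one> \<notin> h ` P" using image_mem[OF Pi ker, of "\<one>"] S.primeD(2)[OF Pp] by simp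
  then show "carrier R \<noteq> h ` P" using h_closed[of "\<one>"] by auto
  fix J assume J: "ideal J R" "h ` P \<subseteq> J" "J \<subseteq> carrier R"
  have img: "h ` {x \<in> carrier S. h x \<in> J} = J"
  proof
    show "J \<subseteq> h ` {x \<in> carrier S. h x \<in> J}"
    proof
      fix y assume y: "y \<in> J"
      then have "y \<in> h ` carrier S" using J(3) surj by auto
      then show "y \<in> h ` {x \<in> carrier S. h x \<in> J}" using y by blast
    qed
  qed auto
  have "{x \<in> carrier S. h x \<in> J} = P \<or> {x \<in> carrier S. h x \<in> J} = carrier S"
    by (rule maximalideal.I_maximal[OF P vimage_ideal[OF J(1)]]) (use J(2) S.ideal_carr[OF Pi] in auto)
  then show "J = h ` P \<or> J = carrier R" using img surj by auto
qed

lemma image_noetherian: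
  assumes "noetherian_ring S"
  shows "noetherian_ring R"
proof (rule R.noetherian_ringI)
  fix I assume I: "ideal I R"
  obtain A where A: "A \<subseteq> carrier S" "finite A" "{x \<in> carrier S. h x \<in> I} = Idl A"
    using noetherian_ring.finetely_gen[OF assms vimage_ideal[OF I]] by blast
  have AI: "h ` A \<subseteq> I" using S.genideal_self[OF A(1)] A(3) by blast
  have hA: "h ` A \<subseteq> carrier R" using AI R.ideal_sub[OF I] by blast
  have g: "ideal (Idl\<^bsub>R\<^esub> (h ` A)) R" by (rule R.genideal_ideal[OF hA])
  have "A \<subseteq> {x \<in> carrier S. h x \<in> Idl\<^bsub>R\<^esub> (h ` A)}" using R.genideal_self[OF hA] A(1) by blast
  then have sub: "Idl A \<subseteq> {x \<in> carrier S. h x \<in> Idl\<^bsub>R\<^esub> (h ` A)}"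
    by (rule S.genideal_minimal[OF vimage_ideal[OF g]])
  have "I \<subseteq> Idl\<^bsub>R\<^esub> (h ` A)"
  proof
    fix y assume y: "y \<in> I"
    then have "y \<in> h ` carrier S" using R.ideal_carr[OF I] surj by simp
    then obtain x where "x \<in> carrier S" "y = h x" by blast
    then show "y \<in> Idl\<^bsub>R\<^esub> (h ` A)" using y sub A(3) by blast
  qed
  then have "I = Idl\<^bsub>R\<^esub> (h ` A)" using R.genideal_minimal[OF I AI] by blast
  then show "\<exists>A\<subseteq>carrier R. finite A \<and> I = Idl\<^bsub>R\<^esub> A" using hA A(2) by blast
qed

lemma image_zero_dimensional_simple_socle:
  assumes S: "noetherian_ring S" and n: "maximalideal n S"
    and units: "\<And>x. x \<in> carrier S \<Longrightarrow> x \<notin> n \<Longrightarrow> x \<in> Units S"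
    and nil: "\<And>q. q \<in> n \<Longrightarrow> \<exists>k::nat. h (q [^] k) = \<zero>\<^bsub>R\<^esub>"
    and ker: "{x \<in> carrier S. h x = \<zero>\<^bsub>R\<^esub>} \<subseteq> n"
    and s: "s \<in> carrier S" "h s \<noteq> \<zero>\<^bsub>R\<^esub>" "\<And>p. p \<in> n \<Longrightarrow> h (p \<otimes> s) = \<zero>\<^bsub>R\<^esub>"
    and socle: "\<And>x. x \<in> carrier S \<Longrightarrow> (\<And>p. p \<in> n \<Longrightarrow> h (p \<otimes> x) = \<zero>\<^bsub>R\<^esub>) \<Longrightarrow>
      \<exists>r\<in>carrier S. h (x \<ominus> r \<otimes> s) = \<zero>\<^bsub>R\<^esub>"
  shows "zero_dimensional_simple_socle R (h ` n) (h s)"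
proof (rule zero_dimensional_simple_socle.intro)
  show "noetherian_cring R"
    by (intro noetherian_cring.intro image_noetherian[OF S] R.cring_axioms)
  have nc: "p \<in> carrier S" if "p \<in> n" for p
    using that S.ideal_carr[OF S.primeD(1)[OF S.maximalideal_prime[OF n]]] by blast
  show "zero_dimensional_simple_socle_axioms R (h ` n) (h s)"
  proof (rule zero_dimensional_simple_socle_axioms.intro)
    show "maximalideal (h ` n) R" by (rule image_maximal[OF n ker])
    show "x \<in> Units R" if "x \<in> carrier R" "x \<notin> h ` n" for x by (rule image_Units[OF units that])
    show "\<exists>k::nat. q [^]\<^bsub>R\<^esub> k = \<zero>\<^bsub>R\<^esub>" if "q \<in> h ` n" for q
      using that nil h_pow nc by auto
    show "h s \<in> carrier R" by (rule h_closed[OF s(1)])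
    show "h s \<noteq> \<zero>\<^bsub>R\<^esub>" by (rule s(2))
    show "p \<otimes>\<^bsub>R\<^esub> h s = \<zero>\<^bsub>R\<^esub>" if "p \<in> h ` n" for p using that s h_mult nc by auto
    show "\<exists>r\<in>carrier R. x = r \<otimes>\<^bsub>R\<^esub> h s"
      if x: "x \<in> carrier R" "\<And>p. p \<in> h ` n \<Longrightarrow> p \<otimes>\<^bsub>R\<^esub> x = \<zero>\<^bsub>R\<^esub>" for x
    proof -
      obtain y where y: "y \<in> carrier S" "x = h y" using x(1) unfolding surj[symmetric] by blast
      have "h (p \<otimes> y) = \<zero>\<^bsub>R\<^esub>" if p: "p \<in> n" for p
        using x(2)[of "h p"] p y h_mult[OF nc[OF p] y(1)] by simp
      then obtain r where r: "r \<in> carrier S" "h (y \<ominus> r \<otimes> s) = \<zero>\<^bsub>R\<^esub>" using socle[OF y(1)] by blast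
      have "x \<ominus>\<^bsub>R\<^esub> h r \<otimes>\<^bsub>R\<^esub> h s = \<zero>\<^bsub>R\<^esub>" using r y s(1) h_minus h_mult by simp
      then have "x = h r \<otimes>\<^bsub>R\<^esub> h s"
        by (rule R.diff_zeroD[OF x(1), rotated]) (use r(1) s(1) h_closed in auto)
      then show ?thesis using h_closed[OF r(1)] by blast
    qed
  qed
qed

end

text \<open>The inclusion of \<open>I\<close> into \<open>R\<close> is among the test maps of
  \<open>injective_module\<close>; \<open>w\<close> is the value at \<open>\<one>\<close> of an
  extension of \<open>f\<close>.\<close>

lemma injective_module_baer:
  assumes E: "injective_module R E" and I: "ideal I R" and fc: "\<And>r. r \<in> I \<Longrightarrow> f r \<in> carrier E"
    and fadd: "\<And>r s. r \<in> I \<Longrightarrow> s \<in> I \<Longrightarrow> f (r \<oplus>\<^bsub>R\<^esub> s) = f r \<oplus>\<^bsub>E\<^esub> f s"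
    and fmult: "\<And>r s. r \<in> carrier R \<Longrightarrow> s \<in> I \<Longrightarrow> f (r \<otimes>\<^bsub>R\<^esub> s) = r \<odot>\<^bsub>E\<^esub> f s"
  shows "\<exists>w\<in>carrier E. \<forall>r\<in>I. f r = r \<odot>\<^bsub>E\<^esub> w"
proof -
  have M: "module R E" using E unfolding injective_module_def by blast
  interpret module R E by (rule M)
  let ?A = "ideal_module R I" and ?B = "ring_module R"
  have A: "module R ?A" and B: "module R ?B"
    by (rule R.module_ideal_module[OF I], rule R.module_ring_module)
  have i: "restrict (\<lambda>x. x) (carrier ?A) \<in> mod_hom R ?A ?B"
    by (rule mod_homI[OF _ _ _ A]) (use R.ideal_carr[OF I] in auto)
  have f': "restrict f (carrier ?A) \<in> mod_hom R ?A E"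
    by (rule mod_homI[OF _ _ _ A]) (use fc fadd fmult in auto)
  have inj: "inj_on (restrict (\<lambda>x. x) (carrier ?A)) (carrier ?A)" by (rule inj_onI) simp
  have "\<exists>g\<in>mod_hom R ?B E. \<forall>a\<in>carrier ?A. g (restrict (\<lambda>x. x) (carrier ?A) a) = restrict f (carrier ?A) a"
    using E A B i inj f' unfolding injective_module_def by blast
  then obtain g where g: "g \<in> mod_hom R ?B E" "\<And>a. a \<in> I \<Longrightarrow> g a = f a" by auto
  have "f r = r \<odot>\<^bsub>E\<^esub> g \<one>\<^bsub>R\<^esub>" if r: "r \<in> I" for r
    using mod_homD(4)[OF g(1), of r "\<one>\<^bsub>R\<^esub>"] g(2)[OF r] R.ideal_carr[OF I r] by simp
  moreover have "g \<one>\<^bsub>R\<^esub> \<in> carrier E" using mod_homD(1)[OF g(1), of "\<one>\<^bsub>R\<^esub>"] by simp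
  ultimately show ?thesis by blast
qed

text \<open>The socle of the hull is the embedded residue field. By essentiality the cyclic module
  of a nonzero socle element \<open>u\<close> meets the multiples of \<open>e\<close>, say in
  \<open>r u = x e \<noteq> 0\<close>; since \<open>\<mm>\<close> kills \<open>u\<close> and
  \<open>e\<close>, both coefficients are units.\<close>

lemma canonical_module_socle:
  assumes E: "canonical_module R \<mm> E" and \<mm>: "primeideal \<mm> R"
    and units: "\<And>x. x \<in> carrier R \<Longrightarrow> x \<notin> \<mm> \<Longrightarrow> x \<in> Units R"
    and v: "v \<in> carrier E" "v \<noteq> \<zero>\<^bsub>E\<^esub>" "\<And>p. p \<in> \<mm> \<Longrightarrow> p \<odot>\<^bsub>E\<^esub> v = \<zero>\<^bsub>E\<^esub>"
    and w: "w \<in> carrier E" "\<And>p. p \<in> \<mm> \<Longrightarrow> p \<odot>\<^bsub>E\<^esub> w = \<zero>\<^bsub>E\<^esub>"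
  shows "\<exists>r\<in>carrier R. w = r \<odot>\<^bsub>E\<^esub> v"
proof -
  let ?Q = "quotient_module (ring_module R) \<mm>"
  have M: "module R E" using E unfolding canonical_module_def injective_hull_def injective_module_def by blast
  interpret module R E by (rule M)
  have \<mm>i: "ideal \<mm> R" by (rule R.primeD(1)[OF \<mm>])
  have Q: "module R ?Q" by (rule R.module_quotient_module[OF \<mm>i])
  note sel = R.quotient_module_sel[OF \<mm>i]
  obtain i where i: "i \<in> mod_hom R ?Q E"
    and ess: "\<And>U. submodule U R E \<Longrightarrow> U \<inter> i ` carrier ?Q = {\<zero>\<^bsub>E\<^esub>} \<Longrightarrow> U = {\<zero>\<^bsub>E\<^esub>}"
    using E unfolding canonical_module_def injective_hull_def residue_field_module_def by blast
  define e where "e = i (\<mm> +>\<^bsub>R\<^esub> \<one>\<^bsub>R\<^esub>)"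
  have i_eq: "i (\<mm> +>\<^bsub>R\<^esub> x) = x \<odot>\<^bsub>E\<^esub> e" if x: "x \<in> carrier R" for x
  proof -
    have "i (x \<odot>\<^bsub>?Q\<^esub> (\<mm> +>\<^bsub>R\<^esub> \<one>\<^bsub>R\<^esub>)) = x \<odot>\<^bsub>E\<^esub> e"
      unfolding e_def by (rule mod_homD(4)[OF i x]) (use sel(1) in auto)
    then show ?thesis using sel(3)[OF x R.one_closed] x by simp
  qed
  have e: "e \<in> carrier E" unfolding e_def by (rule mod_homD(1)[OF i]) (use sel(1) in auto)
  have \<mm>e: "p \<odot>\<^bsub>E\<^esub> e = \<zero>\<^bsub>E\<^esub>" if p: "p \<in> \<mm>" for p
    using i_eq[OF R.ideal_carr[OF \<mm>i p]] R.a_rcos_zero[OF \<mm>i p] mod_hom_zero[OF Q M i] sel(4) by simp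
  have multiple: "\<exists>a\<in>Units R. u = a \<odot>\<^bsub>E\<^esub> e"
    if u: "u \<in> carrier E" "u \<noteq> \<zero>\<^bsub>E\<^esub>" "\<And>p. p \<in> \<mm> \<Longrightarrow> p \<odot>\<^bsub>E\<^esub> u = \<zero>\<^bsub>E\<^esub>" for u
  proof -
    let ?U = "(\<lambda>r. r \<odot>\<^bsub>E\<^esub> u) ` carrier R"
    have U: "submodule ?U R E"
    proof (rule submoduleI)
      show "\<zero>\<^bsub>E\<^esub> \<in> ?U" using u(1) by (intro image_eqI[of _ _ "\<zero>\<^bsub>R\<^esub>"]) auto
      show "\<ominus>\<^bsub>E\<^esub> a \<in> ?U" if "a \<in> ?U" for a
        using that u(1) by (auto simp: smult_l_minus[symmetric])
      show "a \<oplus>\<^bsub>E\<^esub> b \<in> ?U" if "a \<in> ?U" "b \<in> ?U" for a b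
        using that u(1) by (auto simp: smult_l_distr[symmetric])
      show "a \<odot>\<^bsub>E\<^esub> b \<in> ?U" if "a \<in> carrier R" "b \<in> ?U" for a b
        using that u(1) by (auto simp: smult_assoc1[symmetric])
    qed (use u(1) in auto)
    have "u \<in> ?U" using u(1) by (intro image_eqI[of _ _ "\<one>\<^bsub>R\<^esub>"]) auto
    then have "?U \<noteq> {\<zero>\<^bsub>E\<^esub>}" using u(2) by blast
    then have "?U \<inter> i ` carrier ?Q \<noteq> {\<zero>\<^bsub>E\<^esub>}" using ess[OF U] by blast
    moreover have "\<zero>\<^bsub>E\<^esub> \<in> ?U \<inter> i ` carrier ?Q"
    proof
      show "\<zero>\<^bsub>E\<^esub> \<in> ?U" using u(1) by (intro image_eqI[of _ _ "\<zero>\<^bsub>R\<^esub>"]) auto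
      have "\<zero>\<^bsub>E\<^esub> = i (\<mm> +>\<^bsub>R\<^esub> \<zero>\<^bsub>R\<^esub>)" using i_eq[OF R.zero_closed] e by simp
      then show "\<zero>\<^bsub>E\<^esub> \<in> i ` carrier ?Q" using sel(1) by auto
    qed
    ultimately obtain z where z: "z \<in> ?U" "z \<in> i ` carrier ?Q" "z \<noteq> \<zero>\<^bsub>E\<^esub>" by blast
    obtain r where r: "r \<in> carrier R" "z = r \<odot>\<^bsub>E\<^esub> u" using z(1) by blast
    obtain x where x: "x \<in> carrier R" "z = x \<odot>\<^bsub>E\<^esub> e" using z(2) sel(1) i_eq by auto
    have ur: "r \<in> Units R" using units r u(3) z(3) by blast
    have ux: "x \<in> Units R" using units x \<mm>e z(3) by blast
    have "u = (inv\<^bsub>R\<^esub> r \<otimes>\<^bsub>R\<^esub> r) \<odot>\<^bsub>E\<^esub> u" using ur u(1) by simp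
    also have "\<dots> = inv\<^bsub>R\<^esub> r \<odot>\<^bsub>E\<^esub> (r \<odot>\<^bsub>E\<^esub> u)" by (rule smult_assoc1) (use ur r(1) u(1) in auto)
    also have "\<dots> = inv\<^bsub>R\<^esub> r \<odot>\<^bsub>E\<^esub> (x \<odot>\<^bsub>E\<^esub> e)" using r(2) x(2) by simp
    also have "\<dots> = (inv\<^bsub>R\<^esub> r \<otimes>\<^bsub>R\<^esub> x) \<odot>\<^bsub>E\<^esub> e" using ur x(1) e by (simp add: smult_assoc1)
    finally have "u = (inv\<^bsub>R\<^esub> r \<otimes>\<^bsub>R\<^esub> x) \<odot>\<^bsub>E\<^esub> e" .
    then show ?thesis using ur ux by blast
  qed
  show ?thesis
  proof (cases "w = \<zero>\<^bsub>E\<^esub>")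
    case True
    then show ?thesis using v(1) by (intro bexI[of _ "\<zero>\<^bsub>R\<^esub>"]) auto
  next
    case False
    obtain a where a: "a \<in> Units R" "w = a \<odot>\<^bsub>E\<^esub> e" using multiple[OF w(1) False w(2)] by blast
    obtain b where b: "b \<in> Units R" "v = b \<odot>\<^bsub>E\<^esub> e" using multiple[OF v] by blast
    have c: "a \<in> carrier R" "b \<in> carrier R" "inv\<^bsub>R\<^esub> b \<in> carrier R" using a b by auto
    have "(a \<otimes>\<^bsub>R\<^esub> inv\<^bsub>R\<^esub> b) \<odot>\<^bsub>E\<^esub> v = ((a \<otimes>\<^bsub>R\<^esub> inv\<^bsub>R\<^esub> b) \<otimes>\<^bsub>R\<^esub> b) \<odot>\<^bsub>E\<^esub> e"
      unfolding b(2) using c e by (simp add: smult_assoc1)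
    also have "(a \<otimes>\<^bsub>R\<^esub> inv\<^bsub>R\<^esub> b) \<otimes>\<^bsub>R\<^esub> b = a" using b(1) c by (simp add: R.m_assoc)
    finally have "w = (a \<otimes>\<^bsub>R\<^esub> inv\<^bsub>R\<^esub> b) \<odot>\<^bsub>E\<^esub> v" using a(2) by simp
    then show ?thesis using c by blast
  qed
qed

section \<open>Restriction of scalars along a surjection\<close>

definition restrict_scalars ::
  "('t \<Rightarrow> 'a) \<Rightarrow> ('a, 'b, 'd) module_scheme \<Rightarrow> ('t, 'b) module" where
  "restrict_scalars h E =
     \<lparr>carrier = carrier E, monoid.mult = undefined, one = undefined, ring.zero = ring.zero E,
      add = ring.add E, smult = (\<lambda>t w. h t \<odot>\<^bsub>E\<^esub> w)\<rparr>"

lemma restrict_scalars_sel [simp]: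
  "carrier (restrict_scalars h E) = carrier E" "ring.add (restrict_scalars h E) = ring.add E"
  "ring.zero (restrict_scalars h E) = ring.zero E" "smult (restrict_scalars h E) = (\<lambda>t w. h t \<odot>\<^bsub>E\<^esub> w)"
  by (simp_all add: restrict_scalars_def)

lemma (in surjective_ring_hom) module_restrict_scalars:
  assumes "module R E"
  shows "module S (restrict_scalars h E)"
proof -
  interpret E: module R E by fact
  show ?thesis
  proof (rule moduleI)
    show "cring S" by (rule S.cring_axioms)
    show "abelian_group (restrict_scalars h E)"
    proof (rule abelian_groupI)
      show "\<exists>y\<in>carrier (restrict_scalars h E). y \<oplus>\<^bsub>restrict_scalars h E\<^esub> x = \<zero>\<^bsub>restrict_scalars h E\<^esub>"
        if "x \<in> carrier (restrict_scalars h E)" for x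
        using that E.M.l_neg by auto
    qed (auto simp: E.M.a_ac)
  qed (auto simp: h_closed h_add h_mult h_one E.smult_l_distr E.smult_r_distr E.smult_assoc1)
qed

text \<open>A map that vanishes on the kernel descends to the image ideal, where injectivity over
  \<open>R\<close> provides \<open>w\<close>.\<close>

lemma (in surjective_ring_hom) restrict_scalars_baer:
  assumes E: "injective_module R E" and I: "ideal I S" and ker: "{x \<in> carrier S. h x = \<zero>\<^bsub>R\<^esub>} \<subseteq> I"
    and fc: "\<And>r. r \<in> I \<Longrightarrow> f r \<in> carrier E"
    and fadd: "\<And>r s. r \<in> I \<Longrightarrow> s \<in> I \<Longrightarrow> f (r \<oplus> s) = f r \<oplus>\<^bsub>E\<^esub> f s"
    and fmult: "\<And>r s. r \<in> carrier S \<Longrightarrow> s \<in> I \<Longrightarrow> f (r \<otimes> s) = h r \<odot>\<^bsub>E\<^esub> f s"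
    and f0: "\<And>r. r \<in> carrier S \<Longrightarrow> h r = \<zero>\<^bsub>R\<^esub> \<Longrightarrow> f r = \<zero>\<^bsub>E\<^esub>"
  shows "\<exists>w\<in>carrier E. \<forall>r\<in>I. f r = h r \<odot>\<^bsub>E\<^esub> w"
proof -
  have "module R E" using E unfolding injective_module_def by blast
  then interpret E: module R E .
  note Ic = S.ideal_carr[OF I]
  have f_eq: "f x = f y" if xy: "x \<in> I" "y \<in> I" "h x = h y" for x y
  proof -
    have c: "x \<in> carrier S" "y \<in> carrier S" using xy Ic by auto
    have "h (x \<ominus> y) = \<zero>\<^bsub>R\<^esub>" using h_minus[OF c] xy(3) h_closed[OF c(2)] by (simp add: R.minus_eq R.r_neg)
    then have "f (x \<ominus> y) = \<zero>\<^bsub>E\<^esub>" using f0 c by simp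
    moreover have "x = x \<ominus> y \<oplus> y" using c by (simp add: S.minus_eq S.a_assoc S.l_neg)
    ultimately show ?thesis using fadd[OF S.ideal_minus[OF I xy(1,2)] xy(2)] fc[OF xy(2)] by simp
  qed
  define g where "g \<rho> = f (SOME x. x \<in> I \<and> h x = \<rho>)" for \<rho>
  have g: "g (h x) = f x" if x: "x \<in> I" for x
  proof -
    have "\<exists>y. y \<in> I \<and> h y = h x" using x by blast
    then have "(SOME y. y \<in> I \<and> h y = h x) \<in> I \<and> h (SOME y. y \<in> I \<and> h y = h x) = h x"
      by (rule someI_ex)
    then show ?thesis unfolding g_def using f_eq[OF _ x] by blast
  qed
  have "\<exists>w\<in>carrier E. \<forall>r\<in>h ` I. g r = r \<odot>\<^bsub>E\<^esub> w"
  proof (rule injective_module_baer[OF E image_ideal[OF I]])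
    show "g r \<in> carrier E" if "r \<in> h ` I" for r using that g fc by auto
    show "g (r \<oplus>\<^bsub>R\<^esub> s) = g r \<oplus>\<^bsub>E\<^esub> g s" if rs: "r \<in> h ` I" "s \<in> h ` I" for r s
    proof -
      obtain x y where x: "x \<in> I" "r = h x" and y: "y \<in> I" "s = h y" using rs by blast
      have "r \<oplus>\<^bsub>R\<^esub> s = h (x \<oplus> y)" using x y Ic h_add by simp
      then show ?thesis using g[OF S.ideal_add[OF I x(1) y(1)]] g[OF x(1)] g[OF y(1)] fadd[OF x(1) y(1)] x(2) y(2) by simp
    qed
    show "g (r \<otimes>\<^bsub>R\<^esub> s) = r \<odot>\<^bsub>E\<^esub> g s" if rs: "r \<in> carrier R" "s \<in> h ` I" for r s
    proof -
      obtain y where y: "y \<in> I" "s = h y" using rs by blast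
      obtain x where x: "x \<in> carrier S" "r = h x" using rs(1) unfolding surj[symmetric] by blast
      have "r \<otimes>\<^bsub>R\<^esub> s = h (x \<otimes> y)" using x y Ic h_mult by simp
      then show ?thesis using g[OF S.ideal_mult[OF I y(1) x(1)]] g[OF y(1)] fmult[OF x(1) y(1)] x(2) y(2) by simp
    qed
  qed
  then show ?thesis using g by auto
qed

section \<open>Regular local rings\<close>

text \<open>A nonunit lies in a proper principal ideal, hence in a maximal one, and there is only
  one.\<close>

lemma (in noetherian_cring) local_ring_units:
  assumes "local_ring R \<mm>" "x \<in> carrier R" "x \<notin> \<mm>"
  shows "x \<in> Units R"
proof (rule ccontr)
  assume x: "x \<notin> Units R"
  have I: "ideal (PIdl x) R" by (rule cgenideal_ideal[OF assms(2)])
  have "\<one> \<notin> PIdl x"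
  proof
    assume "\<one> \<in> PIdl x"
    then obtain y where "y \<in> carrier R" "y \<otimes> x = \<one>" unfolding cgenideal_def by auto
    then show False using x assms(2) m_comm[of y x] unfolding Units_def by auto
  qed
  let ?C = "{J. ideal J R \<and> PIdl x \<subseteq> J \<and> J \<noteq> carrier R}"
  have "PIdl x \<in> ?C" using I \<open>\<one> \<notin> PIdl x\<close> by auto
  then have ne: "?C \<noteq> {}" by blast
  obtain M where M: "M \<in> ?C" and Mmax: "\<And>K. K \<in> ?C \<Longrightarrow> M \<subseteq> K \<Longrightarrow> K = M"
    by (rule ideal_maximal_exists[OF ne]) auto
  have "maximalideal M R"
  proof (rule maximalidealI)
    show "J = M \<or> J = carrier R" if "ideal J R" "M \<subseteq> J" for J
      using Mmax[of J] M that by blast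
  qed (use M in auto)
  then have "M = \<mm>" using assms(1) unfolding local_ring_def by blast
  then show False using M cgenideal_self[OF assms(2)] assms(3) by blast
qed

text \<open>For positive \<open>n\<close> the supremum is reached and a longer chain may be cut off.
  For \<open>n = 0\<close> it could be the supremum of the empty set, and there \<open>Q\<close>
  provides the chain.\<close>

lemma krull_dim_chain:
  assumes "krull_dim R = enat n" "primeideal Q R"
  shows "\<exists>P :: nat \<Rightarrow> 'a set. (\<forall>i\<le>n. primeideal (P i) (R :: ('a, 'b) ring_scheme)) \<and> (\<forall>i<n. P i \<subset> P (Suc i))"
proof (cases "n = 0")
  case True
  then show ?thesis using assms(2) by (intro exI[of _ "\<lambda>_. Q"]) auto
next
  case False
  let ?ch = "\<lambda>n. \<exists>P :: nat \<Rightarrow> 'a set. (\<forall>i\<le>n. primeideal (P i) R) \<and> (\<forall>i<n. P i \<subset> P (Suc i))"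
  have "\<exists>k\<ge>n. ?ch k"
  proof (rule ccontr)
    assume *: "\<not> ?thesis"
    have "krull_dim R \<le> enat (n - 1)"
      unfolding krull_dim_def
    proof (rule Sup_least)
      fix x assume "x \<in> {enat n | n. ?ch n}"
      then obtain k where k: "x = enat k" "?ch k" by blast
      then have "\<not> n \<le> k" using * by blast
      then show "x \<le> enat (n - 1)" using k(1) by simp
    qed
    then show False using assms(1) False by simp
  qed
  then obtain k P where k: "n \<le> k" "\<forall>i\<le>k. primeideal (P i) R" "\<forall>i<k. P i \<subset> P (Suc i)" by blast
  then show ?thesis by (intro exI[of _ P]) auto
qed

lemma regular_local_ring_sequence:
  fixes R (structure)
  assumes T: "regular_local_ring R \<mm>" and n: "krull_dim R = enat n"
  shows "\<exists>ts. length ts = n \<and> set ts \<subseteq> \<mm> \<and> regular_sequence R {\<zero>\<^bsub>R\<^esub>} ts"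
proof -
  have loc: "local_ring R \<mm>" using T unfolding regular_local_ring_def by blast
  have cr: "cring R" and \<mm>: "maximalideal \<mm> R" using loc unfolding local_ring_def by auto
  interpret noetherian_cring R
    using cr T unfolding regular_local_ring_def by (intro noetherian_cring.intro) auto
  have \<mm>p: "primeideal \<mm> R" by (rule maximalideal_prime[OF \<mm>])
  have sat: "saturated R \<mm> I" if "ideal I R" for I
    by (rule saturated_of_units[OF local_ring_units[OF loc] that])
  obtain A where A: "finite A" "A \<subseteq> carrier R" "enat (card A) = krull_dim R" "Idl A = \<mm>"
    using T unfolding regular_local_ring_def by blast
  obtain ts where ts: "set ts = A" "distinct ts" using finite_distinct_list[OF A(1)] by blast
  have len: "length ts = n" using distinct_card[OF ts(2)] ts(1) A(3) n by simp
  obtain P :: "nat \<Rightarrow> 'a set" where P: "\<forall>i\<le>n. primeideal (P i) R" "\<forall>i<n. P i \<subset> P (Suc i)"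
    using krull_dim_chain[OF n \<mm>p] by blast
  have P\<mm>: "P i \<subseteq> \<mm>" if "i \<le> n" for i
  proof -
    have p: "primeideal (P i) R" using P(1) that by blast
    show ?thesis by (rule saturated_proper[OF sat[OF primeD(1)[OF p]] primeD(3)[OF p]])
  qed
  \<comment> \<open>All primes lie in \<open>\<mm>\<close>, so the top of the chain may be replaced
    by \<open>\<mm>\<close>, the ideal generated by the \<open>n\<close> elements, as
    \<open>regular_sequence_of_prime_chain\<close> demands.\<close>
  let ?P = "\<lambda>i. if i = n then \<mm> else P i"
  have Idl: "Idl ({\<zero>} \<union> A) = Idl A"
  proof
    have c: "{\<zero>} \<union> A \<subseteq> carrier R" using A(2) by auto
    show "Idl ({\<zero>} \<union> A) \<subseteq> Idl A"
      by (rule genideal_minimal[OF genideal_ideal[OF A(2)]])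
        (use genideal_self[OF A(2)] ideal_zero[OF genideal_ideal[OF A(2)]] in auto)
    show "Idl A \<subseteq> Idl ({\<zero>} \<union> A)"
      by (rule genideal_minimal[OF genideal_ideal[OF c]]) (use genideal_self[OF c] in auto)
  qed
  have "regular_sequence R {\<zero>} ts \<and> ?P 0 = {\<zero>}"
  proof (rule regular_sequence_of_prime_chain[OF zeroideal])
    show "set ts \<subseteq> carrier R" using ts A(2) by simp
    show "primeideal (?P i) R" if "i \<le> length ts" for i using that P(1) \<mm>p len by simp
    show "?P i \<subset> ?P (Suc i)" if "i < length ts" for i
    proof (cases "Suc i = n")
      case True
      then have "P i \<subset> P (Suc i)" using P(2) by blast
      then have "P i \<subset> \<mm>" using P\<mm>[of "Suc i"] True by auto
      then show ?thesis using True by simp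
    qed (use that P(2) len in simp)
    have "primeideal (?P 0) R" using P(1) \<mm>p by simp
    then show "{\<zero>} \<subseteq> ?P 0" using ideal_zero[OF primeD(1)] by blast
    show "?P (length ts) = Idl ({\<zero>} \<union> set ts)" using Idl len ts(1) A(4) by simp
    show "saturated R (?P (length ts)) I" if "ideal I R" for I using sat[OF that] len by simp
  qed
  moreover have "set ts \<subseteq> \<mm>" using genideal_self[OF A(2)] A(4) ts(1) by simp
  ultimately show ?thesis using len by blast
qed

lemma (in cring) pow_mem_mono:
  assumes "ideal I R" "x \<in> carrier R" "x [^] (k::nat) \<in> I" "k \<le> n"
  shows "x [^] n \<in> I"
proof -
  have "x [^] n = x [^] k \<otimes> x [^] (n - k)" using assms(2,4) by (simp add: nat_pow_mult)
  then show ?thesis using ideal_mult'[OF assms(1,3)] assms(2) by simp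
qed

lemma regular_sequence_in_parameter_ideal:
  fixes R (structure)
  assumes T: "regular_local_ring R \<mm>" and A: "system_of_parameters R \<mm> A"
  shows "\<exists>ss. length ss = card A \<and> set ss \<subseteq> genideal R A \<and> regular_sequence R {\<zero>\<^bsub>R\<^esub>} ss"
proof -
  have cr: "cring R" and \<mm>: "maximalideal \<mm> R"
    using T unfolding regular_local_ring_def local_ring_def by auto
  interpret cring R by (rule cr)
  have "krull_dim R = enat (card A)" using A unfolding system_of_parameters_def by simp
  then obtain ts where ts: "length ts = card A" "set ts \<subseteq> \<mm>" "regular_sequence R {\<zero>} ts"
    using regular_local_ring_sequence[OF T] by blast
  have \<mm>c: "\<mm> \<subseteq> carrier R" by (rule ideal_sub[OF primeD(1)[OF maximalideal_prime[OF \<mm>]]])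
  have d: "ideal (Idl A) R" and rad: "radical R (Idl A) = \<mm>"
    using A unfolding system_of_parameters_def primary_to_def primary_ideal_def by auto
  \<comment> \<open>The radical gives an exponent for each element; adding them gives a common one,
    as higher powers stay in the ideal.\<close>
  have "\<exists>k. \<forall>t\<in>set us. t [^] (k::nat) \<in> Idl A" if "set us \<subseteq> \<mm>" for us
    using that
  proof (induction us)
    case (Cons u us)
    then obtain k where k: "\<forall>t\<in>set us. t [^] (k::nat) \<in> Idl A" by auto
    obtain j where j: "u [^] (j::nat) \<in> Idl A" using Cons.prems rad unfolding radical_def by auto
    have uc: "u \<in> carrier R" "t \<in> set us \<Longrightarrow> t \<in> carrier R" for t using Cons.prems \<mm>c by auto
    have "t [^] (k + j) \<in> Idl A" if t: "t \<in> set (u # us)" for t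
    proof (cases "t = u")
      case True
      then show ?thesis using pow_mem_mono[OF d uc(1) j, of "k + j"] by simp
    next
      case False
      then have t': "t \<in> set us" using t by simp
      then show ?thesis using pow_mem_mono[OF d uc(2)[OF t'], of k "k + j"] k by simp
    qed
    then show ?case by blast
  qed simp
  then obtain k where k: "\<forall>t\<in>set ts. t [^] (k::nat) \<in> Idl A" using ts(2) by blast
  have "regular_sequence R {\<zero>} (map (\<lambda>t. t [^] k) ts)"
    by (rule regular_sequence_pow[OF zeroideal _ ts(3)]) (use ts(2) \<mm>c in blast)
  then show ?thesis using ts(1) k by (intro exI[of _ "map (\<lambda>t. t [^] k) ts"]) auto
qed

lemma (in cring) ring_iso_quotient_hom:
  assumes I: "ideal I R" and S: "cring S" and \<rho>: "\<rho> \<in> ring_iso (R Quot I) S"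
  shows "surjective_ring_hom R S (\<lambda>x. \<rho> (I +> x))"
    and "x \<in> carrier R \<Longrightarrow> \<rho> (I +> x) = \<zero>\<^bsub>S\<^esub> \<longleftrightarrow> x \<in> I"
proof -
  interpret Q: cring "R Quot I" by (rule ideal.quotient_is_cring[OF I cring_axioms])
  interpret S: cring S by (rule S)
  have \<rho>h: "\<rho> \<in> ring_hom (R Quot I) S" and bij: "bij_betw \<rho> (carrier (R Quot I)) (carrier S)"
    using \<rho> unfolding ring_iso_def by auto
  have carr: "carrier (R Quot I) = (\<lambda>x. I +> x) ` carrier R" by (auto simp: FactRing_def A_RCOSETS_def')
  have hom: "(\<lambda>x. \<rho> (I +> x)) \<in> ring_hom R S"
    using ring_hom_trans[OF ideal.rcos_ring_hom[OF I] \<rho>h] by (simp add: comp_def)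
  show "surjective_ring_hom R S (\<lambda>x. \<rho> (I +> x))"
    by (intro surjective_ring_hom.intro surjective_ring_hom_axioms.intro cring_axioms S hom)
      (use bij carr in \<open>auto simp: bij_betw_def image_image\<close>)
  have zero: "\<rho> I = \<zero>\<^bsub>S\<^esub>"
    using ring_hom_zero[OF \<rho>h Q.ring_axioms S.ring_axioms] by (simp add: FactRing_def)
  have I0: "I = I +> \<zero>" using a_rcos_zero[OF I ideal_zero[OF I]] by simp
  show "\<rho> (I +> x) = \<zero>\<^bsub>S\<^esub> \<longleftrightarrow> x \<in> I" if x: "x \<in> carrier R" for x
  proof
    assume "\<rho> (I +> x) = \<zero>\<^bsub>S\<^esub>"
    then have "\<rho> (I +> x) = \<rho> (I +> \<zero>)" using zero I0 by simp
    then have "I +> x = I +> \<zero>"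
      by (rule inj_onD[OF bij_betw_imp_inj_on[OF bij]]) (use carr x in auto)
    then have "x \<ominus> \<zero> \<in> I" using quotient_eq_iff_same_a_r_cos[OF I x zero_closed] by simp
    then show "x \<in> I" using x by (simp add: minus_eq)
  next
    assume "x \<in> I"
    then show "\<rho> (I +> x) = \<zero>\<^bsub>S\<^esub>" using a_rcos_zero[OF I] zero by simp
  qed
qed

theorem theorem5p1:
  fixes R :: "'r ring" and \<mm> :: "'r set" and \<omega> :: "('r, 'w) module"
    and T :: "'t ring" and \<mm>\<^sub>T \<aa> \<bb> \<dd> :: "'t set"
    and \<rho> :: "'t set \<Rightarrow> 'r" and bar :: "'t \<Rightarrow> 'r"
  assumes R: "artinian_local_ring R \<mm>"
    and \<omega>: "canonical_module R \<mm> \<omega>"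
    and T: "regular_local_ring T \<mm>\<^sub>T"
    and \<bb>: "primary_to T \<mm>\<^sub>T \<bb>"
    and \<rho>: "\<rho> \<in> ring_iso (T Quot \<bb>) R"
    and bar: "bar = (\<lambda>x. \<rho> (\<bb> +>\<^bsub>T\<^esub> x))"
    and \<aa>: "ideal \<aa> T" "\<aa> \<noteq> carrier T"
    and \<dd>: "\<exists>A. system_of_parameters T \<mm>\<^sub>T A \<and> \<dd> = genideal T A" "\<dd> \<subseteq> \<aa>"
    and a: "\<exists>\<phi> \<in> mod_hom R (ideal_module R (bar ` \<dd>))
                   (hom_module R (ideal_module R (bar ` \<aa>)) \<omega>).
              inj_on \<phi> (bar ` \<dd>) \<and>
              (\<forall>x\<in>\<dd>. \<forall>y\<in>\<dd>. \<phi> (bar x) (bar y) = \<phi> (bar y) (bar x))"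
    and b: "\<bb> \<subseteq> ideal_prod T \<aa> \<dd>"
    and c: "colon_ideal T \<bb> \<aa> \<subseteq> \<dd>"
  shows "(\<exists>S :: 'r list ring. gorenstein_artin_local_ring S \<and> maps_onto S R \<and>
            ring_length S - ring_length R =
              module_length R (quotient_module (ring_module R) (bar ` \<aa>))) \<and>
         gorenstein_colength R \<le>
           module_length R (quotient_module (ring_module R) (bar ` \<aa>))"
proof -

  \<comment> \<open>The presentation of \<open>R\<close> by \<open>T\<close> and
    \<open>\<bb>\<close>\<close>
  have loc: "local_ring T \<mm>\<^sub>T" using T unfolding regular_local_ring_def by blast
  have T_cring: "cring T" and \<mm>\<^sub>T: "maximalideal \<mm>\<^sub>T T" using loc unfolding local_ring_def by auto
  interpret T: noetherian_cring T
    using T_cring T unfolding regular_local_ring_def by (intro noetherian_cring.intro) auto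
  note \<mm>p = T.maximalideal_prime[OF \<mm>\<^sub>T]
  note \<mm>i = T.primeD(1)[OF \<mm>p]
  have R_loc: "local_ring R \<mm>" using R unfolding artinian_local_ring_def by blast
  have R_cring: "cring R" using R_loc unfolding local_ring_def by blast
  have \<bb>i: "ideal \<bb> T" and \<bb>_rad: "radical T \<bb> = \<mm>\<^sub>T"
    using \<bb> unfolding primary_to_def primary_ideal_def by auto
  interpret bar: surjective_ring_hom T R bar
    unfolding bar by (rule T.ring_iso_quotient_hom(1)[OF \<bb>i R_cring \<rho>])
  have bar_zero: "bar x = \<zero>\<^bsub>R\<^esub> \<longleftrightarrow> x \<in> \<bb>" if "x \<in> carrier T" for x
    unfolding bar by (rule T.ring_iso_quotient_hom(2)[OF \<bb>i R_cring \<rho> that])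
  have ker: "{x \<in> carrier T. bar x = \<zero>\<^bsub>R\<^esub>} = \<bb>"
    using bar_zero T.ideal_carr[OF \<bb>i] by auto
  obtain A where A: "system_of_parameters T \<mm>\<^sub>T A" "\<dd> = genideal T A" using \<dd>(1) by blast
  have A_fin: "finite A" "A \<subseteq> carrier T"
    using A(1) T.ideal_sub[OF \<mm>i] unfolding system_of_parameters_def by auto
  obtain xs where xs: "set xs = A" "distinct xs" using finite_distinct_list[OF A_fin(1)] by blast
  have len: "length xs = card A" using distinct_card[OF xs(2)] xs(1) by simp
  have \<dd>i: "ideal \<dd> T" unfolding A(2) by (rule T.genideal_ideal[OF A_fin(2)])
  have \<dd>_xs: "\<dd> = genideal T (set xs)" using A(2) xs(1) by simp
  have T_units: "x \<in> Units T" if "x \<in> carrier T" "x \<notin> \<mm>\<^sub>T" for x by (rule T.local_ring_units[OF loc that])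
  have \<aa>\<mm>: "\<aa> \<subseteq> \<mm>\<^sub>T" by (rule T.saturated_proper[OF T.saturated_of_units[OF T_units \<aa>(1)] \<aa>(2)])
  have "ideal_prod T \<aa> \<dd> \<subseteq> \<dd>"
  proof
    fix x assume "x \<in> ideal_prod T \<aa> \<dd>"
    then show "x \<in> \<dd>"
      by (induction rule: ideal_prod.induct)
        (use T.ideal_mult[OF \<dd>i] T.ideal_add[OF \<dd>i] T.ideal_carr[OF \<aa>(1)] in auto)
  qed
  then have \<bb>\<dd>: "\<bb> \<subseteq> \<dd>" using b by blast
  have \<bb>\<aa>: "\<bb> \<subseteq> \<aa>" using \<bb>\<dd> \<dd>(2) by blast
  have nil: "\<exists>k::nat. q [^]\<^bsub>T\<^esub> k \<in> \<bb>" if "q \<in> \<mm>\<^sub>T" for q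
    using that \<bb>_rad unfolding radical_def by blast
  have "{x \<in> carrier T. bar x = \<zero>\<^bsub>R\<^esub>} \<subseteq> \<mm>\<^sub>T"
    unfolding ker using \<bb>\<aa> \<aa>\<mm> by (rule order_trans)
  then have "maximalideal (bar ` \<mm>\<^sub>T) R" by (rule bar.image_maximal[OF \<mm>\<^sub>T])
  then have \<mm>_eq: "\<mm> = bar ` \<mm>\<^sub>T" using R_loc unfolding local_ring_def by simp
  have R_units: "x \<in> Units R" if "x \<in> carrier R" "x \<notin> \<mm>" for x
    using bar.image_Units[OF T_units that(1)] that(2) \<mm>_eq by simp
  have \<mm>R: "primeideal \<mm> R"
    using cring.maximalideal_prime[OF R_cring] R_loc unfolding local_ring_def by blast
  have inj: "injective_module R \<omega>" using \<omega> unfolding canonical_module_def injective_hull_def by blast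
  have \<omega>_mod: "module R \<omega>" using inj unfolding injective_module_def by blast
  interpret \<omega>: module R \<omega> by (rule \<omega>_mod)

  \<comment> \<open>The pairing of \<open>\<dd>\<close> and \<open>\<aa>\<close> over
    \<open>T\<close>\<close>
  let ?E = "restrict_scalars bar \<omega>"
  obtain \<phi> where \<phi>: "\<phi> \<in> mod_hom R (ideal_module R (bar ` \<dd>)) (hom_module R (ideal_module R (bar ` \<aa>)) \<omega>)"
    "inj_on \<phi> (bar ` \<dd>)" "\<And>x y. x \<in> \<dd> \<Longrightarrow> y \<in> \<dd> \<Longrightarrow> \<phi> (bar x) (bar y) = \<phi> (bar y) (bar x)"
    using a by blast
  define B where "B x y = \<phi> (bar x) (bar y)" for x y
  have \<phi>_hom: "\<phi> (bar x) \<in> mod_hom R (ideal_module R (bar ` \<aa>)) \<omega>" if "x \<in> \<dd>" for x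
    using mod_homD(1)[OF \<phi>(1), of "bar x"] that by (simp add: hom_module_def)
  have dc: "x \<in> carrier T" if "x \<in> \<dd>" for x using T.ideal_carr[OF \<dd>i that] .
  have ac: "x \<in> carrier T" if "x \<in> \<aa>" for x using T.ideal_carr[OF \<aa>(1) that] .
  have B_closed: "B x y \<in> carrier \<omega>" if "x \<in> \<dd>" "y \<in> \<aa>" for x y
    using mod_homD(1)[OF \<phi>_hom[OF that(1)], of "bar y"] that(2) unfolding B_def by simp
  have B_add_right: "B x (y \<oplus>\<^bsub>T\<^esub> y') = B x y \<oplus>\<^bsub>\<omega>\<^esub> B x y'" if "x \<in> \<dd>" "y \<in> \<aa>" "y' \<in> \<aa>" for x y y'
    using mod_homD(3)[OF \<phi>_hom[OF that(1)], of "bar y" "bar y'"] that bar.h_add ac unfolding B_def by simp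
  have B_smult_right: "B x (r \<otimes>\<^bsub>T\<^esub> y) = bar r \<odot>\<^bsub>\<omega>\<^esub> B x y" if "r \<in> carrier T" "x \<in> \<dd>" "y \<in> \<aa>" for r x y
    using mod_homD(4)[OF \<phi>_hom[OF that(2)], of "bar r" "bar y"] that bar.h_mult bar.h_closed ac unfolding B_def by simp
  have B_add_left: "B (x \<oplus>\<^bsub>T\<^esub> x') y = B x y \<oplus>\<^bsub>\<omega>\<^esub> B x' y" if "x \<in> \<dd>" "x' \<in> \<dd>" "y \<in> \<aa>" for x x' y
    using mod_homD(3)[OF \<phi>(1), of "bar x" "bar x'"] that bar.h_add dc unfolding B_def by (simp add: hom_module_def)
  have B_smult_left: "B (r \<otimes>\<^bsub>T\<^esub> x) y = bar r \<odot>\<^bsub>\<omega>\<^esub> B x y" if "r \<in> carrier T" "x \<in> \<dd>" "y \<in> \<aa>" for r x y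
    using mod_homD(4)[OF \<phi>(1), of "bar r" "bar x"] that bar.h_mult bar.h_closed dc unfolding B_def by (simp add: hom_module_def)
  have zero_\<dd>: "\<zero>\<^bsub>T\<^esub> \<in> \<dd>" by (rule T.ideal_zero[OF \<dd>i])
  have B_zero: "B \<zero>\<^bsub>T\<^esub> y = \<zero>\<^bsub>\<omega>\<^esub>" if y: "y \<in> \<aa>" for y
    using B_smult_left[OF T.zero_closed zero_\<dd> y] B_closed[OF zero_\<dd> y] bar.h_zero by simp
  have B_\<bb>: "B x y = \<zero>\<^bsub>\<omega>\<^esub>" if "x \<in> \<bb>" "y \<in> \<aa>" for x y
    using bar_zero[OF T.ideal_carr[OF \<bb>i that(1)]] that(1) bar.h_zero B_zero[OF that(2)] unfolding B_def by simp
  have B_nondeg: "x \<in> \<bb>" if x: "x \<in> \<dd>" "\<And>y. y \<in> \<aa> \<Longrightarrow> B x y = \<zero>\<^bsub>\<omega>\<^esub>" for x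
  proof -
    \<comment> \<open>Homomorphisms are extensional, so vanishing on the image of
      \<open>\<aa>\<close> already means equality with the zero map.\<close>
    have "\<phi> (bar x) = \<phi> (bar \<zero>\<^bsub>T\<^esub>)"
    proof (rule extensionalityI)
      show "\<phi> (bar x) \<in> extensional (bar ` \<aa>)" using mod_homD(2)[OF \<phi>_hom[OF x(1)]] by simp
      show "\<phi> (bar \<zero>\<^bsub>T\<^esub>) \<in> extensional (bar ` \<aa>)" using mod_homD(2)[OF \<phi>_hom[OF zero_\<dd>]] by simp
      show "\<phi> (bar x) z = \<phi> (bar \<zero>\<^bsub>T\<^esub>) z" if "z \<in> bar ` \<aa>" for z
        using that x(2) B_zero unfolding B_def by auto
    qed
    then have "bar x = bar \<zero>\<^bsub>T\<^esub>" by (rule inj_onD[OF \<phi>(2)]) (use x(1) zero_\<dd> in auto)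
    then show ?thesis using bar_zero[OF dc[OF x(1)]] bar.h_zero by simp
  qed
  obtain ss where ss: "length ss = card A" "set ss \<subseteq> genideal T A" "regular_sequence T {\<zero>\<^bsub>T\<^esub>} ss"
    using regular_sequence_in_parameter_ideal[OF T A(1)] by blast
  interpret G: gorenstein_construction T ?E \<mm>\<^sub>T \<aa> \<bb> B xs ss
  proof (rule gorenstein_construction.intro[OF T.noetherian_cring_axioms bar.module_restrict_scalars[OF \<omega>_mod]],
      rule gorenstein_construction_axioms.intro, unfold \<dd>_xs[symmetric])
    show "r \<odot>\<^bsub>?E\<^esub> w = \<zero>\<^bsub>?E\<^esub>" if "r \<in> \<bb>" "w \<in> carrier ?E" for r w
      using that bar_zero[OF T.ideal_carr[OF \<bb>i that(1)]] by simp
    show "\<exists>w\<in>carrier ?E. \<forall>r\<in>I. f r = r \<odot>\<^bsub>?E\<^esub> w"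
      if "ideal I T" "\<bb> \<subseteq> I" "\<And>r. r \<in> I \<Longrightarrow> f r \<in> carrier ?E"
        "\<And>r s. r \<in> I \<Longrightarrow> s \<in> I \<Longrightarrow> f (r \<oplus>\<^bsub>T\<^esub> s) = f r \<oplus>\<^bsub>?E\<^esub> f s"
        "\<And>r s. r \<in> carrier T \<Longrightarrow> s \<in> I \<Longrightarrow> f (r \<otimes>\<^bsub>T\<^esub> s) = r \<odot>\<^bsub>?E\<^esub> f s"
        "\<And>r. r \<in> \<bb> \<Longrightarrow> f r = \<zero>\<^bsub>?E\<^esub>" for I f
      using bar.restrict_scalars_baer[OF inj that(1), of f] that(2-) ker bar_zero by simp
    show "\<exists>r\<in>carrier T. w = r \<odot>\<^bsub>?E\<^esub> v"
      if v: "v \<in> carrier ?E" "w \<in> carrier ?E" "v \<noteq> \<zero>\<^bsub>?E\<^esub>"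
        "\<And>p. p \<in> \<mm>\<^sub>T \<Longrightarrow> p \<odot>\<^bsub>?E\<^esub> v = \<zero>\<^bsub>?E\<^esub>" "\<And>p. p \<in> \<mm>\<^sub>T \<Longrightarrow> p \<odot>\<^bsub>?E\<^esub> w = \<zero>\<^bsub>?E\<^esub>" for v w
    proof -
      have "\<exists>r\<in>carrier R. w = r \<odot>\<^bsub>\<omega>\<^esub> v"
        by (rule canonical_module_socle[OF \<omega> \<mm>R R_units]) (use v \<mm>_eq in auto)
      then obtain r where r: "r \<in> carrier R" "w = r \<odot>\<^bsub>\<omega>\<^esub> v" by blast
      obtain t where "t \<in> carrier T" "r = bar t" using r(1) unfolding bar.surj[symmetric] by blast
      then show ?thesis using r(2) by auto
    qed
    show "B x y = B y x" if "x \<in> \<dd>" "y \<in> \<dd>" for x y using \<phi>(3)[OF that] unfolding B_def .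
    show "set ss \<subseteq> \<dd>" using ss(2) A(2) by simp
  qed (use \<mm>p \<aa>(1) \<bb>i nil A_fin(2) xs(1) \<bb>\<dd> \<dd>(2) \<aa>\<mm> c ss(1,3) len
      B_closed B_add_left B_smult_left B_add_right B_smult_right B_\<bb> B_nondeg in simp_all)

  \<comment> \<open>The Gorenstein ring \<open>S\<close>\<close>
  obtain \<cc> s where \<cc>: "ideal \<cc> T" "\<cc> \<subseteq> \<bb>"
    "\<And>r. r \<in> carrier T \<Longrightarrow> (\<forall>y\<in>\<aa>. r \<otimes>\<^bsub>T\<^esub> y \<in> \<cc>) \<longleftrightarrow> r \<in> \<bb>"
    "\<And>q. q \<in> \<mm>\<^sub>T \<Longrightarrow> \<exists>k::nat. q [^]\<^bsub>T\<^esub> k \<in> \<cc>"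
    and s: "s \<in> carrier T" "s \<notin> \<cc>" "\<And>p. p \<in> \<mm>\<^sub>T \<Longrightarrow> p \<otimes>\<^bsub>T\<^esub> s \<in> \<cc>"
    "\<And>x. x \<in> carrier T \<Longrightarrow> (\<And>p. p \<in> \<mm>\<^sub>T \<Longrightarrow> p \<otimes>\<^bsub>T\<^esub> x \<in> \<cc>) \<Longrightarrow>
      \<exists>r\<in>carrier T. x \<ominus>\<^bsub>T\<^esub> r \<otimes>\<^bsub>T\<^esub> s \<in> \<cc>"
    using G.simple_socle_ideal by blast
  \<comment> \<open>Elements of \<open>R\<close> serve as names of residue classes: \<open>t\<close>
    and the chosen lift of \<open>bar t\<close> differ by an element of \<open>\<bb>\<close>, hence
    of the maximal ideal. This puts \<open>S\<close> on the type \<open>'r list\<close>.\<close>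
  define \<sigma> where "\<sigma> r = (SOME t. t \<in> carrier T \<and> bar t = r)" for r
  have \<sigma>: "\<exists>r. \<sigma> r \<in> carrier T \<and> t \<ominus>\<^bsub>T\<^esub> \<sigma> r \<in> \<mm>\<^sub>T" if t: "t \<in> carrier T" for t
  proof -
    have "\<exists>t'. t' \<in> carrier T \<and> bar t' = bar t" using t by blast
    then have "\<sigma> (bar t) \<in> carrier T \<and> bar (\<sigma> (bar t)) = bar t"
      unfolding \<sigma>_def by (rule someI_ex)
    then have \<sigma>t: "\<sigma> (bar t) \<in> carrier T" "bar (\<sigma> (bar t)) = bar t" by auto
    then have "bar (t \<ominus>\<^bsub>T\<^esub> \<sigma> (bar t)) = \<zero>\<^bsub>R\<^esub>"
      using bar.h_minus[OF t \<sigma>t(1)] bar.h_closed[OF t] by (simp add: bar.R.minus_eq bar.R.r_neg)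
    then show ?thesis using bar_zero[of "t \<ominus>\<^bsub>T\<^esub> \<sigma> (bar t)"] \<sigma>t(1) t \<bb>\<aa> \<aa>\<mm> by auto
  qed
  obtain f :: "'t \<Rightarrow> 'r list" where f: "weak_ring_morphism f \<cc> T"
    using T.weak_ring_morphism_list[OF \<mm>p \<cc>(1,4) \<sigma>] by blast
  let ?S = "image_ring f T"
  interpret f: surjective_ring_hom T ?S f by (rule T.image_ring_surjective[OF f])
  have f_zero: "f x = \<zero>\<^bsub>?S\<^esub> \<longleftrightarrow> x \<in> \<cc>" if "x \<in> carrier T" for x
    by (rule T.weak_ring_morphism_zero_iff[OF f that])
  have mc: "p \<in> carrier T" if "p \<in> \<mm>\<^sub>T" for p using T.ideal_carr[OF \<mm>i that] .
  interpret Z: zero_dimensional_simple_socle ?S "f ` \<mm>\<^sub>T" "f s"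
  proof (rule f.image_zero_dimensional_simple_socle[OF T.noetherian_ring_axioms \<mm>\<^sub>T T_units])
    show "\<exists>k::nat. f (q [^]\<^bsub>T\<^esub> k) = \<zero>\<^bsub>?S\<^esub>" if "q \<in> \<mm>\<^sub>T" for q using \<cc>(4)[OF that] f_zero mc[OF that] by auto
    show "{x \<in> carrier T. f x = \<zero>\<^bsub>?S\<^esub>} \<subseteq> \<mm>\<^sub>T" using f_zero \<cc>(2) \<bb>\<aa> \<aa>\<mm> by auto
    show "s \<in> carrier T" "f s \<noteq> \<zero>\<^bsub>?S\<^esub>" using s f_zero by auto
    show "f (p \<otimes>\<^bsub>T\<^esub> s) = \<zero>\<^bsub>?S\<^esub>" if "p \<in> \<mm>\<^sub>T" for p using s(1) s(3)[OF that] f_zero mc[OF that] by simp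
    show "\<exists>r\<in>carrier T. f (x \<ominus>\<^bsub>T\<^esub> r \<otimes>\<^bsub>T\<^esub> s) = \<zero>\<^bsub>?S\<^esub>"
      if x: "x \<in> carrier T" "\<And>p. p \<in> \<mm>\<^sub>T \<Longrightarrow> f (p \<otimes>\<^bsub>T\<^esub> x) = \<zero>\<^bsub>?S\<^esub>" for x
    proof -
      have "\<exists>r\<in>carrier T. x \<ominus>\<^bsub>T\<^esub> r \<otimes>\<^bsub>T\<^esub> s \<in> \<cc>"
        by (rule s(4)[OF x(1)]) (use x f_zero mc in auto)
      then show ?thesis using f_zero x(1) s(1) by auto
    qed
  qed

  \<comment> \<open>The surjection from \<open>S\<close> onto \<open>R\<close>\<close>
  define h where "h y = bar (SOME x. x \<in> carrier T \<and> f x = y)" for y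
  have h: "h (f x) = bar x" if x: "x \<in> carrier T" for x
  proof -
    have "\<exists>z. z \<in> carrier T \<and> f z = f x" using x by blast
    then have z: "(SOME z. z \<in> carrier T \<and> f z = f x) \<in> carrier T \<and> f (SOME z. z \<in> carrier T \<and> f z = f x) = f x"
      by (rule someI_ex)
    obtain z where z: "z = (SOME z. z \<in> carrier T \<and> f z = f x)" "z \<in> carrier T" "f z = f x" using z by blast
    have "f (z \<ominus>\<^bsub>T\<^esub> x) = \<zero>\<^bsub>?S\<^esub>"
      using f.h_minus[OF z(2) x] z(3) f.h_closed[OF x] by (simp add: f.R.minus_eq f.R.r_neg)
    \<comment> \<open>Here \<open>\<cc> \<subseteq> \<bb>\<close> makes \<open>bar\<close> factor
      through \<open>f\<close>.\<close>
    then have "z \<ominus>\<^bsub>T\<^esub> x \<in> \<bb>" using f_zero z(2) x \<cc>(2) by auto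
    then have "bar z \<ominus>\<^bsub>R\<^esub> bar x = \<zero>\<^bsub>R\<^esub>"
      using bar_zero[of "z \<ominus>\<^bsub>T\<^esub> x"] bar.h_minus[OF z(2) x] z(2) x by simp
    then have "bar z = bar x" by (rule bar.R.diff_zeroD[OF bar.h_closed[OF z(2)] bar.h_closed[OF x]])
    then show ?thesis unfolding h_def z(1) .
  qed
  have Sx: "\<exists>x\<in>carrier T. y = f x" if "y \<in> carrier ?S" for y using that unfolding f.surj[symmetric] by blast
  have h_hom: "h \<in> ring_hom ?S R"
  proof (rule ring_hom_memI)
    show "h y \<in> carrier R" if "y \<in> carrier ?S" for y using Sx[OF that] h bar.h_closed by auto
    show "h (y \<otimes>\<^bsub>?S\<^esub> z) = h y \<otimes>\<^bsub>R\<^esub> h z" if "y \<in> carrier ?S" "z \<in> carrier ?S" for y z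
      using Sx[OF that(1)] Sx[OF that(2)] h bar.h_mult f.h_mult by (metis T.m_closed)
    show "h (y \<oplus>\<^bsub>?S\<^esub> z) = h y \<oplus>\<^bsub>R\<^esub> h z" if "y \<in> carrier ?S" "z \<in> carrier ?S" for y z
      using Sx[OF that(1)] Sx[OF that(2)] h bar.h_add f.h_add by (metis T.a_closed)
    show "h \<one>\<^bsub>?S\<^esub> = \<one>\<^bsub>R\<^esub>" using h[OF T.one_closed] f.h_one bar.h_one by simp
  qed
  have h_surj: "h ` carrier ?S = carrier R"
    unfolding f.surj[symmetric] bar.surj[symmetric] using h by (force simp: image_image)
  interpret h: surjective_ring_hom ?S R h
    by (intro surjective_ring_hom.intro surjective_ring_hom_axioms.intro f.R.cring_axioms R_cring h_hom h_surj)
  have R_sat: "saturated R \<mm> I" if "ideal I R" for I by (rule bar.R.saturated_of_units[OF R_units that])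

  \<comment> \<open>Comparison of lengths\<close>
  let ?\<alpha> = "{y \<in> carrier ?S. h y \<in> bar ` \<aa>}" and ?\<beta> = "{y \<in> carrier ?S. h y \<in> {\<zero>\<^bsub>R\<^esub>}}"
  have bar\<aa>: "ideal (bar ` \<aa>) R" by (rule bar.image_ideal[OF \<aa>(1)])
  have \<alpha>: "ideal ?\<alpha> ?S" and \<beta>: "ideal ?\<beta> ?S"
    by (rule h.vimage_ideal[OF bar\<aa>], rule h.vimage_ideal[OF bar.R.zeroideal])
  have \<alpha>_iff: "f x \<in> ?\<alpha> \<longleftrightarrow> x \<in> \<aa>" if x: "x \<in> carrier T" for x
    using h[OF x] f.h_closed[OF x] bar.image_mem[OF \<aa>(1) _ x] ker \<bb>\<aa> by simp
  \<comment> \<open>The equality of \<open>\<bb>\<close> with the colon ideal of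
    \<open>\<cc>\<close> by \<open>\<aa>\<close>, read in \<open>S\<close>: the kernel of the map
    onto \<open>R\<close> is the annihilator of the image of \<open>\<aa>\<close>.\<close>
  have ann: "Z.ann ?\<alpha> = ?\<beta>"
  proof (rule Set.set_eqI)
    fix y
    show "y \<in> Z.ann ?\<alpha> \<longleftrightarrow> y \<in> ?\<beta>"
    proof (cases "y \<in> carrier ?S")
      case True
      then obtain x where x: "x \<in> carrier T" "y = f x" using Sx by blast
      have "y \<in> Z.ann ?\<alpha> \<longleftrightarrow> (\<forall>z\<in>\<aa>. f x \<otimes>\<^bsub>?S\<^esub> f z = \<zero>\<^bsub>?S\<^esub>)"
      proof -
        have "(\<forall>u\<in>?\<alpha>. f x \<otimes>\<^bsub>?S\<^esub> u = \<zero>\<^bsub>?S\<^esub>) \<longleftrightarrow> (\<forall>z\<in>\<aa>. f x \<otimes>\<^bsub>?S\<^esub> f z = \<zero>\<^bsub>?S\<^esub>)"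
        proof
          assume L: "\<forall>u\<in>?\<alpha>. f x \<otimes>\<^bsub>?S\<^esub> u = \<zero>\<^bsub>?S\<^esub>"
          show "\<forall>z\<in>\<aa>. f x \<otimes>\<^bsub>?S\<^esub> f z = \<zero>\<^bsub>?S\<^esub>" using L \<alpha>_iff ac by blast
        next
          assume L: "\<forall>z\<in>\<aa>. f x \<otimes>\<^bsub>?S\<^esub> f z = \<zero>\<^bsub>?S\<^esub>"
          show "\<forall>u\<in>?\<alpha>. f x \<otimes>\<^bsub>?S\<^esub> u = \<zero>\<^bsub>?S\<^esub>"
          proof
            fix u assume u: "u \<in> ?\<alpha>"
            then obtain z where "z \<in> carrier T" "u = f z" using Sx by blast
            then show "f x \<otimes>\<^bsub>?S\<^esub> u = \<zero>\<^bsub>?S\<^esub>" using L u \<alpha>_iff by blast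
          qed
        qed
        then show ?thesis using True x(2) by (simp only: Z.mem_ann simp_thms)
      qed
      also have "\<dots> \<longleftrightarrow> (\<forall>z\<in>\<aa>. x \<otimes>\<^bsub>T\<^esub> z \<in> \<cc>)"
      proof (rule ball_cong[OF refl])
        fix z assume "z \<in> \<aa>"
        then have z: "z \<in> carrier T" by (rule ac)
        show "f x \<otimes>\<^bsub>?S\<^esub> f z = \<zero>\<^bsub>?S\<^esub> \<longleftrightarrow> x \<otimes>\<^bsub>T\<^esub> z \<in> \<cc>"
          using f.h_mult[OF x(1) z] f_zero[OF T.m_closed[OF x(1) z]] by simp
      qed
      also have "\<dots> \<longleftrightarrow> x \<in> \<bb>" by (rule \<cc>(3)[OF x(1)])
      also have "\<dots> \<longleftrightarrow> y \<in> ?\<beta>" using bar_zero[OF x(1)] h[OF x(1)] x(2) True by simp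
      finally show ?thesis .
    next
      case False
      then show ?thesis using Z.mem_ann by blast
    qed
  qed
  \<comment> \<open>Both lengths over \<open>R\<close> are pulled back to \<open>S\<close>, where
    \<open>ann_length_eq\<close> identifies the length of the kernel with the colength of
    \<open>?\<alpha>\<close>.\<close>
  have len_R: "ring_length R = Z.len ?\<beta> (carrier ?S)"
    using bar.R.module_length_ring_module[OF R_sat] h.saturated_length_vimage[OF bar.R.zeroideal Z.sat R_sat] by simp
  have len_Ra: "module_length R (quotient_module (ring_module R) (bar ` \<aa>)) = Z.len ?\<alpha> (carrier ?S)"
    using bar.R.module_length_quotient_module[OF bar\<aa> R_sat] h.saturated_length_vimage[OF bar\<aa> Z.sat R_sat] by simp
  have "ring_length ?S = Z.len {\<zero>\<^bsub>?S\<^esub>} (carrier ?S)"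
    by (rule f.R.module_length_ring_module) (rule Z.sat)
  also have "\<dots> = Z.len {\<zero>\<^bsub>?S\<^esub>} ?\<beta> + Z.len ?\<beta> (carrier ?S)"
    by (rule Z.len_add[OF \<beta> f.R.oneideal]) (use f.R.ideal_zero[OF \<beta>] in auto)
  also have "Z.len {\<zero>\<^bsub>?S\<^esub>} ?\<beta> = Z.len ?\<alpha> (carrier ?S)"
    using Z.ann_length_eq(2)[OF \<alpha>] ann by simp
  finally have len_S: "ring_length ?S = Z.len ?\<alpha> (carrier ?S) + ring_length R" unfolding len_R .
  \<comment> \<open>Cancelling a summand in \<open>enat\<close> requires it to be finite.\<close>
  have "ring_length R \<noteq> \<infinity>" unfolding len_R by (rule Z.len_finite'[OF \<beta> order_refl])
  then have diff: "ring_length ?S - ring_length R = module_length R (quotient_module (ring_module R) (bar ` \<aa>))"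
    unfolding len_S len_Ra by (cases "ring_length R"; cases "Z.len ?\<alpha> (carrier ?S)") auto
  have onto: "maps_onto ?S R" unfolding maps_onto_def using h_hom h_surj by blast
  have "gorenstein_colength R \<le> ring_length ?S - ring_length R"
    unfolding gorenstein_colength_def by (rule Inf_lower) (use Z.gorenstein onto in blast)
  then show ?thesis using Z.gorenstein onto diff by auto
qed

end
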